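(* Let $(\varrho,\mathbf u)$ satisfy the semi-discrete continuity equation $$\int_{\Omega^k}D_t\varrho^k\,\varphi\,dx+\int_{\Omega^k}\mathrm{div}(\varrho^k\mathbf v^k)\,\varphi\,dx=0\quad\text{for all admissible }\varphi\in Q(\Omega^k),\ k=1,\dots,N_T,$$ with the boundary condition $\mathbf u^k=\mathbf w^k$ on $\partial\Omega^k$. Then for every $B\in C^1(\mathbb R)$ and every $k$, $$\frac1\tau\Big(\int_{\Omega^k}B(\varrho^k)\,dx-\int_{\Omega^{k-1}}B(\varrho^{k-1})\,dx\Big)+\int_{\Omega^k}\big(\varrho^kB'(\varrho^k)-B(\varrho^k)\big)\mathrm{div}\,\mathbf u^k\,dx+D_0=0,$$ where $$D_0=\frac1\tau\int_{\Omega^k}\mathcal F_k^{k-1}\Big(B(\varrho^{k-1}\circ X_k^{k-1})-B(\varrho^k)-B'(\varrho^k)\big(\varrho^{k-1}\circ X_k^{k-1}-\varrho^k\big)\Big)dx.$$ Moreover, $D_0\ge0$ if $B$ is convex.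
   Context: $d\in\{2,3\}$, $H>0$, $\Sigma=[0,L_1]\times\cdots\times[0,L_{d-1}]$, $\widehat\Omega=\Sigma\times[0,H]$, points $x=(r,x_d)$, $r\in\Sigma$. $T>0$, $\tau=T/N_T$. For displacements $\eta^k:\Sigma\to(-H,\infty)$, $\eta^k\in W(\Sigma)\subset W_0^{2,2}(\Sigma)$, $k=0,\dots,N_T$, put $\mathcal A^k(\hat r,\hat x_d)=\big(\hat r,\hat x_d\frac{H+\eta^k(\hat r)}H\big)$, $\Omega^k=\mathcal A^k(\widehat\Omega)$, $X_k^{k-1}=\mathcal A^{k-1}\circ(\mathcal A^k)^{-1}:\Omega^k\to\Omega^{k-1}$, $\mathcal F_k^{k-1}(x)=\frac{H+\eta^{k-1}(r)}{H+\eta^k(r)}$, $\mathbf w^k=\big(\mathbf0_{d-1},\frac{\eta^k-\eta^{k-1}}\tau\frac{x_d}{H+\eta^k}\big)^T$, $\mathbf v^k=\mathbf u^k-\mathbf w^k$, and $D_tr^k=\frac{r^k-(r^{k-1}\circ X_k^{k-1})\mathcal F_k^{k-1}}\tau$ for $r^k$ defined on $\Omega^k$. $\varrho^k\in Q(\Omega^k)\subset L^\gamma(\Omega^k)$ ($\gamma>1$), $\mathbf u^k\in V(\Omega^k)\subset W^{1,s}(\Omega^k)$ for all $s<2$. Standing assumption of the semi-discrete setting: the functions are regular enough that all integrals are well defined, and all needed test functions (such as $B'(\varrho^k)$) and integrations by parts are admissible. *)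

theory Defs
  imports "HOL-Analysis.Analysis"
begin

section \<open>Sobolev spaces on open sets\<close>

text \<open>
  Functions are total; only their values on the open set \<open>U\<close> matter, and only up to Lebesgue null
  sets for the notions defined through integrals.
\<close>

primrec Ck :: "nat \<Rightarrow> ('a::euclidean_space \<Rightarrow> 'b::euclidean_space) \<Rightarrow> bool" where
  "Ck 0 f = continuous_on UNIV f"
| "Ck (Suc n) f = ((\<forall>x. f differentiable (at x)) \<and>
                   (\<forall>h. Ck n (\<lambda>x. frechet_derivative f (at x) h)))"

definition test_functions :: "'a::euclidean_space set \<Rightarrow> ('a \<Rightarrow> 'b::euclidean_space) set" where
  "test_functions U = {\<phi>. (\<forall>n. Ck n \<phi>) \<and>
     compact (closure {x. \<phi> x \<noteq> 0}) \<and> closure {x. \<phi> x \<noteq> 0} \<subseteq> U}"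

definition L1_loc :: "'a::euclidean_space set \<Rightarrow> ('a \<Rightarrow> 'b::euclidean_space) set" where
  "L1_loc U = {f. \<forall>K. compact K \<and> K \<subseteq> U \<longrightarrow> set_integrable lebesgue K f}"

definition Lp :: "real \<Rightarrow> 'a::euclidean_space set \<Rightarrow> ('a \<Rightarrow> 'b::euclidean_space) set" where
  "Lp p S = {f \<in> borel_measurable (lebesgue_on S).
               integrable (lebesgue_on S) (\<lambda>x. norm (f x) powr p)}"

definition has_weak_deriv ::
  "'a::euclidean_space set \<Rightarrow> 'a \<Rightarrow> ('a \<Rightarrow> 'b::euclidean_space) \<Rightarrow> ('a \<Rightarrow> 'b) \<Rightarrow> bool" where
  "has_weak_deriv U b f g \<longleftrightarrow> f \<in> L1_loc U \<and> g \<in> L1_loc U \<and>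
     (\<forall>\<phi>::'a \<Rightarrow> real. \<phi> \<in> test_functions U \<longrightarrow>
        (LINT x:U|lebesgue. frechet_derivative \<phi> (at x) b *\<^sub>R f x)
          = - (LINT x:U|lebesgue. \<phi> x *\<^sub>R g x))"

text \<open>
  Weak derivatives and divergences are unique almost everywhere in \<open>U\<close>, so the choices below only
  fix a representative (and a junk value when none exists).
\<close>

definition wderiv ::
  "'a::euclidean_space set \<Rightarrow> 'a \<Rightarrow> ('a \<Rightarrow> 'b::euclidean_space) \<Rightarrow> 'a \<Rightarrow> 'b" where
  "wderiv U b f = (SOME g. has_weak_deriv U b f g)"

definition wgrad :: "'a::euclidean_space set \<Rightarrow> ('a \<Rightarrow> real) \<Rightarrow> 'a \<Rightarrow> 'a" where
  "wgrad U f x = (\<Sum>b\<in>Basis. wderiv U b f x *\<^sub>R b)"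

definition has_weak_div ::
  "'a::euclidean_space set \<Rightarrow> ('a \<Rightarrow> 'a) \<Rightarrow> ('a \<Rightarrow> real) \<Rightarrow> bool" where
  "has_weak_div U F h \<longleftrightarrow> F \<in> L1_loc U \<and> h \<in> L1_loc U \<and>
     (\<forall>\<phi>::'a \<Rightarrow> real. \<phi> \<in> test_functions U \<longrightarrow>
        (LINT x:U|lebesgue. frechet_derivative \<phi> (at x) (F x))
          = - (LINT x:U|lebesgue. \<phi> x * h x))"

definition wdiv :: "'a::euclidean_space set \<Rightarrow> ('a \<Rightarrow> 'a) \<Rightarrow> 'a \<Rightarrow> real" where
  "wdiv U F = (SOME h. has_weak_div U F h)"

primrec sobolev ::
  "nat \<Rightarrow> real \<Rightarrow> 'a::euclidean_space set \<Rightarrow> ('a \<Rightarrow> 'b::euclidean_space) set" where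
  "sobolev 0 p U = Lp p U"
| "sobolev (Suc m) p U =
     {f \<in> Lp p U. \<forall>b\<in>Basis. \<exists>g\<in>sobolev m p U. has_weak_deriv U b f g}"

text \<open>
  The \<open>p\<close>-th power of a norm of \<open>W\<^sup>m\<^sup>,\<^sup>p\<close>; mixed derivatives are counted with
  multiplicity, which gives an equivalent norm.
\<close>

primrec sobolev_norm_powr ::
  "nat \<Rightarrow> real \<Rightarrow> 'a::euclidean_space set \<Rightarrow> ('a \<Rightarrow> 'b::euclidean_space) \<Rightarrow> real" where
  "sobolev_norm_powr 0 p U f = (LINT x:U|lebesgue. norm (f x) powr p)"
| "sobolev_norm_powr (Suc m) p U f = (LINT x:U|lebesgue. norm (f x) powr p)
     + (\<Sum>b\<in>Basis. sobolev_norm_powr m p U (wderiv U b f))"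

definition sobolev0 ::
  "nat \<Rightarrow> real \<Rightarrow> 'a::euclidean_space set \<Rightarrow> ('a \<Rightarrow> 'b::euclidean_space) set" where
  "sobolev0 m p U = {f \<in> sobolev m p U.
     \<exists>\<Phi>. (\<forall>n::nat. \<Phi> n \<in> test_functions U) \<and>
         (\<lambda>n. sobolev_norm_powr m p U (\<lambda>x. \<Phi> n x - f x)) \<longlonglongrightarrow> 0}"

text \<open>
  Velocity fields lie in \<open>W\<^sup>1\<^sup>,\<^sup>s\<close> for all \<open>s < 2\<close>. The moving domain lies below the graph of a
  \<open>W\<^sup>2\<^sup>,\<^sup>2\<close> function and need not be Lipschitz, so vanishing on its boundary is
  understood in the usual sense of \<open>W\<^sub>0\<^sup>1\<^sup>,\<^sup>s\<close>.
\<close>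

definition vel :: "'a::euclidean_space set \<Rightarrow> ('a \<Rightarrow> 'a) set" where
  "vel U = (\<Inter>s\<in>{1..<2}. sobolev 1 s U)"

definition vel0 :: "'a::euclidean_space set \<Rightarrow> ('a \<Rightarrow> 'a) set" where
  "vel0 U = (\<Inter>s\<in>{1..<2}. sobolev0 1 s U)"

text \<open>
  ``Integration by parts is admissible for \<open>g\<close>'': \<open>g\<close> is weakly differentiable and Green's formula,
  which by definition of the weak gradient holds against test fields, extends to all velocity fields
  vanishing on the boundary for which both integrals exist. This is automatic if \<open>g\<close> is in
  \<open>W\<^sup>1\<^sup>,\<^sup>p\<close> for some \<open>p > 2\<close>.
\<close>

definition green_admissible :: "'a::euclidean_space set \<Rightarrow> ('a \<Rightarrow> real) \<Rightarrow> bool" where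
  "green_admissible U g \<longleftrightarrow> (\<forall>b\<in>Basis. \<exists>h. has_weak_deriv U b g h) \<and>
     (\<forall>v\<in>vel0 U. set_integrable lebesgue U (\<lambda>x. g x * wdiv U v x) \<longrightarrow>
        set_integrable lebesgue U (\<lambda>x. wgrad U g x \<bullet> v x) \<longrightarrow>
        (LINT x:U|lebesgue. g x * wdiv U v x) = - (LINT x:U|lebesgue. wgrad U g x \<bullet> v x))"


section \<open>The moving domain\<close>

text \<open>
  A point of \<open>d\<close>-dimensional space is a pair \<open>(r, x\<^sub>d)\<close> with \<open>r\<close> in \<open>(d-1)\<close>-dimensional space, so
  \<open>d = CARD('n) + 1\<close>. In all two-level quantities \<open>\<eta>'\<close> is the displacement at the previous time
  level and \<open>\<eta>\<close> the one at the current level.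
\<close>

definition base :: "real^'n \<Rightarrow> (real^'n) set" where
  "base L = {r. \<forall>i. 0 \<le> r $ i \<and> r $ i \<le> L $ i}"

definition ref_dom :: "real^'n \<Rightarrow> real \<Rightarrow> ((real^'n) \<times> real) set" where
  "ref_dom L H = base L \<times> {0..H}"

definition ale_map :: "real \<Rightarrow> (real^'n \<Rightarrow> real) \<Rightarrow> (real^'n) \<times> real \<Rightarrow> (real^'n) \<times> real" where
  "ale_map H \<eta> = (\<lambda>(r, xd). (r, xd * ((H + \<eta> r) / H)))"

definition cur_dom :: "real^'n \<Rightarrow> real \<Rightarrow> (real^'n \<Rightarrow> real) \<Rightarrow> ((real^'n) \<times> real) set" where
  "cur_dom L H \<eta> = ale_map H \<eta> ` ref_dom L H"

definition back_map ::
  "real^'n \<Rightarrow> real \<Rightarrow> (real^'n \<Rightarrow> real) \<Rightarrow> (real^'n \<Rightarrow> real) \<Rightarrow>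
   (real^'n) \<times> real \<Rightarrow> (real^'n) \<times> real" where
  "back_map L H \<eta>' \<eta> = ale_map H \<eta>' \<circ> inv_into (ref_dom L H) (ale_map H \<eta>)"

definition jac :: "real \<Rightarrow> (real^'n \<Rightarrow> real) \<Rightarrow> (real^'n \<Rightarrow> real) \<Rightarrow> (real^'n) \<times> real \<Rightarrow> real" where
  "jac H \<eta>' \<eta> = (\<lambda>(r, xd). (H + \<eta>' r) / (H + \<eta> r))"

definition mesh_vel ::
  "real \<Rightarrow> real \<Rightarrow> (real^'n \<Rightarrow> real) \<Rightarrow> (real^'n \<Rightarrow> real) \<Rightarrow>
   (real^'n) \<times> real \<Rightarrow> (real^'n) \<times> real" where
  "mesh_vel H \<tau> \<eta>' \<eta> = (\<lambda>(r, xd). (0, (\<eta> r - \<eta>' r) / \<tau> * (xd / (H + \<eta> r))))"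

definition disc_dt ::
  "real^'n \<Rightarrow> real \<Rightarrow> real \<Rightarrow> (real^'n \<Rightarrow> real) \<Rightarrow> (real^'n \<Rightarrow> real) \<Rightarrow>
   ((real^'n) \<times> real \<Rightarrow> real) \<Rightarrow> ((real^'n) \<times> real \<Rightarrow> real) \<Rightarrow> (real^'n) \<times> real \<Rightarrow> real" where
  "disc_dt L H \<tau> \<eta>' \<eta> q' q x = (q x - q' (back_map L H \<eta>' \<eta> x) * jac H \<eta>' \<eta> x) / \<tau>"

definition D0_integrand ::
  "real^'n \<Rightarrow> real \<Rightarrow> (real \<Rightarrow> real) \<Rightarrow> (real^'n \<Rightarrow> real) \<Rightarrow> (real^'n \<Rightarrow> real) \<Rightarrow>
   ((real^'n) \<times> real \<Rightarrow> real) \<Rightarrow> ((real^'n) \<times> real \<Rightarrow> real) \<Rightarrow> (real^'n) \<times> real \<Rightarrow> real" where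
  "D0_integrand L H B \<eta>' \<eta> q' q x = jac H \<eta>' \<eta> x *
     (B (q' (back_map L H \<eta>' \<eta> x)) - B (q x)
        - deriv B (q x) * (q' (back_map L H \<eta>' \<eta> x) - q x))"

definition D0 ::
  "real^'n \<Rightarrow> real \<Rightarrow> real \<Rightarrow> (real \<Rightarrow> real) \<Rightarrow> (real^'n \<Rightarrow> real) \<Rightarrow> (real^'n \<Rightarrow> real) \<Rightarrow>
   ((real^'n) \<times> real \<Rightarrow> real) \<Rightarrow> ((real^'n) \<times> real \<Rightarrow> real) \<Rightarrow> real" where
  "D0 L H \<tau> B \<eta>' \<eta> q' q =
     1 / \<tau> * (LINT x:cur_dom L H \<eta>|lebesgue. D0_integrand L H B \<eta>' \<eta> q' q x)"

end

theory Submission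
  imports Defs
begin

text \<open>
The proof tests the continuity equation with \<open>B'(\<rho>)\<close>. Write \<open>X\<close> for the back map, \<open>J\<close> for its
Jacobian, \<open>\<rho>'\<close> for the previous density and \<open>v = u - w\<close>. The discrete time derivative splits pointwise as
\<open>\<tau> D\<^sub>t\<rho> B'(\<rho>) = J (B(\<rho>'\<circ>X) - B(\<rho>) - B'(\<rho>)(\<rho>'\<circ>X - \<rho>)) + B(\<rho>) - J B(\<rho>'\<circ>X) + (1 - J)(\<rho> B'(\<rho>) - B(\<rho>))\<close>.
The first summand is the integrand of \<open>D\<^sub>0\<close>, nonnegative for convex \<open>B\<close> since the graph lies above its
tangents. The map \<open>X\<close> stretches vertical lines by the factor \<open>J\<close>, so \<open>J B(\<rho>'\<circ>X)\<close> integrates to the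
integral of \<open>B(\<rho>')\<close> over the previous domain (\<open>transport_integral\<close>). The factor \<open>(1 - J) / \<tau>\<close> is the
divergence of the mesh velocity \<open>w\<close> (\<open>has_weak_div_mesh_vel\<close>); it turns \<open>div v\<close> into \<open>div u\<close> in the
convective term, which is \<open>div(\<rho> v) B'(\<rho>) = \<rho> B'(\<rho>) div v + \<nabla>B(\<rho>) \<bullet> v\<close> with
\<open>\<integral> \<nabla>B(\<rho>) \<bullet> v = - \<integral> B(\<rho>) div v\<close> by Green's formula. The boundary of the domain is a null set
(\<open>cur_dom_interior_AE\<close>), so integrals over the closed and the open domain agree.

The analytic content is the treatment of the convective term at the low regularity of \<open>\<rho>\<close> and \<open>v\<close>.
The product rule (\<open>wdiv_product_rule\<close>) comes from Green's formula for \<open>\<rho>\<close> applied to \<open>\<phi> v\<close> with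
a test function \<open>\<phi>\<close>, which again vanishes on the boundary (\<open>vel0_scaleR_test\<close>). In the chain rule
(\<open>weak_chain_rule\<close>) the derivative of \<open>B\<close> may be unbounded, but
\<open>\<rho>\<close> and \<open>B(\<rho>)\<close> are both weakly differentiable. Their difference quotients converge almost everywhere to the weak
derivatives along a common sequence of step sizes (\<open>weak_deriv_difference_quotients\<close>), so that the
classical pointwise chain rule identifies the limits. That convergence rests on a
weak form of the fundamental theorem of calculus and on the continuity of translations in the mean
(\<open>shift_gap_tendsto_0\<close>). All these identities are tested first and then
hold almost everywhere by the fundamental lemma of the calculus of variations (\<open>fundamental_lemma\<close>), here with
test functions built from \<open>e\<^sup>-\<^sup>1\<^sup>/\<^sup>t\<close>.
\<close>

section \<open>Smooth functions and test functions\<close>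

abbreviation fderiv :: "('a::euclidean_space \<Rightarrow> 'b::euclidean_space) \<Rightarrow> 'a \<Rightarrow> 'a \<Rightarrow> 'b" where
  "fderiv f x \<equiv> frechet_derivative f (at x)"

abbreviation smooth :: "('a::euclidean_space \<Rightarrow> 'b::euclidean_space) \<Rightarrow> bool" where
  "smooth f \<equiv> \<forall>n. Ck n f"

lemma Ck_SucI:
  assumes "\<And>x. (f has_derivative F x) (at x)" "\<And>h. Ck n (\<lambda>x. F x h)"
  shows "Ck (Suc n) f"
proof -
  have "fderiv f x = F x" for x
    using frechet_derivative_at[OF assms(1)] by metis
  then show ?thesis
    using assms by (auto simp: differentiable_def)
qed

lemma Ck_Suc_has_derivative:
  "Ck (Suc n) f \<Longrightarrow> (f has_derivative fderiv f x) (at x)"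
  by (simp add: frechet_derivative_works[symmetric])

lemma Ck_SucD: "Ck (Suc n) f \<Longrightarrow> Ck n f"
proof (induction n arbitrary: f)
  case 0
  then show ?case
    by (auto intro!: continuous_at_imp_continuous_on differentiable_imp_continuous_within)
next
  case (Suc n)
  then show ?case by (metis Ck.simps(2))
qed

lemma Ck_const: "Ck n (\<lambda>x. c)"
proof (induction n arbitrary: c)
  case (Suc n)
  show ?case by (rule Ck_SucI[where F = "\<lambda>x h. 0"]) (auto intro: Suc)
qed auto

lemma Ck_add: "Ck n f \<Longrightarrow> Ck n g \<Longrightarrow> Ck n (\<lambda>x. f x + g x)"
proof (induction n arbitrary: f g)
  case 0
  then show ?case by (auto intro: continuous_intros)
next
  case (Suc n)
  show ?case
    using Suc.prems Suc.IH
    by (intro Ck_SucI[where F = "\<lambda>x h. fderiv f x h + fderiv g x h"])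
       (auto intro!: has_derivative_add Ck_Suc_has_derivative)
qed

lemma Ck_bounded_linear:
  fixes A :: "'b::euclidean_space \<Rightarrow> 'c::euclidean_space"
  assumes A: "bounded_linear A"
  shows "Ck n f \<Longrightarrow> Ck n (\<lambda>x. A (f x))"
proof (induction n arbitrary: f)
  case 0
  then show ?case by (auto intro: bounded_linear.continuous_on[OF A])
next
  case (Suc n)
  show ?case
    using Suc
    by (intro Ck_SucI[where F = "\<lambda>x h. A (fderiv f x h)"])
       (auto intro!: bounded_linear.has_derivative[OF A] Ck_Suc_has_derivative)
qed

lemma Ck_bounded_bilinear:
  fixes p :: "'b::euclidean_space \<Rightarrow> 'c::euclidean_space \<Rightarrow> 'd::euclidean_space"
  assumes p: "bounded_bilinear p"
  shows "Ck n f \<Longrightarrow> Ck n g \<Longrightarrow> Ck n (\<lambda>x. p (f x) (g x))"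
proof (induction n arbitrary: f g)
  case 0
  then show ?case by (auto intro: bounded_bilinear.continuous_on[OF p])
next
  case (Suc n)
  show ?case
  proof (rule Ck_SucI)
    show "((\<lambda>x. p (f x) (g x)) has_derivative (\<lambda>h. p (f x) (fderiv g x h)
        + p (fderiv f x h) (g x))) (at x)" for x
      using Suc.prems by (intro bounded_bilinear.FDERIV[OF p] Ck_Suc_has_derivative)
    show "Ck n (\<lambda>x. p (f x) (fderiv g x h)
        + p (fderiv f x h) (g x))" for h
      using Suc.prems Ck_SucD[OF Suc.prems(1)] Ck_SucD[OF Suc.prems(2)]
      by (intro Ck_add Suc.IH) auto
  qed
qed

lemma Ck_translation: "Ck n f \<Longrightarrow> Ck n (\<lambda>x. f (x + c))"
proof (induction n arbitrary: f)
  case 0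
  then have "continuous_on UNIV f" by simp
  then have "continuous_on UNIV (\<lambda>x. f (x + c))"
    by (rule continuous_on_compose2) (auto intro!: continuous_on_add continuous_on_const continuous_on_id)
  then show ?case by simp
next
  case (Suc n)
  show ?case
  proof (rule Ck_SucI)
    show "((\<lambda>x. f (x + c)) has_derivative fderiv f (x + c)) (at x)" for x
    proof (rule has_derivative_eq_rhs)
      show "((\<lambda>x. f (x + c)) has_derivative (\<lambda>h. fderiv f (x + c) (h + 0))) (at x)"
        by (rule has_derivative_compose[where f = "\<lambda>x. x + c", OF _ Ck_Suc_has_derivative[OF Suc.prems]])
           (intro has_derivative_add has_derivative_ident has_derivative_const)
    qed simp
    show "Ck n (\<lambda>x. fderiv f (x + c) h)" for h
      using Suc by auto
  qed
qed

lemma Ck_compose_affine: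
  fixes d :: "nat \<Rightarrow> real \<Rightarrow> real" and c :: "'a::euclidean_space"
  assumes "\<And>m t. (d m has_real_derivative d (Suc m) t) (at t)"
  shows "Ck n (\<lambda>x. d m (x \<bullet> c + e))"
proof (induction n arbitrary: m)
  case 0
  have "continuous_on UNIV (d m)"
    by (intro continuous_at_imp_continuous_on ballI DERIV_isCont[OF assms])
  then have *: "continuous_on UNIV (\<lambda>x. d m (x \<bullet> c + e))"
    by (rule continuous_on_compose2) (intro continuous_on_add continuous_on_inner continuous_on_const continuous_on_id subset_UNIV)+
  show ?case
    unfolding Ck.simps by (fact *)
next
  case (Suc n)
  show ?case
  proof (rule Ck_SucI[where F = "\<lambda>x h. d (Suc m) (x \<bullet> c + e) * (h \<bullet> c)"])
    show "((\<lambda>x. d m (x \<bullet> c + e)) has_derivative (\<lambda>h. d (Suc m) (x \<bullet> c + e) * (h \<bullet> c))) (at x)" for x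
    proof -
      have "((\<lambda>x. x \<bullet> c + e) has_derivative (\<lambda>h. h \<bullet> c)) (at x)"
        by (auto intro!: derivative_eq_intros)
      from has_derivative_compose[OF this assms[of m, unfolded has_field_derivative_def]]
      show ?thesis .
    qed
    show "Ck n (\<lambda>x. d (Suc m) (x \<bullet> c + e) * (h \<bullet> c))" for h
      using Ck_bounded_linear[OF bounded_linear_mult_left Suc] .
  qed
qed

lemma Ck_prod:
  fixes f :: "'i \<Rightarrow> 'a::euclidean_space \<Rightarrow> real"
  assumes "\<And>i. i \<in> I \<Longrightarrow> Ck n (f i)"
  shows "Ck n (\<lambda>x. \<Prod>i\<in>I. f i x)"
  using assms
proof (induction I rule: infinite_finite_induct)
  case (insert i I)
  then show ?case
    using Ck_bounded_bilinear[OF bounded_bilinear_mult, of n "f i" "\<lambda>x. \<Prod>i\<in>I. f i x"] by simp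
qed (auto intro: Ck_const)

text \<open>
  The functions \<open>p(1/t) e\<^sup>-\<^sup>1\<^sup>/\<^sup>t\<close>, extended by zero, form a family that is closed under
  differentiation; this is the shortest way to see that \<open>e\<^sup>-\<^sup>1\<^sup>/\<^sup>t\<close> is smooth.
\<close>

definition flat :: "real poly \<Rightarrow> real \<Rightarrow> real" where
  "flat p t = (if t > 0 then poly p (1 / t) * exp (- (1 / t)) else 0)"

lemma flat_tendsto_0: "(flat p \<longlongrightarrow> 0) (at_right 0)"
proof -
  have "((\<lambda>x. poly p x / exp x) \<longlongrightarrow> (\<Sum>i\<le>degree p. coeff p i * 0)) at_top"
    unfolding poly_altdef sum_divide_distrib times_divide_eq_right[symmetric]
    by (intro tendsto_intros tendsto_power_div_exp_0)
  then have "((\<lambda>t. poly p (inverse t) / exp (inverse t)) \<longlongrightarrow> 0) (at_right 0)"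
    by (intro filterlim_compose[OF _ filterlim_inverse_at_top_right]) simp
  then show ?thesis
    by (rule Lim_transform_eventually)
       (auto simp: flat_def eventually_at_filter exp_minus divide_inverse)
qed

lemma flat_has_derivative:
  "(flat p has_real_derivative flat ([:0, 0, 1:] * (p - pderiv p)) t) (at t)"
proof -
  consider "t > 0" | "t < 0" | "t = 0" by linarith
  then show ?thesis
  proof cases
    case 1
    have "((\<lambda>t. poly p (1 / t) * exp (- (1 / t))) has_real_derivative
        flat ([:0, 0, 1:] * (p - pderiv p)) t) (at t)"
      using 1 by (auto intro!: derivative_eq_intros simp: flat_def power2_eq_square field_simps)
    then show ?thesis
      by (rule has_field_derivative_transform_within_open[where S = "{0<..}"])
         (use 1 in \<open>auto simp: flat_def\<close>)
  next
    case 2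
    have "((\<lambda>t. 0) has_real_derivative flat ([:0, 0, 1:] * (p - pderiv p)) t) (at t)"
      using 2 by (auto simp: flat_def)
    then show ?thesis
      by (rule has_field_derivative_transform_within_open[where S = "{..<0}"])
         (use 2 in \<open>auto simp: flat_def\<close>)
  next
    case 3
    have "((\<lambda>h. (flat p (0 + h) - flat p 0) / h) \<longlongrightarrow> 0) (at_right 0)"
      using flat_tendsto_0[of "[:0, 1:] * p"]
      by (rule Lim_transform_eventually) (auto simp: flat_def eventually_at_filter)
    moreover have "((\<lambda>h. (flat p (0 + h) - flat p 0) / h) \<longlongrightarrow> 0) (at_left 0)"
      by (rule Lim_transform_eventually[of "\<lambda>h. 0"]) (auto simp: flat_def eventually_at_filter)
    ultimately have "((\<lambda>h. (flat p (0 + h) - flat p 0) / h) \<longlongrightarrow> 0) (at 0)"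
      by (rule filterlim_split_at[rotated])
    then show ?thesis
      using 3 by (auto simp: DERIV_def flat_def)
  qed
qed

lemma smooth_flat_affine: "smooth (\<lambda>x. flat 1 (x \<bullet> c + e))"
proof
  fix n
  define d where "d m = flat (((\<lambda>p. [:0, 0, 1:] * (p - pderiv p)) ^^ m) 1)" for m
  have "(d m has_real_derivative d (Suc m) t) (at t)" for m t
    using flat_has_derivative by (simp add: d_def)
  from Ck_compose_affine[of d n 0, OF this] show "Ck n (\<lambda>x. flat 1 (x \<bullet> c + e))"
    by (simp add: d_def)
qed

text \<open>
  The box bump increases with \<open>n\<close> to the indicator of the open box, so test functions determine
  the integrals of a function over boxes.
\<close>

definition box_bump :: "nat \<Rightarrow> 'a \<Rightarrow> 'a \<Rightarrow> 'a::euclidean_space \<Rightarrow> real" where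
  "box_bump n a b x = (\<Prod>i\<in>Basis. flat 1 (real n * (x \<bullet> i - a \<bullet> i)) * flat 1 (real n * (b \<bullet> i - x \<bullet> i)))"

lemma smooth_box_bump: "smooth (box_bump n a b)"
proof
  fix m
  have "(\<lambda>x. flat 1 (real n * (x \<bullet> i - a \<bullet> i))) = (\<lambda>x. flat 1 (x \<bullet> (real n *\<^sub>R i) + - (real n * (a \<bullet> i))))"
    "(\<lambda>x. flat 1 (real n * (b \<bullet> i - x \<bullet> i))) = (\<lambda>x. flat 1 (x \<bullet> (- real n *\<^sub>R i) + real n * (b \<bullet> i)))" for i
    by (simp_all add: right_diff_distrib)
  then have "Ck m (\<lambda>x. flat 1 (real n * (x \<bullet> i - a \<bullet> i)))" "Ck m (\<lambda>x. flat 1 (real n * (b \<bullet> i - x \<bullet> i)))" for i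
    using smooth_flat_affine by metis+
  then have "Ck m (\<lambda>x. \<Prod>i\<in>Basis. flat 1 (real n * (x \<bullet> i - a \<bullet> i)) * flat 1 (real n * (b \<bullet> i - x \<bullet> i)))"
    by (intro Ck_prod Ck_bounded_bilinear[OF bounded_bilinear_mult])
  then show "Ck m (box_bump n a b)"
    by (simp add: box_bump_def[abs_def])
qed

lemma flat_1_bounds: "0 \<le> flat 1 t" "flat 1 t \<le> 1"
  by (auto simp: flat_def)

lemma box_bump_bounds: "0 \<le> box_bump n a b x" "box_bump n a b x \<le> 1"
  unfolding box_bump_def
  by (simp_all add: prod_nonneg prod_le_1 mult_le_one flat_1_bounds)

lemma box_bump_support:
  assumes "x \<notin> box a b"
  shows "box_bump n a b x = 0"
proof -
  obtain i where i: "i \<in> Basis" "x \<bullet> i - a \<bullet> i \<le> 0 \<or> b \<bullet> i - x \<bullet> i \<le> 0"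
    using assms by (force simp: mem_box not_less)
  then have "real n * (x \<bullet> i - a \<bullet> i) \<le> 0 \<or> real n * (b \<bullet> i - x \<bullet> i) \<le> 0"
    by (auto intro: mult_nonneg_nonpos)
  then have "flat 1 (real n * (x \<bullet> i - a \<bullet> i)) * flat 1 (real n * (b \<bullet> i - x \<bullet> i)) = 0"
    by (auto simp: flat_def)
  with i(1) show ?thesis
    unfolding box_bump_def by (intro prod_zero) auto
qed

lemma flat_scaled_tendsto: "(\<lambda>n. flat 1 (real n * s)) \<longlonglongrightarrow> indicator {0<..} s"
proof (cases "s > 0")
  case True
  have "(\<lambda>n. exp (- (inverse (real n) * (1 / s)))) \<longlonglongrightarrow> exp (- (0 * (1 / s)))"
    by (intro tendsto_intros lim_inverse_n)
  moreover have "eventually (\<lambda>n. exp (- (inverse (real n) * (1 / s))) = flat 1 (real n * s)) sequentially"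
    using eventually_gt_at_top[of 0] by eventually_elim (use True in \<open>auto simp: flat_def field_simps\<close>)
  ultimately show ?thesis
    using True by (auto intro: Lim_transform_eventually)
next
  case False
  then have "flat 1 (real n * s) = 0" for n
    by (auto simp: flat_def mult_less_0_iff zero_less_mult_iff)
  then show ?thesis using False by simp
qed

lemma box_bump_tendsto: "(\<lambda>n. box_bump n a b x) \<longlonglongrightarrow> indicator (box a b) x"
proof -
  have "(\<Prod>i\<in>Basis. indicator {0<..} (x \<bullet> i - a \<bullet> i) * indicator {0<..} (b \<bullet> i - x \<bullet> i)) =
      (indicator (box a b) x :: real)"
  proof (cases "x \<in> box a b")
    case True
    then show ?thesis by (simp add: mem_box indicator_def)
  next
    case False
    then obtain i where "i \<in> Basis" "\<not> (a \<bullet> i < x \<bullet> i \<and> x \<bullet> i < b \<bullet> i)"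
      by (auto simp: mem_box)
    then have "\<exists>i\<in>Basis. indicator {0<..} (x \<bullet> i - a \<bullet> i) * indicator {0<..} (b \<bullet> i - x \<bullet> i) = (0::real)"
      by (intro bexI[of _ i]) (auto simp: indicator_def)
    then show ?thesis using False by simp
  qed
  moreover have "(\<lambda>n. box_bump n a b x) \<longlonglongrightarrow>
      (\<Prod>i\<in>Basis. indicator {0<..} (x \<bullet> i - a \<bullet> i) * indicator {0<..} (b \<bullet> i - x \<bullet> i))"
    unfolding box_bump_def by (intro tendsto_prod tendsto_mult flat_scaled_tendsto)
  ultimately show ?thesis by simp
qed

definition Cc :: "'a::euclidean_space set \<Rightarrow> ('a \<Rightarrow> 'b::euclidean_space) set" where
  "Cc U = {\<phi>. continuous_on UNIV \<phi> \<and> compact (closure {x. \<phi> x \<noteq> 0}) \<and> closure {x. \<phi> x \<noteq> 0} \<subseteq> U}"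

lemma CcI:
  assumes "continuous_on UNIV \<phi>" "compact K" "K \<subseteq> U" "\<And>x. \<phi> x \<noteq> 0 \<Longrightarrow> x \<in> K"
  shows "\<phi> \<in> Cc U"
proof -
  have "closure {x. \<phi> x \<noteq> 0} \<subseteq> K"
    using assms by (intro closure_minimal compact_imp_closed) auto
  then show ?thesis
    using assms bounded_subset[OF compact_imp_bounded[OF assms(2)]]
    by (auto simp: Cc_def subset_eq)
qed

lemma CcE:
  assumes "\<phi> \<in> Cc U"
  obtains K where "compact K" "K \<subseteq> U" "\<And>x. x \<notin> K \<Longrightarrow> \<phi> x = 0" "continuous_on UNIV \<phi>"
proof (rule that[of "closure {x. \<phi> x \<noteq> 0}"])
  show "\<phi> x = 0" if "x \<notin> closure {x. \<phi> x \<noteq> 0}" for x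
    using that closure_subset[of "{x. \<phi> x \<noteq> 0}"] by auto
qed (use assms in \<open>auto simp: Cc_def\<close>)

lemma Cc_bounded:
  fixes \<phi> :: "'a::euclidean_space \<Rightarrow> 'b::euclidean_space"
  assumes "\<phi> \<in> Cc U"
  obtains M where "M \<ge> 0" "\<And>x. norm (\<phi> x) \<le> M"
proof -
  obtain K where K: "compact K" "\<And>x. x \<notin> K \<Longrightarrow> \<phi> x = 0" "continuous_on UNIV \<phi>"
    using assms by (auto elim: CcE)
  then have "compact (\<phi> ` K)"
    by (meson compact_continuous_image continuous_on_subset subset_UNIV)
  then obtain M where M: "M > 0" "\<forall>y\<in>\<phi> ` K. norm y \<le> M"
    using compact_imp_bounded bounded_pos by metis
  have "norm (\<phi> x) \<le> M" for x
  proof (cases "x \<in> K")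
    case True
    with M show ?thesis by blast
  next
    case False
    with M K show ?thesis by simp
  qed
  with M show ?thesis
    by (intro that[of M]) auto
qed

lemma test_functionsI:
  assumes "smooth \<phi>" "compact K" "K \<subseteq> U" "\<And>x. \<phi> x \<noteq> 0 \<Longrightarrow> x \<in> K"
  shows "\<phi> \<in> test_functions U"
proof -
  have "\<phi> \<in> Cc U"
    using assms by (intro CcI[of \<phi> K]) (auto dest: spec[of _ 0])
  with assms(1) show ?thesis by (auto simp: test_functions_def Cc_def)
qed

lemma test_functions_smooth: "\<phi> \<in> test_functions U \<Longrightarrow> Ck n \<phi>"
  by (auto simp: test_functions_def)

lemma test_functions_Cc: "\<phi> \<in> test_functions U \<Longrightarrow> \<phi> \<in> Cc U"
  by (auto simp: test_functions_def Cc_def dest: spec[of _ 0])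

lemma test_functions_has_derivative:
  "\<phi> \<in> test_functions U \<Longrightarrow> (\<phi> has_derivative fderiv \<phi> x) (at x)"
  using Ck_Suc_has_derivative test_functions_smooth by blast

lemma test_functions_deriv:
  assumes "\<phi> \<in> test_functions U"
  shows "(\<lambda>x. fderiv \<phi> x h) \<in> test_functions U"
proof -
  obtain K where K: "compact K" "K \<subseteq> U" "\<And>x. x \<notin> K \<Longrightarrow> \<phi> x = 0"
    using test_functions_Cc[OF assms] by (auto elim: CcE)
  have "x \<in> K" if "fderiv \<phi> x h \<noteq> 0" for x
  proof (rule ccontr)
    assume "x \<notin> K"
    then have "(\<phi> has_derivative (\<lambda>h. 0)) (at x)"
      using K compact_imp_closed
      by (intro has_derivative_transform_within_open[of "\<lambda>x. 0" "\<lambda>h. 0" x UNIV "- K" \<phi>]) auto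
    then have "fderiv \<phi> x = (\<lambda>h. 0)"
      using frechet_derivative_at by metis
    with that show False by simp
  qed
  moreover have "smooth (\<lambda>x. fderiv \<phi> x h)"
    using test_functions_smooth[OF assms] Ck.simps(2) by blast
  ultimately show ?thesis
    using K by (intro test_functionsI[of _ K]) auto
qed

lemma test_functions_bilinear:
  fixes p :: "'b::euclidean_space \<Rightarrow> 'c::euclidean_space \<Rightarrow> 'd::euclidean_space"
  assumes p: "bounded_bilinear p" and "\<phi> \<in> test_functions U" "smooth \<psi>"
  shows "(\<lambda>x. p (\<phi> x) (\<psi> x)) \<in> test_functions U"
proof -
  obtain K where K: "compact K" "K \<subseteq> U" "\<And>x. x \<notin> K \<Longrightarrow> \<phi> x = 0"
    using test_functions_Cc[OF assms(2)] by (auto elim: CcE)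
  have "p (\<phi> x) (\<psi> x) \<noteq> 0 \<Longrightarrow> x \<in> K" for x
    using K(3) bounded_bilinear.zero_left[OF p] by metis
  with K show ?thesis
    using assms Ck_bounded_bilinear[OF p test_functions_smooth[OF assms(2)]]
    by (intro test_functionsI[of _ K]) auto
qed

lemma test_functions_translation:
  assumes "\<phi> \<in> test_functions V" "(\<lambda>x. x - c) ` V \<subseteq> U"
  shows "(\<lambda>x. \<phi> (x + c)) \<in> test_functions U"
proof -
  obtain K where K: "compact K" "K \<subseteq> V" "\<And>x. x \<notin> K \<Longrightarrow> \<phi> x = 0"
    using test_functions_Cc[OF assms(1)] by (auto elim: CcE)
  show ?thesis
  proof (rule test_functionsI)
    show "smooth (\<lambda>x. \<phi> (x + c))"
      using test_functions_smooth[OF assms(1)] by (auto intro: Ck_translation)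
    show "compact ((\<lambda>x. x - c) ` K)"
      using K compact_translation_subtract by blast
    show "(\<lambda>x. x - c) ` K \<subseteq> U"
      using K assms by blast
    show "\<phi> (x + c) \<noteq> 0 \<Longrightarrow> x \<in> (\<lambda>x. x - c) ` K" for x
      using K(3)[of "x + c"] by (metis add_diff_cancel image_eqI)
  qed
qed

lemma frechet_derivative_translation:
  assumes "\<phi> \<in> test_functions V"
  shows "fderiv (\<lambda>x. \<phi> (x + c)) x = fderiv \<phi> (x + c)"
proof -
  have "((\<lambda>x. \<phi> (x + c)) has_derivative (\<lambda>h. fderiv \<phi> (x + c) (h + 0))) (at x)"
    by (rule has_derivative_compose[where f = "\<lambda>x. x + c", OF _ test_functions_has_derivative[OF assms]])
       (intro has_derivative_add has_derivative_ident has_derivative_const)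
  then show ?thesis using frechet_derivative_at[of "\<lambda>x. \<phi> (x + c)"] by simp
qed

lemma box_bump_test:
  assumes "cbox a b \<subseteq> U"
  shows "box_bump n a b \<in> test_functions U"
proof (rule test_functionsI)
  show "x \<in> cbox a b" if "box_bump n a b x \<noteq> 0" for x
    using that box_bump_support box_subset_cbox subsetD by metis
qed (use assms in \<open>auto intro: smooth_box_bump[rule_format]\<close>)

section \<open>Almost everywhere equality for Lebesgue measure\<close>

text \<open>
Weak derivatives are known only almost everywhere. The following variants of the congruence rules for
integrals make no measurability assumption on the second function: completeness of Lebesgue measure
supplies it.
\<close>

lemma borel_measurable_lebesgue_cong_AE:
  fixes f g :: "'a::euclidean_space \<Rightarrow> 'b::euclidean_space"
  assumes "AE x in lebesgue. f x = g x" "f \<in> borel_measurable lebesgue"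
  shows "g \<in> borel_measurable lebesgue"
proof (rule measurableI)
  fix A :: "'b set" assume A: "A \<in> sets borel"
  have "f -` A \<inter> space lebesgue \<in> sets lebesgue"
    using assms(2) A by (rule measurable_sets)
  moreover have "AE x in lebesgue. x \<in> f -` A \<inter> space lebesgue \<longleftrightarrow> x \<in> g -` A \<inter> space lebesgue"
    using assms(1) by eventually_elim simp
  ultimately show "g -` A \<inter> space lebesgue \<in> sets lebesgue"
    using completion.in_sets_AE[of "f -` A \<inter> space lebesgue" "g -` A \<inter> space lebesgue" lborel] by simp
qed auto

lemma integrable_lebesgue_cong_AE:
  fixes f g :: "'a::euclidean_space \<Rightarrow> 'b::euclidean_space"
  assumes "AE x in lebesgue. f x = g x" "integrable lebesgue f"
  shows "integrable lebesgue g" "integral\<^sup>L lebesgue g = integral\<^sup>L lebesgue f"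
proof -
  have [measurable]: "f \<in> borel_measurable lebesgue" "g \<in> borel_measurable lebesgue"
    using assms borel_measurable_lebesgue_cong_AE[OF assms(1)] by auto
  show "integrable lebesgue g"
    using assms by (subst integrable_cong_AE[where g = f]) auto
  show "integral\<^sup>L lebesgue g = integral\<^sup>L lebesgue f"
    using assms by (intro integral_cong_AE) auto
qed

lemma set_integrable_lebesgue_cong_AE:
  fixes f g :: "'a::euclidean_space \<Rightarrow> 'b::euclidean_space"
  assumes "AE x in lebesgue. x \<in> S \<longrightarrow> f x = g x" "set_integrable lebesgue S f"
  shows "set_integrable lebesgue S g" "(LINT x:S|lebesgue. g x) = (LINT x:S|lebesgue. f x)"
proof -
  have "AE x in lebesgue. indicat_real S x *\<^sub>R f x = indicat_real S x *\<^sub>R g x"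
    using assms(1) by eventually_elim (auto simp: indicator_def)
  from integrable_lebesgue_cong_AE[OF this] assms(2)
  show "set_integrable lebesgue S g" "(LINT x:S|lebesgue. g x) = (LINT x:S|lebesgue. f x)"
    by (simp_all add: set_integrable_def set_lebesgue_integral_def)
qed

lemma integrable_lebesgue_borel_representative:
  fixes f :: "'a::euclidean_space \<Rightarrow> real"
  assumes "integrable lebesgue f"
  obtains g where "g \<in> borel_measurable borel" "integrable lborel g" "AE x in lebesgue. f x = g x"
proof -
  obtain g where g: "g \<in> borel_measurable lborel" "AE x in lborel. f x = g x"
    using completion_ex_borel_measurable_real[OF borel_measurable_integrable[OF assms]] by auto
  have ae: "AE x in lebesgue. f x = g x"
    using g(2) by (rule AE_completion)
  have "integrable lborel g"
    using integrable_lebesgue_cong_AE(1)[OF ae assms] g(1) integrable_completion by blast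
  with g ae show ?thesis by (intro that[of g]) auto
qed

lemma integrable_scaleR_bounded:
  fixes f :: "'a \<Rightarrow> 'b::euclidean_space" and k :: "'a \<Rightarrow> real"
  assumes "integrable N f" "k \<in> borel_measurable N" "\<And>x. \<bar>k x\<bar> \<le> M"
  shows "integrable N (\<lambda>x. k x *\<^sub>R f x)"
proof (rule Bochner_Integration.integrable_bound)
  show "integrable N (\<lambda>x. M * norm (f x))"
    using assms by simp
  show "(\<lambda>x. k x *\<^sub>R f x) \<in> borel_measurable N"
    using assms by measurable
  show "AE x in N. norm (k x *\<^sub>R f x) \<le> norm (M * norm (f x))"
    using assms(3) by (auto intro!: AE_I2 simp: abs_mult intro!: mult_right_mono order_trans[OF _ abs_ge_self])
qed

section \<open>Locally integrable functions\<close>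

lemma L1_locD: "f \<in> L1_loc U \<Longrightarrow> compact K \<Longrightarrow> K \<subseteq> U \<Longrightarrow> set_integrable lebesgue K f"
  by (simp add: L1_loc_def)

lemma L1_loc_add: "f \<in> L1_loc U \<Longrightarrow> g \<in> L1_loc U \<Longrightarrow> (\<lambda>x. f x + g x) \<in> L1_loc U"
  by (auto simp: L1_loc_def intro!: set_integral_add)

lemma L1_loc_diff: "f \<in> L1_loc U \<Longrightarrow> g \<in> L1_loc U \<Longrightarrow> (\<lambda>x. f x - g x) \<in> L1_loc U"
  by (auto simp: L1_loc_def intro!: set_integral_diff)

lemma L1_loc_zero: "(\<lambda>x. 0) \<in> L1_loc U"
  by (auto simp: L1_loc_def set_integrable_def)

lemma L1_loc_sum: "(\<And>i. i \<in> I \<Longrightarrow> f i \<in> L1_loc U) \<Longrightarrow> (\<lambda>x. \<Sum>i\<in>I. f i x) \<in> L1_loc U"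
  by (induction I rule: infinite_finite_induct) (auto intro: L1_loc_zero L1_loc_add)

lemma L1_loc_bounded_linear:
  fixes A :: "'b::euclidean_space \<Rightarrow> 'c::euclidean_space"
  assumes A: "bounded_linear A" and "f \<in> L1_loc U"
  shows "(\<lambda>x. A (f x)) \<in> L1_loc U"
proof -
  have "indicat_real K x *\<^sub>R A (f x) = A (indicat_real K x *\<^sub>R f x)" for K x
    using bounded_linear.linear[OF A] by (simp add: linear_cmul)
  then show ?thesis
    using assms by (auto simp: L1_loc_def set_integrable_def intro!: integrable_bounded_linear[OF A])
qed

lemma L1_loc_scaleR_continuous:
  fixes f :: "'a::euclidean_space \<Rightarrow> 'b::euclidean_space"
  assumes "f \<in> L1_loc U" and k: "continuous_on U k"
  shows "(\<lambda>x. k x *\<^sub>R f x) \<in> L1_loc U"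
  unfolding L1_loc_def
proof safe
  fix K assume K: "compact K" "K \<subseteq> U"
  have kK: "continuous_on K k" using k K continuous_on_subset by blast
  then have "compact (k ` K)" using K compact_continuous_image by blast
  then obtain M where M: "M > 0" "\<forall>y\<in>k ` K. norm y \<le> M"
    using compact_imp_bounded bounded_pos by metis
  have "(\<lambda>x. indicator K x *\<^sub>R k x) \<in> borel_measurable borel"
    using K kK by (intro borel_measurable_continuous_on_indicator) (auto intro: borel_compact)
  then have "integrable lebesgue (\<lambda>x. (indicator K x *\<^sub>R k x) *\<^sub>R (indicator K x *\<^sub>R f x))"
    using L1_locD[OF assms(1) K] M
    by (intro integrable_scaleR_bounded[where M = M and k = "\<lambda>x. indicator K x *\<^sub>R k x"])
       (auto simp: set_integrable_def indicator_def intro: measurable_completion)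
  also have "(\<lambda>x. (indicator K x *\<^sub>R k x) *\<^sub>R (indicator K x *\<^sub>R f x)) = (\<lambda>x. indicator K x *\<^sub>R (k x *\<^sub>R f x))"
    by (auto simp: indicator_def)
  finally show "set_integrable lebesgue K (\<lambda>x. k x *\<^sub>R f x)"
    by (simp add: set_integrable_def)
qed

lemma L1_loc_continuous:
  fixes f :: "'a::euclidean_space \<Rightarrow> 'b::euclidean_space"
  assumes "continuous_on U f"
  shows "f \<in> L1_loc U"
  unfolding L1_loc_def
proof safe
  fix K assume K: "compact K" "K \<subseteq> U"
  have "integrable lborel (\<lambda>x. indicator K x *\<^sub>R f x)"
    using K assms continuous_on_subset by (intro borel_integrable_compact) auto
  then show "set_integrable lebesgue K f"
    unfolding set_integrable_def using integrable_completion borel_measurable_integrable by blast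
qed

lemma Cc_measurable:
  fixes \<phi> :: "'a::euclidean_space \<Rightarrow> 'b::euclidean_space"
  assumes "\<phi> \<in> Cc U"
  shows "\<phi> \<in> borel_measurable borel" "\<phi> \<in> borel_measurable lebesgue"
proof -
  show 1: "\<phi> \<in> borel_measurable borel"
    using assms by (auto simp: Cc_def intro: borel_measurable_continuous_onI)
  show "\<phi> \<in> borel_measurable lebesgue"
    using 1 by (intro measurable_completion) auto
qed

lemma Cc_L1_loc_integrable:
  fixes f :: "'a::euclidean_space \<Rightarrow> 'b::euclidean_space" and \<phi> :: "'a \<Rightarrow> real"
  assumes \<phi>: "\<phi> \<in> Cc U" and f: "f \<in> L1_loc U"
  shows "integrable lebesgue (\<lambda>x. \<phi> x *\<^sub>R f x)"
proof -
  obtain K where K: "compact K" "K \<subseteq> U" "\<And>x. x \<notin> K \<Longrightarrow> \<phi> x = 0"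
    using \<phi> by (auto elim: CcE)
  obtain M where M: "\<And>x. norm (\<phi> x) \<le> M"
    using Cc_bounded[OF \<phi>] by metis
  have "integrable lebesgue (\<lambda>x. \<phi> x *\<^sub>R (indicator K x *\<^sub>R f x))"
    using L1_locD[OF f K(1,2)] M Cc_measurable[OF \<phi>]
    by (intro integrable_scaleR_bounded[where M = M and k = \<phi>]) (simp_all add: set_integrable_def)
  also have "(\<lambda>x. \<phi> x *\<^sub>R (indicator K x *\<^sub>R f x)) = (\<lambda>x. \<phi> x *\<^sub>R f x)"
  proof
    show "\<phi> x *\<^sub>R (indicator K x *\<^sub>R f x) = \<phi> x *\<^sub>R f x" for x
      using K(3)[of x] by (cases "x \<in> K") auto
  qed
  finally show ?thesis .
qed

lemma set_integral_eq_integral_if_zero_outside: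
  fixes g :: "'a \<Rightarrow> 'b::euclidean_space"
  assumes "\<And>x. x \<notin> U \<Longrightarrow> g x = 0"
  shows "(LINT x:U|N. g x) = (LINT x|N. g x)" "set_integrable N U g \<longleftrightarrow> integrable N g"
proof -
  have "indicat_real U x *\<^sub>R g x = g x" for x
    using assms by (cases "x \<in> U") auto
  then show "(LINT x:U|N. g x) = (LINT x|N. g x)" "set_integrable N U g \<longleftrightarrow> integrable N g"
    by (simp_all add: set_lebesgue_integral_def set_integrable_def)
qed

section \<open>Test functions separate locally integrable functions\<close>

text \<open>
The box bumps are test functions and increase to the indicator of the box, so dominated convergence passes
the hypothesis on to boxes.
\<close>

lemma integral_box_eq_0:
  fixes d :: "'a::euclidean_space \<Rightarrow> real"
  assumes d: "d \<in> L1_loc U"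
    and test: "\<And>\<phi>. \<phi> \<in> test_functions U \<Longrightarrow> (LINT x|lebesgue. \<phi> x * d x) = 0"
    and ab: "box a b \<noteq> {}" "cbox a b \<subseteq> U"
  shows "(LINT x|lebesgue. indicator (box a b) x * d x) = 0"
proof -
  have int: "integrable lebesgue (\<lambda>x. indicat_real (cbox a b) x *\<^sub>R d x)"
    using L1_locD[OF d compact_cbox ab(2)] by (simp add: set_integrable_def)
  have meas: "(\<lambda>x. k x * d x) \<in> borel_measurable lebesgue"
    if k: "k \<in> borel_measurable lebesgue" "\<And>x. x \<notin> cbox a b \<Longrightarrow> k x = 0" for k
  proof -
    have "(\<lambda>x. k x * (indicat_real (cbox a b) x *\<^sub>R d x)) \<in> borel_measurable lebesgue"
      using k borel_measurable_integrable[OF int] by measurable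
    also have "(\<lambda>x. k x * (indicat_real (cbox a b) x *\<^sub>R d x)) = (\<lambda>x. k x * d x)"
    proof
      show "k x * (indicat_real (cbox a b) x *\<^sub>R d x) = k x * d x" for x
        using k(2)[of x] by (cases "x \<in> cbox a b") auto
    qed
    finally show ?thesis .
  qed
  have "(\<lambda>n. LINT x|lebesgue. box_bump n a b x * d x) \<longlonglongrightarrow>
      (LINT x|lebesgue. indicator (box a b) x * d x)"
  proof (rule integral_dominated_convergence)
    show "integrable lebesgue (\<lambda>x. \<bar>indicat_real (cbox a b) x *\<^sub>R d x\<bar>)"
      using int by (rule integrable_abs)
    show "AE x in lebesgue. norm (box_bump n a b x * d x) \<le> \<bar>indicat_real (cbox a b) x *\<^sub>R d x\<bar>" for n
    proof (intro AE_I2)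
      fix x
      show "norm (box_bump n a b x * d x) \<le> \<bar>indicat_real (cbox a b) x *\<^sub>R d x\<bar>"
        using box_bump_bounds[of n a b x] box_bump_support[of x a b n] box_subset_cbox[of a b]
        by (cases "x \<in> box a b") (auto simp: abs_mult indicator_def mult_left_le_one_le)
    qed
    show "(\<lambda>x. box_bump n a b x * d x) \<in> borel_measurable lebesgue" for n
      using Cc_measurable(2)[OF test_functions_Cc[OF box_bump_test[OF ab(2)]]]
        box_bump_support box_subset_cbox by (intro meas) (auto, blast)
    show "(\<lambda>x. indicator (box a b) x * d x) \<in> borel_measurable lebesgue"
      using box_subset_cbox[of a b] by (intro meas borel_measurable_indicator) (auto simp: indicator_def)
    show "AE x in lebesgue. (\<lambda>n. box_bump n a b x * d x) \<longlonglongrightarrow> indicator (box a b) x * d x"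
      by (intro AE_I2 tendsto_mult box_bump_tendsto tendsto_const)
  qed
  then show ?thesis
    using test[OF box_bump_test[OF ab(2)]] by (simp add: LIMSEQ_const_iff)
qed

text \<open>
Open boxes form an intersection-stable generator of the Borel sets, and the sets over which \<open>g\<close> integrates
to zero are closed under complements and disjoint unions.
\<close>

lemma AE_zero_if_box_integrals_zero:
  fixes g :: "'a::euclidean_space \<Rightarrow> real"
  assumes g: "integrable lborel g" and g0: "(LINT x|lborel. g x) = 0"
    and box: "\<And>a b. (LINT x:box a b|lborel. g x) = 0"
  shows "AE x in lborel. g x = 0"
proof (rule sigma_finite_measure.density_zero[OF lborel.sigma_finite_measure_axioms g])
  fix A :: "'a set" assume "A \<in> sets lborel"
  then have A: "A \<in> sigma_sets UNIV (range (\<lambda>(a, b). box a b))"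
    by (simp add: borel_eq_box)
  have "Int_stable (range (\<lambda>(a, b). box a b :: 'a set))"
    by (auto simp: Int_stable_def box_Int_box)
  from this subset_UNIV[of "_ :: 'a set set", folded Pow_UNIV] A show "(LINT x:A|lborel. g x) = 0"
  proof (induction rule: sigma_sets_induct_disjoint)
    case (basic A)
    then show ?case using box by auto
  next
    case empty
    then show ?case by (simp add: set_lebesgue_integral_def)
  next
    case (compl A)
    have A: "A \<in> sets lborel" using compl by (simp add: borel_eq_box)
    have "(LINT x:UNIV - A|lborel. g x) = (LINT x|lborel. g x - indicator A x *\<^sub>R g x)"
      unfolding set_lebesgue_integral_def by (intro Bochner_Integration.integral_cong) (auto simp: indicator_def)
    also have "\<dots> = (LINT x|lborel. g x) - (LINT x:A|lborel. g x)"
      unfolding set_lebesgue_integral_def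
      using g A by (intro Bochner_Integration.integral_diff integrable_mult_indicator) auto
    finally show ?case using g0 compl by simp
  next
    case (union A)
    have A: "\<And>i. A i \<in> sets lborel" using union by (auto simp: borel_eq_box)
    then have "set_integrable lborel (\<Union>i. A i) g"
      unfolding set_integrable_def using g by (intro integrable_mult_indicator) auto
    then have "(LINT x:(\<Union>i. A i)|lborel. g x) = (\<Sum>i. (LINT x:A i|lborel. g x))"
      using union A by (intro lebesgue_integral_countable_add) (auto simp: disjoint_family_on_def)
    then show ?case using union by simp
  qed
qed

text \<open>
An open set is a countable union of closed boxes, whose boundaries are null sets. This reduces local
statements to boxes on which locally integrable functions are integrable.
\<close>

lemma AE_open_from_boxes:
  fixes U :: "'a::euclidean_space set"
  assumes U: "open U" and box: "\<And>c e. cbox c e \<subseteq> U \<Longrightarrow> AE x in lebesgue. x \<in> box c e \<longrightarrow> P x"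
  shows "AE x in lebesgue. x \<in> U \<longrightarrow> P x"
proof -
  obtain \<D> where \<D>: "countable \<D>" "\<D> \<subseteq> Pow U" "\<And>X. X \<in> \<D> \<Longrightarrow> \<exists>a b. X = cbox a b" "\<Union>\<D> = U"
    using open_countable_Union_open_cbox[OF U] by metis
  have "AE x in lebesgue. \<forall>X\<in>\<D>. x \<in> X \<longrightarrow> P x"
  proof (subst AE_ball_countable[OF \<D>(1)], rule ballI)
    fix X assume X: "X \<in> \<D>"
    then obtain c e where ce: "X = cbox c e" using \<D>(3) by blast
    with X \<D>(2) have "AE x in lebesgue. x \<in> box c e \<longrightarrow> P x" by (intro box) auto
    moreover have "AE x in lebesgue. x \<notin> cbox c e - box c e"
      using negligible_frontier_interval[of c e] by (intro AE_not_in) (simp add: negligible_iff_null_sets)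
    ultimately show "AE x in lebesgue. x \<in> X \<longrightarrow> P x"
      unfolding ce by eventually_elim blast
  qed
  then show ?thesis
    by eventually_elim (use \<D>(4) in blast)
qed

text \<open>
The fundamental lemma of the calculus of variations. On each compact box the function is integrable and
all its integrals over subboxes vanish.
\<close>

theorem fundamental_lemma:
  fixes d :: "'a::euclidean_space \<Rightarrow> real"
  assumes U: "open U" and d: "d \<in> L1_loc U"
    and test: "\<And>\<phi>. \<phi> \<in> test_functions U \<Longrightarrow> (LINT x|lebesgue. \<phi> x * d x) = 0"
  shows "AE x in lebesgue. x \<in> U \<longrightarrow> d x = 0"
proof (rule AE_open_from_boxes[OF U])
  show "AE x in lebesgue. x \<in> box c e \<longrightarrow> d x = 0" if ce: "cbox c e \<subseteq> U" for c e
  proof -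
    let ?F = "\<lambda>x. indicat_real (cbox c e) x *\<^sub>R d x"
    have F: "integrable lebesgue ?F"
      using L1_locD[OF d compact_cbox ce] by (simp add: set_integrable_def)
    obtain g where g: "g \<in> borel_measurable borel" "integrable lborel g" "AE x in lebesgue. ?F x = g x"
      using integrable_lebesgue_borel_representative[OF F] by blast
    have frontier: "AE x in lebesgue. x \<notin> cbox c e - box c e"
      using negligible_frontier_interval[of c e] by (intro AE_not_in) (simp add: negligible_iff_null_sets)
    have box0: "(LINT x|lborel. indicator A x * g x) = 0" if A: "A \<inter> box c e = box a b" "A \<in> sets borel" for A a b
    proof -
      have "(LINT x|lborel. indicator A x * g x) = (LINT x|lebesgue. indicator A x * g x)"
        using g(1) A(2) by (intro integral_completion[symmetric]) simp
      also have "\<dots> = (LINT x|lebesgue. indicator (box a b) x * d x)"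
      proof (rule integrable_lebesgue_cong_AE(2))
        show "AE x in lebesgue. indicator (box a b) x * d x = indicator A x * g x"
          using frontier g(3)
        proof eventually_elim
          case (elim x)
          then show ?case
            using A(1) box_subset_cbox[of c e] by (cases "x \<in> box c e") (auto simp: indicator_def)
        qed
        have "AE x in lebesgue. indicator A x *\<^sub>R ?F x = indicator (box a b) x * d x"
          using frontier
        proof eventually_elim
          case (elim x)
          then show ?case
            using A(1) box_subset_cbox[of c e] by (cases "x \<in> box c e") (auto simp: indicator_def)
        qed
        moreover have "integrable lebesgue (\<lambda>x. indicator A x *\<^sub>R ?F x)"
          using integrable_mult_indicator[OF _ F, of A] A(2) by simp
        ultimately show "integrable lebesgue (\<lambda>x. indicator (box a b) x * d x)"
          by (rule integrable_lebesgue_cong_AE(1))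
      qed
      also have "\<dots> = 0"
      proof (cases "box a b = {}")
        case False
        have "box a b \<subseteq> box c e" using A by blast
        then have "cbox a b \<subseteq> U"
          using False ce closure_mono[of "box a b" "box c e"] closure_box by (metis empty_iff order_trans subset_empty)
        then show ?thesis
          using integral_box_eq_0[OF d test False] by simp
      qed simp
      finally show ?thesis .
    qed
    have "AE x in lborel. g x = 0"
    proof (rule AE_zero_if_box_integrals_zero[OF g(2)])
      show "(LINT x|lborel. g x) = 0"
        using box0[of UNIV c e] by simp
      fix a b
      obtain a' b' where "box a b \<inter> box c e = box a' b'"
        using box_Int_box by blast
      then show "(LINT x:box a b|lborel. g x) = 0"
        using box0 by (simp add: set_lebesgue_integral_def)
    qed
    then have "AE x in lebesgue. g x = 0"
      by (rule AE_completion)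
    with g(3) show ?thesis
      by eventually_elim (auto simp: indicator_def dest: subsetD[OF box_subset_cbox])
  qed
qed

section \<open>Weak derivatives and weak divergence\<close>

lemma test_functions_outside:
  assumes "\<phi> \<in> test_functions U" "x \<notin> U"
  shows "\<phi> x = 0" "fderiv \<phi> x h = 0"
  using test_functions_Cc[OF assms(1)] test_functions_Cc[OF test_functions_deriv[OF assms(1), of h]] assms(2)
  by (auto elim!: CcE)

text \<open>
The defining identity of the weak divergence contains \<open>D\<phi>(x)(F(x))\<close>, where the direction depends on the
point; expanding it in the basis gives products of a test function with a locally integrable function.
\<close>

lemma frechet_derivative_basis_sum:
  assumes "\<phi> \<in> test_functions U"
  shows "fderiv \<phi> x h = (\<Sum>b\<in>Basis. (h \<bullet> b) *\<^sub>R fderiv \<phi> x b)"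
proof -
  have lin: "linear (fderiv \<phi> x)"
    using test_functions_has_derivative[OF assms] has_derivative_linear by blast
  have "fderiv \<phi> x h = fderiv \<phi> x (\<Sum>b\<in>Basis. (h \<bullet> b) *\<^sub>R b)"
    by (simp add: euclidean_representation)
  also have "\<dots> = (\<Sum>b\<in>Basis. (h \<bullet> b) *\<^sub>R fderiv \<phi> x b)"
    using lin by (simp add: linear_sum linear_cmul)
  finally show ?thesis .
qed

lemma frechet_derivative_bilinear:
  fixes p :: "'b::euclidean_space \<Rightarrow> 'c::euclidean_space \<Rightarrow> 'd::euclidean_space"
  assumes p: "bounded_bilinear p" and "\<phi> \<in> test_functions U" "\<psi> \<in> test_functions V"
  shows "fderiv (\<lambda>x. p (\<phi> x) (\<psi> x)) x h
    = p (\<phi> x) (fderiv \<psi> x h) + p (fderiv \<phi> x h) (\<psi> x)"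
  using frechet_derivative_at[OF bounded_bilinear.FDERIV[OF p
      test_functions_has_derivative[OF assms(2)] test_functions_has_derivative[OF assms(3)]], symmetric]
  by simp

lemma has_weak_deriv_iff:
  "has_weak_deriv U b f g \<longleftrightarrow> f \<in> L1_loc U \<and> g \<in> L1_loc U \<and>
     (\<forall>\<phi>::'a::euclidean_space \<Rightarrow> real. \<phi> \<in> test_functions U \<longrightarrow>
        (LINT x|lebesgue. fderiv \<phi> x b *\<^sub>R f x) = - (LINT x|lebesgue. \<phi> x *\<^sub>R g x))"
  unfolding has_weak_deriv_def
  by (intro conj_cong refl all_cong imp_cong arg_cong2[where f = "(=)"] arg_cong[where f = uminus]
      set_integral_eq_integral_if_zero_outside)
     (simp_all add: test_functions_outside)

lemma has_weak_div_iff: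
  "has_weak_div U F h \<longleftrightarrow> F \<in> L1_loc U \<and> h \<in> L1_loc U \<and>
     (\<forall>\<phi>::'a::euclidean_space \<Rightarrow> real. \<phi> \<in> test_functions U \<longrightarrow>
        (LINT x|lebesgue. fderiv \<phi> x (F x)) = - (LINT x|lebesgue. \<phi> x * h x))"
  unfolding has_weak_div_def
  by (intro conj_cong refl all_cong imp_cong arg_cong2[where f = "(=)"] arg_cong[where f = uminus]
      set_integral_eq_integral_if_zero_outside)
     (simp_all add: test_functions_outside)

lemma test_L1_loc_integrable:
  fixes f :: "'a::euclidean_space \<Rightarrow> 'b::euclidean_space" and \<phi> :: "'a \<Rightarrow> real"
  assumes "\<phi> \<in> test_functions U" "f \<in> L1_loc U"
  shows "integrable lebesgue (\<lambda>x. \<phi> x *\<^sub>R f x)"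
    "integrable lebesgue (\<lambda>x. fderiv \<phi> x h *\<^sub>R f x)"
  using assms test_functions_deriv by (auto intro!: Cc_L1_loc_integrable test_functions_Cc)

lemma test_frechet_L1_loc:
  fixes v :: "'a::euclidean_space \<Rightarrow> 'a" and \<phi> :: "'a \<Rightarrow> real"
  assumes \<phi>: "\<phi> \<in> test_functions V" and v: "v \<in> L1_loc U"
  shows "(\<lambda>x. fderiv \<phi> x (v x)) \<in> L1_loc U"
    "V = U \<Longrightarrow> integrable lebesgue (\<lambda>x. fderiv \<phi> x (v x))"
proof -
  have eq: "(\<lambda>x. fderiv \<phi> x (v x)) =
      (\<lambda>x. \<Sum>b\<in>Basis. fderiv \<phi> x b *\<^sub>R (v x \<bullet> b))"
    by (rule ext, subst frechet_derivative_basis_sum[OF \<phi>]) (simp add: mult.commute)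
  have vb: "(\<lambda>x. v x \<bullet> b) \<in> L1_loc U" for b
    using v by (intro L1_loc_bounded_linear[OF bounded_linear_inner_left])
  have "continuous_on U (\<lambda>x. fderiv \<phi> x b)" for b
    using test_functions_smooth[OF test_functions_deriv[OF \<phi>], of 0 b] continuous_on_subset by auto
  then show "(\<lambda>x. fderiv \<phi> x (v x)) \<in> L1_loc U"
    unfolding eq using vb by (intro L1_loc_sum L1_loc_scaleR_continuous)
  show "integrable lebesgue (\<lambda>x. fderiv \<phi> x (v x))" if "V = U"
    unfolding eq using vb \<phi> that by (intro Bochner_Integration.integrable_sum test_L1_loc_integrable) auto
qed

lemma L1_loc_AE_eq:
  fixes g k :: "'a::euclidean_space \<Rightarrow> 'b::euclidean_space"
  assumes U: "open U" and L: "g \<in> L1_loc U" "k \<in> L1_loc U"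
    and eq: "\<And>\<phi>. \<phi> \<in> test_functions U \<Longrightarrow> (LINT x|lebesgue. \<phi> x *\<^sub>R g x) = (LINT x|lebesgue. \<phi> x *\<^sub>R k x)"
  shows "AE x in lebesgue. x \<in> U \<longrightarrow> g x = k x"
proof -
  have "AE x in lebesgue. x \<in> U \<longrightarrow> (g x - k x) \<bullet> c = 0" for c
  proof (rule fundamental_lemma[OF U])
    show "(\<lambda>x. (g x - k x) \<bullet> c) \<in> L1_loc U"
      using L by (intro L1_loc_bounded_linear[OF bounded_linear_inner_left] L1_loc_diff)
    fix \<phi> :: "'a \<Rightarrow> real" assume \<phi>: "\<phi> \<in> test_functions U"
    note int = test_L1_loc_integrable(1)[OF \<phi> L(1)] test_L1_loc_integrable(1)[OF \<phi> L(2)]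
    have "(LINT x|lebesgue. \<phi> x * ((g x - k x) \<bullet> c)) = (LINT x|lebesgue. (\<phi> x *\<^sub>R g x - \<phi> x *\<^sub>R k x) \<bullet> c)"
      by (simp add: algebra_simps)
    also have "\<dots> = (LINT x|lebesgue. \<phi> x *\<^sub>R g x - \<phi> x *\<^sub>R k x) \<bullet> c"
      using int by (intro integral_inner_left) simp
    also have "\<dots> = 0"
      using int eq[OF \<phi>] by simp
    finally show "(LINT x|lebesgue. \<phi> x * ((g x - k x) \<bullet> c)) = 0" .
  qed
  then have "AE x in lebesgue. \<forall>c\<in>Basis. x \<in> U \<longrightarrow> (g x - k x) \<bullet> c = 0"
    by (intro AE_finite_allI finite_Basis)
  then show ?thesis
  proof eventually_elim
    case (elim x)
    then show ?case
      using euclidean_eqI[of "g x" "k x"] by (auto simp: inner_diff_left)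
  qed
qed

lemma has_weak_deriv_unique:
  fixes f :: "'a::euclidean_space \<Rightarrow> 'b::euclidean_space"
  assumes "open U" "has_weak_deriv U b f g" "has_weak_deriv U b f k"
  shows "AE x in lebesgue. x \<in> U \<longrightarrow> g x = k x"
  using assms(2,3) by (intro L1_loc_AE_eq[OF assms(1)]) (simp_all add: has_weak_deriv_iff)

lemma has_weak_div_unique:
  assumes "open U" "has_weak_div U F g" "has_weak_div U F k"
  shows "AE x in lebesgue. x \<in> U \<longrightarrow> g x = k x"
  using assms(2,3) by (intro L1_loc_AE_eq[OF assms(1)]) (simp_all add: has_weak_div_iff)

lemma has_weak_deriv_wderiv: "has_weak_deriv U b f g \<Longrightarrow> has_weak_deriv U b f (wderiv U b f)"
  unfolding wderiv_def by (rule someI[of "has_weak_deriv U b f"])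

lemma has_weak_div_wdiv: "has_weak_div U F h \<Longrightarrow> has_weak_div U F (wdiv U F)"
  unfolding wdiv_def by (rule someI[of "has_weak_div U F"])

lemma wderiv_AE_eq:
  "open U \<Longrightarrow> has_weak_deriv U b f g \<Longrightarrow> AE x in lebesgue. x \<in> U \<longrightarrow> wderiv U b f x = g x"
  using has_weak_deriv_unique has_weak_deriv_wderiv by blast

lemma wdiv_AE_eq:
  "open U \<Longrightarrow> has_weak_div U F h \<Longrightarrow> AE x in lebesgue. x \<in> U \<longrightarrow> wdiv U F x = h x"
  using has_weak_div_unique has_weak_div_wdiv by blast

lemma has_weak_deriv_diff:
  fixes f g :: "'a::euclidean_space \<Rightarrow> 'b::euclidean_space"
  assumes "has_weak_deriv U b f f'" "has_weak_deriv U b g g'"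
  shows "has_weak_deriv U b (\<lambda>x. f x - g x) (\<lambda>x. f' x - g' x)"
  unfolding has_weak_deriv_iff
proof safe
  have L: "f \<in> L1_loc U" "f' \<in> L1_loc U" "g \<in> L1_loc U" "g' \<in> L1_loc U"
    using assms by (auto simp: has_weak_deriv_iff)
  then show "(\<lambda>x. f x - g x) \<in> L1_loc U" "(\<lambda>x. f' x - g' x) \<in> L1_loc U"
    by (auto intro: L1_loc_diff)
  fix \<phi> :: "'a \<Rightarrow> real" assume \<phi>: "\<phi> \<in> test_functions U"
  show "(LINT x|lebesgue. fderiv \<phi> x b *\<^sub>R (f x - g x))
      = - (LINT x|lebesgue. \<phi> x *\<^sub>R (f' x - g' x))"
    using assms \<phi> L by (simp add: scaleR_diff_right test_L1_loc_integrable[OF \<phi>] has_weak_deriv_iff)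
qed

lemma has_weak_div_diff:
  fixes F G :: "'a::euclidean_space \<Rightarrow> 'a"
  assumes "has_weak_div U F f" "has_weak_div U G g"
  shows "has_weak_div U (\<lambda>x. F x - G x) (\<lambda>x. f x - g x)"
  unfolding has_weak_div_iff
proof safe
  have L: "F \<in> L1_loc U" "f \<in> L1_loc U" "G \<in> L1_loc U" "g \<in> L1_loc U"
    using assms by (auto simp: has_weak_div_iff)
  then show "(\<lambda>x. F x - G x) \<in> L1_loc U" "(\<lambda>x. f x - g x) \<in> L1_loc U"
    by (auto intro: L1_loc_diff)
  fix \<phi> :: "'a \<Rightarrow> real" assume \<phi>: "\<phi> \<in> test_functions U"
  have "fderiv \<phi> x (F x - G x) = fderiv \<phi> x (F x) - fderiv \<phi> x (G x)" for x
    using has_derivative_linear[OF test_functions_has_derivative[OF \<phi>]] by (rule linear_diff)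
  then show "(LINT x|lebesgue. fderiv \<phi> x (F x - G x)) = - (LINT x|lebesgue. \<phi> x * (f x - g x))"
    using assms \<phi> L test_L1_loc_integrable(1)[OF \<phi>, of f] test_L1_loc_integrable(1)[OF \<phi>, of g]
    by (simp add: right_diff_distrib test_frechet_L1_loc(2)[OF \<phi>] has_weak_div_iff)
qed

lemma has_weak_div_of_weak_derivs:
  fixes v :: "'a::euclidean_space \<Rightarrow> 'a"
  assumes "\<And>b. b \<in> Basis \<Longrightarrow> has_weak_deriv U b v (g b)"
  shows "has_weak_div U v (\<lambda>x. \<Sum>b\<in>Basis. g b x \<bullet> b)"
  unfolding has_weak_div_iff
proof safe
  obtain b0 :: 'a where "b0 \<in> Basis" using nonempty_Basis by blast
  then show v: "v \<in> L1_loc U" using assms by (auto simp: has_weak_deriv_iff)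
  have g: "g b \<in> L1_loc U" if "b \<in> Basis" for b
    using assms[OF that] by (auto simp: has_weak_deriv_iff)
  then show "(\<lambda>x. \<Sum>b\<in>Basis. g b x \<bullet> b) \<in> L1_loc U"
    by (intro L1_loc_sum L1_loc_bounded_linear[OF bounded_linear_inner_left])
  fix \<phi> :: "'a \<Rightarrow> real" assume \<phi>: "\<phi> \<in> test_functions U"
  note int = test_L1_loc_integrable[OF \<phi>]
  have "(LINT x|lebesgue. fderiv \<phi> x (v x)) =
      (LINT x|lebesgue. (\<Sum>b\<in>Basis. (fderiv \<phi> x b *\<^sub>R v x) \<bullet> b))"
    by (rule Bochner_Integration.integral_cong, rule refl, subst frechet_derivative_basis_sum[OF \<phi>])
       (simp add: mult.commute)
  also have "\<dots> = (\<Sum>b\<in>Basis. (LINT x|lebesgue. fderiv \<phi> x b *\<^sub>R v x) \<bullet> b)"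
    by (subst Bochner_Integration.integral_sum)
       (auto intro!: sum.cong integral_inner_left integrable_inner_left int(2)[OF v] simp del: inner_scaleR_left)
  also have "\<dots> = (\<Sum>b\<in>Basis. (- (LINT x|lebesgue. \<phi> x *\<^sub>R g b x)) \<bullet> b)"
    using assms \<phi> by (simp add: has_weak_deriv_iff)
  also have "\<dots> = - (\<Sum>b\<in>Basis. (LINT x|lebesgue. \<phi> x *\<^sub>R g b x) \<bullet> b)"
    by (simp add: sum_negf)
  also have "\<dots> = - (LINT x|lebesgue. (\<Sum>b\<in>Basis. (\<phi> x *\<^sub>R g b x) \<bullet> b))"
    by (subst Bochner_Integration.integral_sum)
       (auto intro!: sum.cong integral_inner_left[symmetric] integrable_inner_left int(1)[OF g] simp del: inner_scaleR_left)
  also have "\<dots> = - (LINT x|lebesgue. \<phi> x * (\<Sum>b\<in>Basis. g b x \<bullet> b))"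
    by (simp add: sum_distrib_left)
  finally show "(LINT x|lebesgue. fderiv \<phi> x (v x)) = - (LINT x|lebesgue. \<phi> x * (\<Sum>b\<in>Basis. g b x \<bullet> b))" .
qed

lemma test_functions_mult:
  fixes \<phi> \<psi> :: "'a::euclidean_space \<Rightarrow> real"
  assumes "\<phi> \<in> test_functions U" "\<psi> \<in> test_functions V"
  shows "(\<lambda>x. \<phi> x * \<psi> x) \<in> test_functions U"
  using test_functions_bilinear[OF bounded_bilinear_mult assms(1)] test_functions_smooth[OF assms(2)] by blast

lemma has_weak_deriv_scaleR_test:
  fixes v :: "'a::euclidean_space \<Rightarrow> 'b::euclidean_space" and \<phi> :: "'a \<Rightarrow> real"
  assumes \<phi>: "\<phi> \<in> test_functions U" and v: "has_weak_deriv U b v g"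
  shows "has_weak_deriv U b (\<lambda>x. \<phi> x *\<^sub>R v x) (\<lambda>x. \<phi> x *\<^sub>R g x + fderiv \<phi> x b *\<^sub>R v x)"
  unfolding has_weak_deriv_iff
proof safe
  have L: "v \<in> L1_loc U" "g \<in> L1_loc U" using v by (auto simp: has_weak_deriv_iff)
  have cont: "continuous_on U \<phi>" "continuous_on U (\<lambda>x. fderiv \<phi> x b)"
    using test_functions_smooth[OF \<phi>, of 0] test_functions_smooth[OF test_functions_deriv[OF \<phi>], of 0 b]
    by (auto intro: continuous_on_subset)
  show "(\<lambda>x. \<phi> x *\<^sub>R v x) \<in> L1_loc U"
    "(\<lambda>x. \<phi> x *\<^sub>R g x + fderiv \<phi> x b *\<^sub>R v x) \<in> L1_loc U"
    using L cont by (auto intro!: L1_loc_add L1_loc_scaleR_continuous)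
  fix \<psi> :: "'a \<Rightarrow> real" assume \<psi>: "\<psi> \<in> test_functions U"
  note \<phi>\<psi> = test_functions_mult[OF \<phi> \<psi>]
  have 1: "integrable lebesgue (\<lambda>x. (\<psi> x * fderiv \<phi> x b) *\<^sub>R v x)"
    using test_L1_loc_integrable(1)[OF test_functions_mult[OF \<psi> test_functions_deriv[OF \<phi>]] L(1)] .
  have "(LINT x|lebesgue. fderiv \<psi> x b *\<^sub>R \<phi> x *\<^sub>R v x) =
     (LINT x|lebesgue. fderiv (\<lambda>x. \<phi> x * \<psi> x) x b *\<^sub>R v x
        - (\<psi> x * fderiv \<phi> x b) *\<^sub>R v x)"
    by (intro Bochner_Integration.integral_cong refl)
       (simp add: frechet_derivative_bilinear[OF bounded_bilinear_mult \<phi> \<psi>] algebra_simps)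
  also have "\<dots> = (LINT x|lebesgue. fderiv (\<lambda>x. \<phi> x * \<psi> x) x b *\<^sub>R v x)
        - (LINT x|lebesgue. (\<psi> x * fderiv \<phi> x b) *\<^sub>R v x)"
    using test_L1_loc_integrable(2)[OF \<phi>\<psi> L(1)] 1 by (rule Bochner_Integration.integral_diff)
  also have "\<dots> = - ((LINT x|lebesgue. (\<phi> x * \<psi> x) *\<^sub>R g x) + (LINT x|lebesgue. (\<psi> x * fderiv \<phi> x b) *\<^sub>R v x))"
    using v \<phi>\<psi> by (simp add: has_weak_deriv_iff)
  also have "\<dots> = - (LINT x|lebesgue. (\<phi> x * \<psi> x) *\<^sub>R g x + (\<psi> x * fderiv \<phi> x b) *\<^sub>R v x)"
    using test_L1_loc_integrable(1)[OF \<phi>\<psi> L(2)] 1 by (simp add: Bochner_Integration.integral_add)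
  also have "\<dots> = - (LINT x|lebesgue. \<psi> x *\<^sub>R (\<phi> x *\<^sub>R g x + fderiv \<phi> x b *\<^sub>R v x))"
    by (simp add: algebra_simps)
  finally show "(LINT x|lebesgue. fderiv \<psi> x b *\<^sub>R \<phi> x *\<^sub>R v x) =
     - (LINT x|lebesgue. \<psi> x *\<^sub>R (\<phi> x *\<^sub>R g x + fderiv \<phi> x b *\<^sub>R v x))" .
qed

lemma has_weak_div_scaleR_test:
  fixes v :: "'a::euclidean_space \<Rightarrow> 'a" and \<phi> :: "'a \<Rightarrow> real"
  assumes \<phi>: "\<phi> \<in> test_functions U" and v: "\<And>b. b \<in> Basis \<Longrightarrow> has_weak_deriv U b v (g b)"
  shows "has_weak_div U (\<lambda>x. \<phi> x *\<^sub>R v x)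
    (\<lambda>x. \<phi> x * (\<Sum>b\<in>Basis. g b x \<bullet> b) + fderiv \<phi> x (v x))"
proof -
  have "(\<Sum>b\<in>Basis. (\<phi> x *\<^sub>R g b x + fderiv \<phi> x b *\<^sub>R v x) \<bullet> b)
      = \<phi> x * (\<Sum>b\<in>Basis. g b x \<bullet> b) + fderiv \<phi> x (v x)" for x
    by (subst frechet_derivative_basis_sum[OF \<phi>, of _ "v x"])
       (simp add: inner_add_left sum.distrib sum_distrib_left mult.commute)
  with has_weak_div_of_weak_derivs[OF has_weak_deriv_scaleR_test[OF \<phi> v]] show ?thesis
    by simp
qed

section \<open>Integration by parts for test functions\<close>

lemma lborel_translation:
  fixes f :: "'a::euclidean_space \<Rightarrow> 'b::euclidean_space"
  assumes f: "f \<in> borel_measurable borel"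
  shows "integrable lborel (\<lambda>x. f (x + c)) \<longleftrightarrow> integrable lborel f"
    and "(LINT x|lborel. f (x + c)) = (LINT x|lborel. f x)"
proof -
  have "integrable (distr lborel borel ((+) c)) f \<longleftrightarrow> integrable lborel (\<lambda>x. f (c + x))"
    using f by (intro integrable_distr_eq) auto
  then show "integrable lborel (\<lambda>x. f (x + c)) \<longleftrightarrow> integrable lborel f"
    by (simp add: lborel_distr_plus add.commute)
  have "(LINT x|distr lborel borel ((+) c). f x) = (LINT x|lborel. f (c + x))"
    using f by (intro integral_distr) auto
  then show "(LINT x|lborel. f (x + c)) = (LINT x|lborel. f x)"
    by (simp add: lborel_distr_plus add.commute)
qed

lemma test_functions_line_derivative:
  fixes \<phi> :: "'a::euclidean_space \<Rightarrow> real"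
  assumes "\<phi> \<in> test_functions U"
  shows "((\<lambda>t. \<phi> (x + t *\<^sub>R b)) has_real_derivative fderiv \<phi> (x + t *\<^sub>R b) b) (at t)"
proof -
  have "((\<lambda>t. x + t *\<^sub>R b) has_derivative (\<lambda>s. s *\<^sub>R b)) (at t)"
    by (auto intro!: derivative_eq_intros)
  from has_derivative_compose[OF this test_functions_has_derivative[OF assms]]
  have "((\<lambda>t. \<phi> (x + t *\<^sub>R b)) has_derivative (\<lambda>s. fderiv \<phi> (x + t *\<^sub>R b) (s *\<^sub>R b))) (at t)" .
  moreover have "(\<lambda>s. fderiv \<phi> (x + t *\<^sub>R b) (s *\<^sub>R b)) =
      (*) (fderiv \<phi> (x + t *\<^sub>R b) b)"
    using has_derivative_linear[OF test_functions_has_derivative[OF assms]]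
    by (auto simp: linear_cmul mult.commute)
  ultimately show ?thesis
    by (simp add: has_field_derivative_def)
qed

text \<open>
For a factor \<open>A\<close> that is constant in direction \<open>b\<close>, translation invariance of the measure gives
\<open>\<integral> A(x) \<psi>(x + h b) dx = \<integral> A(x) \<psi>(x) dx\<close>; the claim is the derivative of this identity at \<open>h = 0\<close>.
With \<open>A = 1\<close> it yields integration by parts for test functions, and with a factor
depending on the horizontal variables only it yields the divergence of the mesh velocity.
\<close>

lemma integral_invariant_mult_derivative:
  fixes \<psi> A :: "'a::euclidean_space \<Rightarrow> real"
  assumes \<psi>: "\<psi> \<in> test_functions UNIV"
    and A: "A \<in> borel_measurable borel" "\<And>x. \<bar>A x\<bar> \<le> M" "\<And>x t. A (x + t *\<^sub>R b) = A x"
  shows "(LINT x|lebesgue. A x * fderiv \<psi> x b) = 0"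
proof -
  define h where "h n = inverse (real (Suc n))" for n
  have h: "h n > 0" "h n \<le> 1" for n by (auto simp: h_def inverse_le_1_iff)
  have h0: "h \<longlonglongrightarrow> 0" unfolding h_def by (rule LIMSEQ_inverse_real_of_nat)
  define q where "q n x = A x * ((\<psi> (x + h n *\<^sub>R b) - \<psi> x) / h n)" for n x
  obtain K where K: "compact K" "\<And>x. x \<notin> K \<Longrightarrow> \<psi> x = 0"
    using test_functions_Cc[OF \<psi>] by (auto elim: CcE)
  obtain R where R: "\<And>x. x \<in> K \<Longrightarrow> norm x \<le> R"
    using compact_imp_bounded[OF K(1)] by (auto simp: bounded_iff)
  obtain C where C: "C \<ge> 0" "\<And>x. norm (fderiv \<psi> x b) \<le> C"
    using Cc_bounded[OF test_functions_Cc[OF test_functions_deriv[OF \<psi>]]] by metis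
  have [measurable]: "\<psi> \<in> borel_measurable borel" "A \<in> borel_measurable borel"
    "(\<lambda>x. fderiv \<psi> x b) \<in> borel_measurable borel"
    using A(1) Cc_measurable(1)[OF test_functions_Cc[OF \<psi>]]
      Cc_measurable(1)[OF test_functions_Cc[OF test_functions_deriv[OF \<psi>]]] by auto
  have M: "M \<ge> 0" using A(2)[of 0] by linarith
  have q_bound: "norm (q n x) \<le> M * C * indicator (cball 0 (R + norm b)) x" for n x
  proof (cases "x \<in> cball 0 (R + norm b)")
    case True
    obtain z where "(\<psi> (x + h n *\<^sub>R b) - \<psi> (x + 0 *\<^sub>R b)) = (h n - 0) * fderiv \<psi> (x + z *\<^sub>R b) b"
      using MVT2[OF h(1)[of n] test_functions_line_derivative[OF \<psi>]] by blast
    then have "(\<psi> (x + h n *\<^sub>R b) - \<psi> x) / h n = fderiv \<psi> (x + z *\<^sub>R b) b"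
      using h(1)[of n] by (simp add: field_simps)
    then have "norm (q n x) = \<bar>A x\<bar> * \<bar>fderiv \<psi> (x + z *\<^sub>R b) b\<bar>"
      by (simp add: q_def abs_mult)
    also have "\<dots> \<le> M * C"
      using A(2) C M by (intro mult_mono) auto
    finally show ?thesis using True by simp
  next
    case False
    have "norm (h n *\<^sub>R b) \<le> norm b"
      using h[of n] by (simp add: mult_left_le_one_le)
    moreover have "norm x \<le> norm (x + h n *\<^sub>R b) + norm (h n *\<^sub>R b)"
      using norm_triangle_ineq4[of "x + h n *\<^sub>R b" "h n *\<^sub>R b"] by simp
    ultimately have "x \<notin> K" "x + h n *\<^sub>R b \<notin> K"
      using False R[of x] R[of "x + h n *\<^sub>R b"] norm_ge_zero[of b] by (auto simp: not_le)
    then show ?thesis using K(2) False by (simp add: q_def)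
  qed
  have \<psi>int: "integrable lborel \<psi>"
  proof -
    have "integrable lborel (\<lambda>x. indicator K x *\<^sub>R \<psi> x)"
      using K test_functions_smooth[OF \<psi>, of 0]
      by (intro borel_integrable_compact) (auto intro: continuous_on_subset)
    moreover have "(\<lambda>x. indicator K x *\<^sub>R \<psi> x) = \<psi>"
      by (auto simp: fun_eq_iff indicator_def K(2))
    ultimately show ?thesis by simp
  qed
  have A\<psi>: "integrable lborel (\<lambda>x. A x * \<psi> x)"
    using integrable_scaleR_bounded[OF \<psi>int, of A M] A by simp
  have "(LINT x|lborel. q n x) = 0" for n
  proof -
    have "(\<lambda>x. A x * \<psi> (x + h n *\<^sub>R b)) = (\<lambda>x. (\<lambda>y. A y * \<psi> y) (x + h n *\<^sub>R b))"
      using A(3) by simp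
    then have "integrable lborel (\<lambda>x. A x * \<psi> (x + h n *\<^sub>R b))"
      "(LINT x|lborel. A x * \<psi> (x + h n *\<^sub>R b)) = (LINT x|lborel. A x * \<psi> x)"
      using A\<psi> lborel_translation[of "\<lambda>y. A y * \<psi> y" "h n *\<^sub>R b"] by simp_all
    with A\<psi> have "(LINT x|lborel. (A x * \<psi> (x + h n *\<^sub>R b) - A x * \<psi> x) / h n) = 0"
      by simp
    then show ?thesis
      by (simp add: q_def algebra_simps)
  qed
  moreover have "(\<lambda>n. LINT x|lborel. q n x) \<longlonglongrightarrow> (LINT x|lborel. A x * fderiv \<psi> x b)"
  proof (rule integral_dominated_convergence)
    show "integrable lborel (\<lambda>x. M * C * indicator (cball 0 (R + norm b)) x)"
      using emeasure_lborel_cball_finite by (intro integrable_mult_right integrable_real_indicator) auto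
    show "AE x in lborel. norm (q n x) \<le> M * C * indicator (cball 0 (R + norm b)) x" for n
      using q_bound by (intro AE_I2)
    have "(\<lambda>n. q n x) \<longlonglongrightarrow> A x * fderiv \<psi> x b" for x
    proof -
      have "((\<lambda>t. (\<psi> (x + (0 + t) *\<^sub>R b) - \<psi> (x + 0 *\<^sub>R b)) / t) \<longlongrightarrow> fderiv \<psi> (x + 0 *\<^sub>R b) b) (at 0)"
        using test_functions_line_derivative[OF \<psi>, of x b 0] by (simp add: DERIV_def)
      moreover have "filterlim h (at 0) sequentially"
        using h h0 by (auto simp: filterlim_at eventually_sequentially) (metis less_irrefl)
      ultimately have "(\<lambda>n. (\<psi> (x + (0 + h n) *\<^sub>R b) - \<psi> (x + 0 *\<^sub>R b)) / h n) \<longlonglongrightarrow> fderiv \<psi> (x + 0 *\<^sub>R b) b"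
        by (rule filterlim_compose)
      then show ?thesis
        unfolding q_def by (intro tendsto_mult tendsto_const) simp
    qed
    then show "AE x in lborel. (\<lambda>n. q n x) \<longlonglongrightarrow> A x * fderiv \<psi> x b"
      by (intro AE_I2)
    show "q n \<in> borel_measurable lborel" for n
      unfolding q_def by measurable
  qed measurable
  ultimately have "(LINT x|lborel. A x * fderiv \<psi> x b) = 0"
    by (simp add: LIMSEQ_const_iff)
  then show ?thesis
    by (subst integral_completion) measurable
qed

lemma test_functions_L1_loc:
  assumes "\<Phi> \<in> test_functions V"
  shows "\<Phi> \<in> L1_loc U"
  using test_functions_smooth[OF assms, of 0] by (auto intro: L1_loc_continuous continuous_on_subset)

lemma test_functions_has_weak_deriv:
  fixes \<Phi> :: "'a::euclidean_space \<Rightarrow> 'b::euclidean_space"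
  assumes \<Phi>: "\<Phi> \<in> test_functions U"
  shows "has_weak_deriv U b \<Phi> (\<lambda>x. fderiv \<Phi> x b)"
  unfolding has_weak_deriv_iff
proof safe
  note d\<Phi> = test_functions_deriv[OF \<Phi>]
  show L: "\<Phi> \<in> L1_loc U" "(\<lambda>x. fderiv \<Phi> x b) \<in> L1_loc U"
    using \<Phi> d\<Phi> by (auto intro: test_functions_L1_loc)
  fix \<phi> :: "'a \<Rightarrow> real" assume \<phi>: "\<phi> \<in> test_functions U"
  note int = test_L1_loc_integrable(2)[OF \<phi> L(1), of b] test_L1_loc_integrable(1)[OF \<phi> L(2)]
  have "(LINT x|lebesgue. fderiv \<phi> x b *\<^sub>R \<Phi> x + \<phi> x *\<^sub>R fderiv \<Phi> x b) = 0"
    (is "(LINT x|lebesgue. ?g x) = 0")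
  proof (rule euclidean_eqI)
    fix c :: 'b assume "c \<in> Basis"
    let ?\<psi> = "\<lambda>x. (\<phi> x *\<^sub>R \<Phi> x) \<bullet> c"
    have \<phi>\<Phi>: "(\<lambda>x. \<phi> x *\<^sub>R \<Phi> x) \<in> test_functions U"
      using test_functions_bilinear[OF bounded_bilinear_scaleR \<phi>] test_functions_smooth[OF \<Phi>] by blast
    then have "?\<psi> \<in> test_functions U"
      using test_functions_bilinear[OF bounded_bilinear_inner \<phi>\<Phi>] Ck_const by blast
    then have \<psi>: "?\<psi> \<in> test_functions UNIV"
      by (auto simp: test_functions_def)
    have "((\<lambda>x. (\<phi> x *\<^sub>R \<Phi> x) \<bullet> c) has_derivative (\<lambda>h. fderiv (\<lambda>x. \<phi> x *\<^sub>R \<Phi> x) x h \<bullet> c)) (at x)" for x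
      by (rule has_derivative_inner_left[OF test_functions_has_derivative[OF \<phi>\<Phi>]])
    from frechet_derivative_at[OF this]
    have "fderiv ?\<psi> x b = fderiv (\<lambda>x. \<phi> x *\<^sub>R \<Phi> x) x b \<bullet> c" for x
      by (metis (no_types, lifting))
    also have "\<dots> x = ?g x \<bullet> c" for x
      by (simp add: frechet_derivative_bilinear[OF bounded_bilinear_scaleR \<phi> \<Phi>] add.commute)
    finally have "(LINT x|lebesgue. ?g x \<bullet> c) = 0"
      using integral_invariant_mult_derivative[OF \<psi>, of "\<lambda>_. 1" 1 b] by simp
    then show "(LINT x|lebesgue. ?g x) \<bullet> c = 0 \<bullet> c"
      using int by (subst integral_inner_left[symmetric]) (auto intro: Bochner_Integration.integrable_add)
  qed
  then show "(LINT x|lebesgue. fderiv \<phi> x b *\<^sub>R \<Phi> x)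
      = - (LINT x|lebesgue. \<phi> x *\<^sub>R fderiv \<Phi> x b)"
    using int by (simp add: eq_neg_iff_add_eq_0)
qed

section \<open>First-order Sobolev spaces\<close>

lemma powr_add_le:
  fixes a b p :: real
  assumes "a \<ge> 0" "b \<ge> 0" "p \<ge> 0"
  shows "(a + b) powr p \<le> 2 powr p * (a powr p + b powr p)"
proof -
  have "(a + b) powr p \<le> (2 * max a b) powr p"
    using assms by (intro powr_mono2) auto
  also have "\<dots> = 2 powr p * max a b powr p"
    using assms by (simp add: powr_mult)
  also have "\<dots> \<le> 2 powr p * (a powr p + b powr p)"
    using assms by (intro mult_left_mono) (auto simp: max_def)
  finally show ?thesis .
qed

abbreviation Lp_int :: "real \<Rightarrow> 'a::euclidean_space set \<Rightarrow> ('a \<Rightarrow> 'b::euclidean_space) \<Rightarrow> real" where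
  "Lp_int p U f \<equiv> (LINT x:U|lebesgue. norm (f x) powr p)"

text \<open>
\<open>Lp\<close> is defined through the measure restricted to \<open>U\<close>, the weak derivatives through integrals over \<open>U\<close>
in the full space; this is the bridge between the two.
\<close>

lemma Lp_iff:
  fixes f :: "'a::euclidean_space \<Rightarrow> 'b::euclidean_space"
  assumes "U \<in> sets lebesgue"
  shows "f \<in> Lp p U \<longleftrightarrow> set_borel_measurable lebesgue U f \<and> set_integrable lebesgue U (\<lambda>x. norm (f x) powr p)"
  using assms by (simp add: Lp_def set_borel_measurable_def set_integrable_def
      borel_measurable_restrict_space_iff integrable_restrict_space)

lemma set_borel_measurable_scaleR:
  fixes f :: "'a \<Rightarrow> 'b::euclidean_space"
  assumes "k \<in> borel_measurable N" "set_borel_measurable N U f"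
  shows "set_borel_measurable N U (\<lambda>x. k x *\<^sub>R f x)"
proof -
  have "(\<lambda>x. k x *\<^sub>R (indicator U x *\<^sub>R f x)) \<in> borel_measurable N"
    using assms unfolding set_borel_measurable_def by measurable
  then show ?thesis by (simp add: set_borel_measurable_def mult.commute)
qed

lemma set_borel_measurable_add:
  fixes f g :: "'a \<Rightarrow> 'b::euclidean_space"
  assumes "set_borel_measurable N U f" "set_borel_measurable N U g"
  shows "set_borel_measurable N U (\<lambda>x. f x + g x)"
  using borel_measurable_add[OF assms[unfolded set_borel_measurable_def]]
  by (simp add: set_borel_measurable_def scaleR_add_right)

lemma set_borel_measurable_norm_powr:
  fixes f :: "'a \<Rightarrow> 'b::euclidean_space"
  assumes [measurable]: "U \<in> sets N" and f: "set_borel_measurable N U f"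
  shows "set_borel_measurable N U (\<lambda>x. norm (f x) powr p)"
proof -
  have [measurable]: "(\<lambda>x. indicat_real U x *\<^sub>R f x) \<in> borel_measurable N"
    using f by (simp add: set_borel_measurable_def)
  have "(\<lambda>x. indicat_real U x *\<^sub>R norm (indicat_real U x *\<^sub>R f x) powr p) \<in> borel_measurable N"
    by measurable
  also have "(\<lambda>x. indicat_real U x *\<^sub>R norm (indicat_real U x *\<^sub>R f x) powr p) = (\<lambda>x. indicat_real U x *\<^sub>R norm (f x) powr p)"
    by (auto simp: fun_eq_iff indicator_def)
  finally show ?thesis by (simp add: set_borel_measurable_def)
qed

lemma Lp_scaleR:
  fixes f :: "'a::euclidean_space \<Rightarrow> 'b::euclidean_space"
  assumes U: "U \<in> sets lebesgue" and f: "f \<in> Lp p U" and p: "p \<ge> 0"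
    and k: "k \<in> borel_measurable lebesgue" "\<And>x. \<bar>k x\<bar> \<le> M"
  shows "(\<lambda>x. k x *\<^sub>R f x) \<in> Lp p U"
    and "Lp_int p U (\<lambda>x. k x *\<^sub>R f x) \<le> M powr p * Lp_int p U f"
proof -
  have le: "norm (k x *\<^sub>R f x) powr p \<le> M powr p * norm (f x) powr p" for x
  proof -
    have "norm (k x *\<^sub>R f x) powr p = \<bar>k x\<bar> powr p * norm (f x) powr p"
      by (simp add: powr_mult)
    also have "\<dots> \<le> M powr p * norm (f x) powr p"
      using k(2)[of x] p by (intro mult_right_mono powr_mono2) auto
    finally show ?thesis .
  qed
  have meas: "set_borel_measurable lebesgue U (\<lambda>x. k x *\<^sub>R f x)"
    using f k U by (intro set_borel_measurable_scaleR) (auto simp: Lp_iff)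
  have int: "set_integrable lebesgue U (\<lambda>x. norm (f x) powr p)"
    using f U by (auto simp: Lp_iff)
  have int': "set_integrable lebesgue U (\<lambda>x. norm (k x *\<^sub>R f x) powr p)"
    using U le set_borel_measurable_norm_powr[OF U meas, of p]
    by (intro set_integrable_bound[OF set_integrable_mult_right[of "M powr p", OF int]]) auto
  show "(\<lambda>x. k x *\<^sub>R f x) \<in> Lp p U"
    using U int' meas by (simp add: Lp_iff)
  show "Lp_int p U (\<lambda>x. k x *\<^sub>R f x) \<le> M powr p * Lp_int p U f"
    using set_integral_mono[OF int' set_integrable_mult_right[of "M powr p", OF int]] le by simp
qed

lemma Lp_add:
  fixes f g :: "'a::euclidean_space \<Rightarrow> 'b::euclidean_space"
  assumes U: "U \<in> sets lebesgue" and f: "f \<in> Lp p U" and g: "g \<in> Lp p U" and p: "p \<ge> 0"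
  shows "(\<lambda>x. f x + g x) \<in> Lp p U"
    and "Lp_int p U (\<lambda>x. f x + g x)
      \<le> 2 powr p * (Lp_int p U f + Lp_int p U g)"
proof -
  have le: "norm (f x + g x) powr p \<le> 2 powr p * (norm (f x) powr p + norm (g x) powr p)" for x
  proof -
    have "norm (f x + g x) powr p \<le> (norm (f x) + norm (g x)) powr p"
      using p by (intro powr_mono2 norm_triangle_ineq) auto
    also have "\<dots> \<le> 2 powr p * (norm (f x) powr p + norm (g x) powr p)"
      using p by (intro powr_add_le) auto
    finally show ?thesis .
  qed
  have meas: "set_borel_measurable lebesgue U (\<lambda>x. f x + g x)"
    using f g U by (intro set_borel_measurable_add) (auto simp: Lp_iff)
  have int: "set_integrable lebesgue U (\<lambda>x. norm (f x) powr p)" "set_integrable lebesgue U (\<lambda>x. norm (g x) powr p)"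
    using f g U by (auto simp: Lp_iff)
  then have int2: "set_integrable lebesgue U (\<lambda>x. 2 powr p * (norm (f x) powr p + norm (g x) powr p))"
    by (intro set_integrable_mult_right set_integral_add)
  have int': "set_integrable lebesgue U (\<lambda>x. norm (f x + g x) powr p)"
    using U le set_borel_measurable_norm_powr[OF U meas, of p]
    by (intro set_integrable_bound[OF int2]) auto
  show "(\<lambda>x. f x + g x) \<in> Lp p U"
    using U int' meas by (simp add: Lp_iff)
  show "Lp_int p U (\<lambda>x. f x + g x)
      \<le> 2 powr p * (Lp_int p U f + Lp_int p U g)"
    using set_integral_mono[OF int' int2] le int by simp
qed

lemma Lp_cong_AE:
  fixes f g :: "'a::euclidean_space \<Rightarrow> 'b::euclidean_space"
  assumes U: "U \<in> sets lebesgue" and ae: "AE x in lebesgue. x \<in> U \<longrightarrow> f x = g x" and f: "f \<in> Lp p U"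
  shows "g \<in> Lp p U"
proof -
  have "AE x in lebesgue. x \<in> U \<longrightarrow> norm (f x) powr p = norm (g x) powr p"
    using ae by eventually_elim auto
  then have "set_integrable lebesgue U (\<lambda>x. norm (g x) powr p)"
    by (rule set_integrable_lebesgue_cong_AE(1)) (use f U in \<open>simp add: Lp_iff\<close>)
  moreover have "AE x in lebesgue. indicat_real U x *\<^sub>R f x = indicat_real U x *\<^sub>R g x"
    using ae by eventually_elim (auto simp: indicator_def)
  then have "set_borel_measurable lebesgue U g"
    using f unfolding Lp_iff[OF U] set_borel_measurable_def by (elim borel_measurable_lebesgue_cong_AE conjE)
  ultimately show ?thesis using U by (simp add: Lp_iff)
qed

lemma Lp_diff:
  fixes f g :: "'a::euclidean_space \<Rightarrow> 'b::euclidean_space"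
  assumes U: "U \<in> sets lebesgue" and f: "f \<in> Lp p U" and g: "g \<in> Lp p U" and p: "p \<ge> 0"
  shows "(\<lambda>x. f x - g x) \<in> Lp p U"
  using Lp_add(1)[OF U f Lp_scaleR(1)[OF U g p, of "\<lambda>_. - 1" 1] p] by simp

lemma Cc_Lp:
  fixes \<Phi> :: "'a::euclidean_space \<Rightarrow> 'b::euclidean_space"
  assumes U: "U \<in> sets lebesgue" and \<Phi>: "\<Phi> \<in> Cc U" and p: "p > 0"
  shows "\<Phi> \<in> Lp p U"
proof -
  obtain K where K: "compact K" "\<And>x. x \<notin> K \<Longrightarrow> \<Phi> x = 0"
    using \<Phi> by (auto elim: CcE)
  obtain M where M: "M \<ge> 0" "\<And>x. norm (\<Phi> x) \<le> M"
    using Cc_bounded[OF \<Phi>] by metis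
  have meas: "set_borel_measurable lebesgue U \<Phi>"
    using U Cc_measurable(2)[OF \<Phi>] unfolding set_borel_measurable_def by measurable
  have "set_integrable lebesgue U (\<lambda>x. M powr p * indicator K x)"
    unfolding set_integrable_def
    using U K lmeasurable_compact[OF K(1)]
    by (intro integrable_mult_indicator integrable_mult_right integrable_real_indicator)
       (auto simp: fmeasurable_def)
  then have "set_integrable lebesgue U (\<lambda>x. norm (\<Phi> x) powr p)"
  proof (rule set_integrable_bound)
    show "AE x in lebesgue. x \<in> U \<longrightarrow> norm (norm (\<Phi> x) powr p) \<le> norm (M powr p * indicator K x)"
      using K(2) M p by (intro AE_I2) (auto simp: indicator_def intro!: powr_mono2)
  qed (use set_borel_measurable_norm_powr[OF U meas] in auto)
  with U meas show ?thesis by (simp add: Lp_iff)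
qed

lemma sobolev_1_iff:
  "f \<in> sobolev 1 p U \<longleftrightarrow> f \<in> Lp p U \<and> (\<forall>b\<in>Basis. \<exists>g\<in>Lp p U. has_weak_deriv U b f g)"
  by simp

lemma sobolev_1_Lp: "f \<in> sobolev 1 p U \<Longrightarrow> f \<in> Lp p U"
  by simp

lemma sobolev_norm_powr_1:
  "sobolev_norm_powr 1 p U f = Lp_int p U f
     + (\<Sum>b\<in>Basis. Lp_int p U (wderiv U b f))"
  by simp

lemma sobolev_1_wderiv:
  assumes "open U" "f \<in> sobolev 1 p U" "b \<in> Basis"
  shows "has_weak_deriv U b f (wderiv U b f)" "wderiv U b f \<in> Lp p U"
proof -
  obtain g where g: "g \<in> Lp p U" "has_weak_deriv U b f g"
    using assms unfolding sobolev_1_iff by blast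
  show "has_weak_deriv U b f (wderiv U b f)"
    using g(2) by (rule has_weak_deriv_wderiv)
  have "AE x in lebesgue. x \<in> U \<longrightarrow> g x = wderiv U b f x"
    using wderiv_AE_eq[OF assms(1) g(2)] by eventually_elim auto
  from Lp_cong_AE[OF _ this g(1)] assms(1) show "wderiv U b f \<in> Lp p U"
    by auto
qed

lemma sobolev_1_diff:
  assumes U: "open U" and p: "p \<ge> 0" and "f \<in> sobolev 1 p U" "g \<in> sobolev 1 p U"
  shows "(\<lambda>x. f x - g x) \<in> sobolev 1 p U"
  unfolding sobolev_1_iff
proof (intro conjI ballI bexI)
  show "(\<lambda>x. f x - g x) \<in> Lp p U"
    using U p assms(3,4)[THEN sobolev_1_Lp] by (intro Lp_diff) auto
  fix b :: 'a assume b: "b \<in> Basis"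
  note w = sobolev_1_wderiv[OF U assms(3) b] sobolev_1_wderiv[OF U assms(4) b]
  show "has_weak_deriv U b (\<lambda>x. f x - g x) (\<lambda>x. wderiv U b f x - wderiv U b g x)"
    using w by (intro has_weak_deriv_diff)
  show "(\<lambda>x. wderiv U b f x - wderiv U b g x) \<in> Lp p U"
    using U p w by (intro Lp_diff) auto
qed

lemma test_functions_sobolev_1:
  assumes U: "open U" and p: "p > 0" and \<Phi>: "\<Phi> \<in> test_functions U"
  shows "\<Phi> \<in> sobolev 1 p U"
  unfolding sobolev_1_iff
proof (intro conjI ballI bexI)
  show "\<Phi> \<in> Lp p U"
    using U p test_functions_Cc[OF \<Phi>] by (intro Cc_Lp) auto
  fix b :: 'a assume b: "b \<in> Basis"
  show "has_weak_deriv U b \<Phi> (\<lambda>x. fderiv \<Phi> x b)"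
    by (rule test_functions_has_weak_deriv[OF \<Phi>])
  show "(\<lambda>x. fderiv \<Phi> x b) \<in> Lp p U"
    using U p test_functions_Cc[OF test_functions_deriv[OF \<Phi>]] by (intro Cc_Lp) auto
qed

lemma test_functions_C1_bound:
  fixes \<phi> :: "'a::euclidean_space \<Rightarrow> real"
  assumes \<phi>: "\<phi> \<in> test_functions U"
  obtains M where "M \<ge> 0" "\<And>x. \<bar>\<phi> x\<bar> \<le> M" "\<And>b x. b \<in> Basis \<Longrightarrow> \<bar>fderiv \<phi> x b\<bar> \<le> M"
proof -
  obtain M0 where M0: "M0 \<ge> 0" "\<And>x. norm (\<phi> x) \<le> M0"
    using Cc_bounded[OF test_functions_Cc[OF \<phi>]] by metis
  have "\<exists>m\<ge>0. \<forall>x. norm (fderiv \<phi> x b) \<le> m" for b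
    using Cc_bounded[OF test_functions_Cc[OF test_functions_deriv[OF \<phi>]]] by metis
  then obtain m where m: "\<And>b. m b \<ge> 0" "\<And>b x. norm (fderiv \<phi> x b) \<le> m b"
    by metis
  have le: "m b \<le> sum m Basis" if "b \<in> Basis" for b
    using m(1) that by (intro member_le_sum) auto
  have nonneg: "sum m Basis \<ge> 0" using m(1) by (intro sum_nonneg) auto
  show ?thesis
  proof (rule that[of "M0 + sum m Basis"])
    show "0 \<le> M0 + sum m Basis" using M0(1) nonneg by simp
    show "\<bar>\<phi> x\<bar> \<le> M0 + sum m Basis" for x
      using M0(2)[of x] nonneg by simp
    show "\<bar>fderiv \<phi> x b\<bar> \<le> M0 + sum m Basis" if "b \<in> Basis" for b x
      using m(2)[of x b] le[OF that] M0(1) by simp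
  qed
qed

text \<open>
Multiplication by a fixed test function is bounded on \<open>W\<^sup>1\<^sup>,\<^sup>p\<close>: by the product rule each
partial derivative of \<open>\<phi> z\<close> is controlled by \<open>z\<close> and the same derivative of \<open>z\<close>, with constants depending on
the \<open>C\<^sup>1\<close> bound of \<open>\<phi>\<close> only. Boundedness is needed to multiply approximating sequences by \<open>\<phi>\<close>.
\<close>

lemma sobolev_1_scaleR_test:
  fixes \<phi> :: "'a::euclidean_space \<Rightarrow> real"
  assumes U: "open U" and p: "p \<ge> 0" and \<phi>: "\<phi> \<in> test_functions U"
  shows "\<And>z :: 'a \<Rightarrow> 'b::euclidean_space. z \<in> sobolev 1 p U \<Longrightarrow> (\<lambda>x. \<phi> x *\<^sub>R z x) \<in> sobolev 1 p U"
    and "\<exists>C. \<forall>z \<in> sobolev 1 p U. sobolev_norm_powr 1 p U (\<lambda>x. \<phi> x *\<^sub>R (z x :: 'b)) \<le> C * sobolev_norm_powr 1 p U z"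
proof -
  obtain M where M: "M \<ge> 0" "\<And>x. \<bar>\<phi> x\<bar> \<le> M" "\<And>b x. b \<in> Basis \<Longrightarrow> \<bar>fderiv \<phi> x b\<bar> \<le> M"
    using test_functions_C1_bound[OF \<phi>] by metis
  have Ul: "U \<in> sets lebesgue" using U by auto
  have meas: "\<phi> \<in> borel_measurable lebesgue" "(\<lambda>x. fderiv \<phi> x b) \<in> borel_measurable lebesgue" for b
    using Cc_measurable(2) test_functions_Cc \<phi> test_functions_deriv[OF \<phi>] by blast+
  let ?C = "M powr p + DIM('a) * (2 powr p * M powr p)"
  have *: "(\<lambda>x. \<phi> x *\<^sub>R z x) \<in> sobolev 1 p U \<and> sobolev_norm_powr 1 p U (\<lambda>x. \<phi> x *\<^sub>R z x) \<le>
      ?C * sobolev_norm_powr 1 p U z"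
    if z: "z \<in> sobolev 1 p U" for z :: "'a \<Rightarrow> 'b"
  proof
    have zL: "z \<in> Lp p U" using z by (rule sobolev_1_Lp)
    note w = sobolev_1_wderiv[OF U z]
    define d where "d b x = \<phi> x *\<^sub>R wderiv U b z x + fderiv \<phi> x b *\<^sub>R z x" for b x
    have weak: "has_weak_deriv U b (\<lambda>x. \<phi> x *\<^sub>R z x) (d b)" if "b \<in> Basis" for b
      unfolding d_def using w(1)[OF that] by (rule has_weak_deriv_scaleR_test[OF \<phi>])
    have L1: "(\<lambda>x. \<phi> x *\<^sub>R wderiv U b z x) \<in> Lp p U" "(\<lambda>x. fderiv \<phi> x b *\<^sub>R z x) \<in> Lp p U"
      "Lp_int p U (\<lambda>x. \<phi> x *\<^sub>R wderiv U b z x) \<le> M powr p * Lp_int p U (wderiv U b z)"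
      "Lp_int p U (\<lambda>x. fderiv \<phi> x b *\<^sub>R z x) \<le> M powr p * Lp_int p U z"
      if b: "b \<in> Basis" for b
      using Lp_scaleR[OF Ul w(2)[OF b] p meas(1) M(2)] Lp_scaleR[OF Ul zL p meas(2) M(3)[OF b]] by auto
    have L: "d b \<in> Lp p U" if "b \<in> Basis" for b
      unfolding d_def using L1[OF that] p Ul by (intro Lp_add)
    have \<phi>z: "(\<lambda>x. \<phi> x *\<^sub>R z x) \<in> Lp p U"
      "Lp_int p U (\<lambda>x. \<phi> x *\<^sub>R z x) \<le> M powr p * Lp_int p U z"
      using Lp_scaleR[OF Ul zL p meas(1) M(2)] by auto
    show "(\<lambda>x. \<phi> x *\<^sub>R z x) \<in> sobolev 1 p U"
      unfolding sobolev_1_iff using \<phi>z(1) L weak by blast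
    define I where "I = Lp_int p U z"
    define J where "J b = Lp_int p U (wderiv U b z)" for b
    have nonneg: "I \<ge> 0" "J b \<ge> 0" for b
      unfolding I_def J_def set_lebesgue_integral_def by (auto intro!: integral_nonneg)
    have "Lp_int p U (\<lambda>x. wderiv U b (\<lambda>x. \<phi> x *\<^sub>R z x) x) \<le> 2 powr p * M powr p * (J b + I)"
      if b: "b \<in> Basis" for b
    proof -
      have "Lp_int p U (\<lambda>x. wderiv U b (\<lambda>x. \<phi> x *\<^sub>R z x) x) = Lp_int p U (\<lambda>x. d b x)"
      proof (rule set_integrable_lebesgue_cong_AE(2))
        show "AE x in lebesgue. x \<in> U \<longrightarrow> norm (d b x) powr p = norm (wderiv U b (\<lambda>x. \<phi> x *\<^sub>R z x) x) powr p"
          using wderiv_AE_eq[OF U weak[OF b]] by eventually_elim auto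
        show "set_integrable lebesgue U (\<lambda>x. norm (d b x) powr p)"
          using L[OF b] Ul by (simp add: Lp_iff)
      qed
      also have "\<dots> \<le> 2 powr p * (Lp_int p U (\<lambda>x. \<phi> x *\<^sub>R wderiv U b z x)
          + Lp_int p U (\<lambda>x. fderiv \<phi> x b *\<^sub>R z x))"
        unfolding d_def using Lp_add(2)[OF Ul L1(1,2)[OF b] p] .
      also have "\<dots> \<le> 2 powr p * (M powr p * J b + M powr p * I)"
        using L1(3,4)[OF b] by (intro mult_left_mono add_mono) (auto simp: I_def J_def)
      finally show ?thesis by (simp add: algebra_simps)
    qed
    moreover have "2 powr p * M powr p * (J b + I) \<le> 2 powr p * M powr p * (I + sum J Basis)" if "b \<in> Basis" for b
      using member_le_sum[OF that, of J] nonneg by (intro mult_left_mono) auto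
    ultimately have "Lp_int p U (wderiv U b (\<lambda>x. \<phi> x *\<^sub>R z x)) \<le> 2 powr p * M powr p * (I + sum J Basis)"
      if "b \<in> Basis" for b
      using that order_trans by blast
    moreover have "Lp_int p U (\<lambda>x. \<phi> x *\<^sub>R z x) \<le> M powr p * (I + sum J Basis)"
      using \<phi>z(2) mult_left_mono[of I "I + sum J Basis" "M powr p"] sum_nonneg[of Basis J] nonneg(2)
      by (simp add: I_def)
    ultimately have "sobolev_norm_powr 1 p U (\<lambda>x. \<phi> x *\<^sub>R z x)
        \<le> M powr p * (I + sum J Basis) + (\<Sum>b\<in>(Basis::'a set). 2 powr p * M powr p * (I + sum J Basis))"
      unfolding sobolev_norm_powr_1 by (intro add_mono sum_mono)
    then show "sobolev_norm_powr 1 p U (\<lambda>x. \<phi> x *\<^sub>R z x) \<le> ?C * sobolev_norm_powr 1 p U z"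
      by (simp add: sobolev_norm_powr_1 I_def J_def algebra_simps del: One_nat_def)
  qed
  show "\<And>z :: 'a \<Rightarrow> 'b. z \<in> sobolev 1 p U \<Longrightarrow> (\<lambda>x. \<phi> x *\<^sub>R z x) \<in> sobolev 1 p U"
    using * by blast
  show "\<exists>C. \<forall>z \<in> sobolev 1 p U. sobolev_norm_powr 1 p U (\<lambda>x. \<phi> x *\<^sub>R (z x :: 'b)) \<le> C * sobolev_norm_powr 1 p U z"
    using * by blast
qed

lemma sobolev_norm_powr_1_nonneg: "sobolev_norm_powr 1 p U f \<ge> 0"
  unfolding sobolev_norm_powr_1 set_lebesgue_integral_def
  by (intro add_nonneg_nonneg sum_nonneg integral_nonneg) auto

text \<open>
If test fields \<open>\<Phi>\<^sub>n\<close> approximate \<open>v\<close>, the test fields \<open>\<phi> \<Phi>\<^sub>n\<close> approximate \<open>\<phi> v\<close>.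
\<close>

lemma vel0_scaleR_test:
  fixes \<phi> :: "'a::euclidean_space \<Rightarrow> real"
  assumes U: "open U" and \<phi>: "\<phi> \<in> test_functions U" and v: "v \<in> vel0 U"
  shows "(\<lambda>x. \<phi> x *\<^sub>R v x) \<in> vel0 U"
  unfolding vel0_def
proof
  fix s :: real assume s: "s \<in> {1..<2}"
  then have "v \<in> sobolev0 1 s U" using v by (auto simp: vel0_def)
  then obtain \<Phi> where vs: "v \<in> sobolev 1 s U" and \<Phi>: "\<And>n. \<Phi> n \<in> test_functions U"
    and lim: "(\<lambda>n. sobolev_norm_powr 1 s U (\<lambda>x. \<Phi> n x - v x)) \<longlonglongrightarrow> 0"
    by (auto simp: sobolev0_def simp del: One_nat_def)
  obtain C where C: "\<And>z :: 'a \<Rightarrow> 'a. z \<in> sobolev 1 s U \<Longrightarrow>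
      sobolev_norm_powr 1 s U (\<lambda>x. \<phi> x *\<^sub>R z x) \<le> C * sobolev_norm_powr 1 s U z"
    using sobolev_1_scaleR_test(2)[OF U _ \<phi>, of s] s by (metis atLeastLessThan_iff order_trans zero_le_one)
  have diff: "(\<lambda>x. \<Phi> n x - v x) \<in> sobolev 1 s U" for n
    using U s vs test_functions_sobolev_1[OF U _ \<Phi>, of s n] by (intro sobolev_1_diff) auto
  have "(\<lambda>n. C * sobolev_norm_powr 1 s U (\<lambda>x. \<Phi> n x - v x)) \<longlonglongrightarrow> 0"
    using tendsto_mult_right_zero[OF lim] .
  then have lim': "(\<lambda>n. sobolev_norm_powr 1 s U (\<lambda>x. \<phi> x *\<^sub>R (\<Phi> n x - v x))) \<longlonglongrightarrow> 0"
  proof (rule Lim_null_comparison[rotated])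
    show "\<forall>\<^sub>F n in sequentially. norm (sobolev_norm_powr 1 s U (\<lambda>x. \<phi> x *\<^sub>R (\<Phi> n x - v x)))
        \<le> C * sobolev_norm_powr 1 s U (\<lambda>x. \<Phi> n x - v x)"
    proof (intro always_eventually allI)
      show "norm (sobolev_norm_powr 1 s U (\<lambda>x. \<phi> x *\<^sub>R (\<Phi> n x - v x)))
        \<le> C * sobolev_norm_powr 1 s U (\<lambda>x. \<Phi> n x - v x)" for n
        using C[OF diff[of n]] sobolev_norm_powr_1_nonneg[of s U "\<lambda>x. \<phi> x *\<^sub>R (\<Phi> n x - v x)"]
        by (simp only: real_norm_def abs_of_nonneg)
    qed
  qed
  have test: "(\<lambda>x. \<phi> x *\<^sub>R \<Phi> n x) \<in> test_functions U" for n
    using test_functions_bilinear[OF bounded_bilinear_scaleR \<phi>] test_functions_smooth[OF \<Phi>] by blast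
  have sob: "(\<lambda>x. \<phi> x *\<^sub>R v x) \<in> sobolev 1 s U"
    using s by (intro sobolev_1_scaleR_test(1)[OF U _ \<phi> vs]) auto
  show "(\<lambda>x. \<phi> x *\<^sub>R v x) \<in> sobolev0 1 s U"
    unfolding sobolev0_def
  proof (intro CollectI conjI sob exI[of _ "\<lambda>n x. \<phi> x *\<^sub>R \<Phi> n x"] allI test)
    show "(\<lambda>n. sobolev_norm_powr 1 s U (\<lambda>x. \<phi> x *\<^sub>R \<Phi> n x - \<phi> x *\<^sub>R v x)) \<longlonglongrightarrow> 0"
      using lim' by (simp only: scaleR_diff_right)
  qed
qed

section \<open>The product rule for the divergence\<close>

lemma vel0_vel: "v \<in> vel0 U \<Longrightarrow> v \<in> vel U"
  unfolding vel_def vel0_def sobolev0_def by blast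

lemma vel_weak_derivs:
  assumes "v \<in> vel U"
  obtains g where "\<And>b. b \<in> Basis \<Longrightarrow> has_weak_deriv U b v (g b)"
proof -
  have v: "v \<in> sobolev 1 1 U"
    using assms by (auto simp: vel_def simp del: One_nat_def dest!: bspec[of _ _ 1])
  have "\<forall>b\<in>Basis. \<exists>g. has_weak_deriv U b v g"
    using v unfolding sobolev_1_iff by blast
  with that show ?thesis by metis
qed

lemma vel_has_weak_div:
  assumes "v \<in> vel U"
  shows "has_weak_div U v (wdiv U v)"
  by (rule vel_weak_derivs[OF assms]) (blast intro: has_weak_div_wdiv has_weak_div_of_weak_derivs)

lemma set_integrable_L1_loc:
  fixes f :: "'a::euclidean_space \<Rightarrow> 'b::euclidean_space"
  assumes "set_integrable lebesgue U f"
  shows "f \<in> L1_loc U"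
  unfolding L1_loc_def
  by (auto intro!: set_integrable_subset[OF assms] fmeasurableD lmeasurable_compact)

text \<open>
Testing the claim with \<open>\<phi>\<close> means \<open>\<integral> g v \<bullet> \<nabla>\<phi> = - \<integral> \<phi> (g div v + \<nabla>g \<bullet> v)\<close>. Since
\<open>div(\<phi> v) = \<phi> div v + \<nabla>\<phi> \<bullet> v\<close>, this is exactly Green's formula for \<open>g\<close> and the field \<open>\<phi> v\<close>.
\<close>

theorem wdiv_product_rule:
  fixes g :: "'a::euclidean_space \<Rightarrow> real" and v :: "'a \<Rightarrow> 'a"
  assumes U: "open U" and v: "v \<in> vel0 U" and green: "green_admissible U g"
    and int1: "set_integrable lebesgue U (\<lambda>x. g x * wdiv U v x)"
    and int2: "set_integrable lebesgue U (\<lambda>x. wgrad U g x \<bullet> v x)"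
    and gv: "has_weak_div U (\<lambda>x. g x *\<^sub>R v x) h"
  shows "AE x in lebesgue. x \<in> U \<longrightarrow> wdiv U (\<lambda>x. g x *\<^sub>R v x) x = g x * wdiv U v x + wgrad U g x \<bullet> v x"
proof (rule wdiv_AE_eq[OF U])
  have gvL: "(\<lambda>x. g x *\<^sub>R v x) \<in> L1_loc U" using gv by (simp add: has_weak_div_iff)
  show "has_weak_div U (\<lambda>x. g x *\<^sub>R v x) (\<lambda>x. g x * wdiv U v x + wgrad U g x \<bullet> v x)"
    unfolding has_weak_div_iff
  proof (intro conjI allI impI)
    show "(\<lambda>x. g x *\<^sub>R v x) \<in> L1_loc U" by (rule gvL)
    show "(\<lambda>x. g x * wdiv U v x + wgrad U g x \<bullet> v x) \<in> L1_loc U"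
      using set_integrable_L1_loc[OF int1] set_integrable_L1_loc[OF int2] by (rule L1_loc_add)
    fix \<phi> :: "'a \<Rightarrow> real" assume \<phi>: "\<phi> \<in> test_functions U"
    let ?D = "\<lambda>x. fderiv \<phi> x (g x *\<^sub>R v x)"
    note L1 = test_L1_loc_integrable(1)[OF \<phi> set_integrable_L1_loc[OF int1], simplified]
    note L2 = test_L1_loc_integrable(1)[OF \<phi> set_integrable_L1_loc[OF int2], simplified]
    note L3 = test_frechet_L1_loc(2)[OF \<phi> gvL refl]
    have D: "?D x = g x * fderiv \<phi> x (v x)" for x
      using has_derivative_linear[OF test_functions_has_derivative[OF \<phi>]] by (simp add: linear_cmul)
    have out: "\<phi> x * (g x * wdiv U v x) + ?D x = 0" "\<phi> x * (wgrad U g x \<bullet> v x) = 0" if "x \<notin> U" for x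
      using test_functions_outside[OF \<phi> that] by simp_all
    have "AE x in lebesgue. x \<in> U \<longrightarrow> wdiv U (\<lambda>x. \<phi> x *\<^sub>R v x) x = \<phi> x * wdiv U v x + fderiv \<phi> x (v x)"
    proof -
      obtain d where d: "\<And>b. b \<in> Basis \<Longrightarrow> has_weak_deriv U b v (d b)"
        using vel_weak_derivs[OF vel0_vel[OF v]] by blast
      have "AE x in lebesgue. x \<in> U \<longrightarrow> wdiv U v x = (\<Sum>b\<in>Basis. d b x \<bullet> b)"
        "AE x in lebesgue. x \<in> U \<longrightarrow> wdiv U (\<lambda>x. \<phi> x *\<^sub>R v x) x
          = \<phi> x * (\<Sum>b\<in>Basis. d b x \<bullet> b) + fderiv \<phi> x (v x)"
        by (intro wdiv_AE_eq[OF U] has_weak_div_of_weak_derivs has_weak_div_scaleR_test[OF \<phi>] d; assumption)+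
      then show ?thesis
        by eventually_elim simp
    qed
    then have ae: "AE x in lebesgue. x \<in> U \<longrightarrow> \<phi> x * (g x * wdiv U v x) + ?D x = g x * wdiv U (\<lambda>x. \<phi> x *\<^sub>R v x) x"
      by eventually_elim (simp add: D algebra_simps)
    have int: "set_integrable lebesgue U (\<lambda>x. \<phi> x * (g x * wdiv U v x) + ?D x)"
      using L1 L3 by (subst set_integral_eq_integral_if_zero_outside(2)[OF out(1)]) auto
    have grad: "(\<lambda>x. wgrad U g x \<bullet> \<phi> x *\<^sub>R v x) = (\<lambda>x. \<phi> x * (wgrad U g x \<bullet> v x))"
      by simp
    have int': "set_integrable lebesgue U (\<lambda>x. wgrad U g x \<bullet> \<phi> x *\<^sub>R v x)"
      unfolding grad using L2 by (subst set_integral_eq_integral_if_zero_outside(2)[OF out(2)]) auto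
    \<comment> \<open>Green's formula for the field \<open>\<phi> v\<close>, which again vanishes on the boundary\<close>
    have "(LINT x:U|lebesgue. g x * wdiv U (\<lambda>x. \<phi> x *\<^sub>R v x) x) = - (LINT x:U|lebesgue. wgrad U g x \<bullet> \<phi> x *\<^sub>R v x)"
      using green set_integrable_lebesgue_cong_AE(1)[OF ae int] int' vel0_scaleR_test[OF U \<phi> v]
      unfolding green_admissible_def by blast
    then have "(LINT x:U|lebesgue. \<phi> x * (g x * wdiv U v x) + ?D x) = - (LINT x:U|lebesgue. \<phi> x * (wgrad U g x \<bullet> v x))"
      unfolding set_integrable_lebesgue_cong_AE(2)[OF ae int] grad .
    also have "(LINT x:U|lebesgue. \<phi> x * (g x * wdiv U v x) + ?D x) = (LINT x|lebesgue. \<phi> x * (g x * wdiv U v x) + ?D x)"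
      by (rule set_integral_eq_integral_if_zero_outside(1)[OF out(1)])
    also have "(LINT x:U|lebesgue. \<phi> x * (wgrad U g x \<bullet> v x)) = (LINT x|lebesgue. \<phi> x * (wgrad U g x \<bullet> v x))"
      by (rule set_integral_eq_integral_if_zero_outside(1)[OF out(2)])
    finally have "(LINT x|lebesgue. \<phi> x * (g x * wdiv U v x) + ?D x) = - (LINT x|lebesgue. \<phi> x * (wgrad U g x \<bullet> v x))" .
    then show "(LINT x|lebesgue. ?D x) = - (LINT x|lebesgue. \<phi> x * (g x * wdiv U v x + wgrad U g x \<bullet> v x))"
      using L1 L2 L3 by (simp add: distrib_left)
  qed
qed

section \<open>Continuity of translations in the mean\<close>

definition shift_gap :: "('a::euclidean_space \<Rightarrow> real) \<Rightarrow> 'a \<Rightarrow> real" where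
  "shift_gap f y = (LINT x|lborel. \<bar>f (x + y) - f x\<bar>)"

lemma integrable_shift:
  fixes f :: "'a::euclidean_space \<Rightarrow> real"
  assumes "integrable lborel f"
  shows "integrable lborel (\<lambda>x. f (x + y))" "integrable lborel (\<lambda>x. \<bar>f (x + y) - f x\<bar>)"
proof -
  show 1: "integrable lborel (\<lambda>x. f (x + y))"
    using assms borel_measurable_integrable[OF assms] lborel_translation(1)[of f y] by simp
  show "integrable lborel (\<lambda>x. \<bar>f (x + y) - f x\<bar>)"
    by (intro integrable_abs Bochner_Integration.integrable_diff 1 assms)
qed

lemma shift_gap_nonneg: "shift_gap f y \<ge> 0"
  unfolding shift_gap_def by (intro Bochner_Integration.integral_nonneg) auto

lemma shift_gap_le:
  assumes f: "integrable lborel f" and g: "integrable lborel g"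
  shows "shift_gap f y \<le> shift_gap g y + 2 * (LINT x|lborel. \<bar>f x - g x\<bar>)"
proof -
  have fg: "integrable lborel (\<lambda>x. \<bar>f x - g x\<bar>)" using f g by auto
  then have fg': "integrable lborel (\<lambda>x. \<bar>f (x + y) - g (x + y)\<bar>)"
    "(LINT x|lborel. \<bar>f (x + y) - g (x + y)\<bar>) = (LINT x|lborel. \<bar>f x - g x\<bar>)"
    using lborel_translation[OF borel_measurable_integrable[OF fg, simplified], of y] by simp_all
  have "shift_gap f y \<le> (LINT x|lborel. \<bar>g (x + y) - g x\<bar> + (\<bar>f (x + y) - g (x + y)\<bar> + \<bar>f x - g x\<bar>))"
    unfolding shift_gap_def
    using integrable_shift[OF f] integrable_shift[OF g] fg fg'(1) by (intro integral_mono) auto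
  also have "\<dots> = shift_gap g y + 2 * (LINT x|lborel. \<bar>f x - g x\<bar>)"
    unfolding shift_gap_def using integrable_shift(2)[OF g] fg fg' by simp
  finally show ?thesis .
qed

lemma shift_gap_tendsto_approx:
  fixes c :: "nat \<Rightarrow> 'a::euclidean_space"
  assumes f: "integrable lborel f"
    and approx: "\<And>e. e > 0 \<Longrightarrow> \<exists>g. integrable lborel g \<and> (LINT x|lborel. \<bar>f x - g x\<bar>) < e \<and> (\<lambda>n. shift_gap g (c n)) \<longlonglongrightarrow> 0"
  shows "(\<lambda>n. shift_gap f (c n)) \<longlonglongrightarrow> 0"
proof (rule LIMSEQ_I)
  fix e :: real assume e: "e > 0"
  obtain g where g: "integrable lborel g" "(LINT x|lborel. \<bar>f x - g x\<bar>) < e / 4"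
    and lim: "(\<lambda>n. shift_gap g (c n)) \<longlonglongrightarrow> 0"
    using approx[of "e / 4"] e by auto
  obtain n0 where n0: "\<And>n. n \<ge> n0 \<Longrightarrow> \<bar>shift_gap g (c n)\<bar> < e / 2"
    using LIMSEQ_D[OF lim, of "e / 2"] e by auto
  have "norm (shift_gap f (c n) - 0) < e" if "n \<ge> n0" for n
    using n0[OF that] shift_gap_le[OF f g(1), of "c n"] g(2) shift_gap_nonneg[of f "c n"] by simp
  then show "\<exists>n0. \<forall>n\<ge>n0. norm (shift_gap f (c n) - 0) < e" by blast
qed

text \<open>
For an open set the indicator is lower semicontinuous, so the positive part of \<open>1\<^sub>S(x) - 1\<^sub>S(x + y)\<close>
tends to zero pointwise as \<open>y\<close> tends to zero and is dominated by \<open>1\<^sub>S\<close>. The positive and the negative part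
of the difference have the same integral, as the measure is translation invariant.
\<close>

lemma shift_gap_open:
  fixes S :: "'a::euclidean_space set"
  assumes S: "open S" "emeasure lborel S < \<infinity>" and c: "c \<longlonglongrightarrow> 0"
  shows "(\<lambda>n. shift_gap (indicator S) (c n)) \<longlonglongrightarrow> 0"
proof -
  have int: "integrable lborel (indicat_real S)"
    using S by (intro integrable_real_indicator) auto
  define d where "d n x = max 0 (indicat_real S x - indicat_real S (x + c n))" for n x
  have dint: "integrable lborel (d n)" for n
    unfolding d_def using integrable_shift(1)[OF int] int by auto
  have "shift_gap (indicator S) (c n) = 2 * (LINT x|lborel. d n x)" for n
  proof -
    have "\<bar>indicat_real S (x + c n) - indicat_real S x\<bar> = 2 * d n x + (indicat_real S (x + c n) - indicat_real S x)" for x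
      by (auto simp: d_def max_def indicator_def)
    then have "shift_gap (indicator S) (c n) = (LINT x|lborel. 2 * d n x + (indicat_real S (x + c n) - indicat_real S x))"
      by (simp add: shift_gap_def)
    also have "\<dots> = 2 * (LINT x|lborel. d n x) + ((LINT x|lborel. indicat_real S (x + c n)) - (LINT x|lborel. indicat_real S x))"
      using dint integrable_shift(1)[OF int] int by simp
    also have "(LINT x|lborel. indicat_real S (x + c n)) = (LINT x|lborel. indicat_real S x)"
      using S by (intro lborel_translation(2) borel_measurable_indicator) auto
    finally show ?thesis by simp
  qed
  moreover have "(\<lambda>n. LINT x|lborel. d n x) \<longlonglongrightarrow> (LINT x::'a|lborel. (0::real))"
  proof (rule integral_dominated_convergence[where s = d and f = "\<lambda>_. 0" and w = "indicat_real S"])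
    show "integrable lborel (indicat_real S)" by (rule int)
    show "AE x in lborel. (\<lambda>n. d n x) \<longlonglongrightarrow> 0"
    proof (intro AE_I2)
      fix x
      show "(\<lambda>n. d n x) \<longlonglongrightarrow> 0"
      proof (cases "x \<in> S")
        case True
        have "(\<lambda>n. x + c n) \<longlonglongrightarrow> x + 0" using c by (intro tendsto_intros)
        then have "\<forall>\<^sub>F n in sequentially. x + c n \<in> S"
          using True S(1) by (intro topological_tendstoD) auto
        then have "\<forall>\<^sub>F n in sequentially. 0 = d n x"
          by eventually_elim (simp add: d_def True)
        then show ?thesis by (rule Lim_transform_eventually[OF tendsto_const])
      next
        case False
        then have "d n x = 0" for n by (simp add: d_def)
        then show ?thesis by simp
      qed
    qed
    show "AE x in lborel. norm (d n x) \<le> indicat_real S x" for n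
      by (intro AE_I2) (auto simp: d_def indicator_def)
  qed (use dint in auto)
  ultimately show ?thesis
    using tendsto_mult_right_zero[of "\<lambda>n. LINT x|lborel. d n x" sequentially 2] by simp
qed

text \<open>
Continuity of translations in the mean. Outer regularity reduces indicators of measurable sets to open
sets; linearity and approximation in the mean give the general case.
\<close>

theorem shift_gap_tendsto_0:
  fixes f :: "'a::euclidean_space \<Rightarrow> real"
  assumes "integrable lborel f" and c: "c \<longlonglongrightarrow> 0"
  shows "(\<lambda>n. shift_gap f (c n)) \<longlonglongrightarrow> 0"
  using assms(1)
proof induction
  case (base A a)
  have A: "A \<in> sets lborel" "emeasure lborel A < \<infinity>" using base by auto
  have intA: "integrable lborel (indicat_real A)"
    using A by (intro integrable_real_indicator) auto
  have ind: "(\<lambda>n. shift_gap (indicat_real A) (c n)) \<longlonglongrightarrow> 0"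
  proof (rule shift_gap_tendsto_approx[OF intA])
    fix e :: real assume e: "e > 0"
    have Al: "A \<in> sets lebesgue" using A(1) by auto
    obtain S where S: "open S" "A \<subseteq> S" "S - A \<in> lmeasurable" "emeasure lebesgue (S - A) < ennreal e"
      using sets_lebesgue_outer_open[OF Al e] by metis
    have SA: "S - A \<in> sets lborel" using S(1) A(1) by auto
    have em: "emeasure lborel (S - A) < ennreal e"
      using S(4) SA by simp
    have "emeasure lborel S = emeasure lborel (A \<union> (S - A))"
      using S(2) by (auto intro!: arg_cong[where f = "emeasure lborel"])
    also have "\<dots> \<le> emeasure lborel A + emeasure lborel (S - A)"
      using A(1) SA by (intro emeasure_subadditive)
    also have "\<dots> < \<infinity>"
      using A(2) em by (auto simp: less_top[symmetric])
    finally have Sfin: "emeasure lborel S < \<infinity>" .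
    have "(LINT x|lborel. \<bar>indicat_real A x - indicat_real S x\<bar>) = (LINT x|lborel. indicat_real (S - A) x)"
      using S(2) by (intro Bochner_Integration.integral_cong) (auto simp: indicator_def)
    also have "\<dots> = measure lborel (S - A)" by simp
    also have "\<dots> < e"
    proof -
      have "emeasure lborel (S - A) \<noteq> top" using em by auto
      then have "ennreal (measure lborel (S - A)) < ennreal e"
        using em by (simp add: emeasure_eq_ennreal_measure)
      then show ?thesis using e by (simp add: ennreal_less_iff)
    qed
    finally show "\<exists>g. integrable lborel g \<and> (LINT x|lborel. \<bar>indicat_real A x - g x\<bar>) < e \<and> (\<lambda>n. shift_gap g (c n)) \<longlonglongrightarrow> 0"
      using S Sfin shift_gap_open[OF S(1) Sfin c] by (intro exI[of _ "indicat_real S"]) (auto intro!: integrable_real_indicator)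
  qed
  have "shift_gap (\<lambda>x. indicat_real A x *\<^sub>R a) y = \<bar>a\<bar> * shift_gap (indicat_real A) y" for y
  proof -
    have "\<bar>indicat_real A (x + y) *\<^sub>R a - indicat_real A x *\<^sub>R a\<bar> = \<bar>a\<bar> * \<bar>indicat_real A (x + y) - indicat_real A x\<bar>" for x
      by (simp add: abs_mult[symmetric] algebra_simps)
    then show ?thesis by (simp add: shift_gap_def)
  qed
  then show ?case
    using tendsto_mult_right_zero[OF ind, of "\<bar>a\<bar>"] by simp
next
  case (add f g)
  show ?case
  proof (rule tendsto_sandwich[OF _ _ tendsto_const])
    show "\<forall>\<^sub>F n in sequentially. 0 \<le> shift_gap (\<lambda>x. f x + g x) (c n)"
      by (simp add: shift_gap_nonneg)
    show "\<forall>\<^sub>F n in sequentially. shift_gap (\<lambda>x. f x + g x) (c n) \<le> shift_gap f (c n) + shift_gap g (c n)"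
    proof (intro always_eventually allI)
      fix n
      have "shift_gap (\<lambda>x. f x + g x) (c n) \<le> (LINT x|lborel. \<bar>f (x + c n) - f x\<bar> + \<bar>g (x + c n) - g x\<bar>)"
        unfolding shift_gap_def
        using integrable_shift[OF add.hyps(1)] integrable_shift[OF add.hyps(2)] add.hyps
        by (intro integral_mono Bochner_Integration.integrable_add integrable_abs Bochner_Integration.integrable_diff) auto
      also have "\<dots> = shift_gap f (c n) + shift_gap g (c n)"
        unfolding shift_gap_def using integrable_shift(2)[OF add.hyps(1)] integrable_shift(2)[OF add.hyps(2)] by simp
      finally show "shift_gap (\<lambda>x. f x + g x) (c n) \<le> shift_gap f (c n) + shift_gap g (c n)" .
    qed
    show "(\<lambda>n. shift_gap f (c n) + shift_gap g (c n)) \<longlonglongrightarrow> 0"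
      using tendsto_add[OF add.IH] by simp
  qed
next
  case (lim f s)
  show ?case
  proof (rule shift_gap_tendsto_approx[OF lim.hyps(4)])
    fix e :: real assume e: "e > 0"
    have "(\<lambda>i. LINT x|lborel. \<bar>f x - s i x\<bar>) \<longlonglongrightarrow> (LINT x::'a|lborel. (0::real))"
    proof (rule integral_dominated_convergence)
      show "integrable lborel (\<lambda>x. 3 * \<bar>f x\<bar>)" using lim.hyps(4) by auto
      show "AE x in lborel. norm \<bar>f x - s i x\<bar> \<le> 3 * \<bar>f x\<bar>" for i
      proof (intro AE_I2)
        show "norm \<bar>f x - s i x\<bar> \<le> 3 * \<bar>f x\<bar>" for x using lim.hyps(3)[of x i] by simp
      qed
      show "AE x in lborel. (\<lambda>i. \<bar>f x - s i x\<bar>) \<longlonglongrightarrow> 0"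
      proof (intro AE_I2)
        fix x
        have "(\<lambda>i. \<bar>f x - s i x\<bar>) \<longlonglongrightarrow> \<bar>f x - f x\<bar>"
          using lim.hyps(2)[of x] by (intro tendsto_intros) auto
        then show "(\<lambda>i. \<bar>f x - s i x\<bar>) \<longlonglongrightarrow> 0" by simp
      qed
      have [measurable]: "f \<in> borel_measurable lborel" "s i \<in> borel_measurable lborel" for i
        using lim.hyps(1,4) by auto
      show "(\<lambda>x. \<bar>f x - s i x\<bar>) \<in> borel_measurable lborel" for i by measurable
    qed auto
    then obtain i where "(LINT x|lborel. \<bar>f x - s i x\<bar>) < e"
      using e order_tendstoD(2)[of "\<lambda>i. LINT x|lborel. \<bar>f x - s i x\<bar>" 0 sequentially e]
      by (auto simp: eventually_sequentially)
    then show "\<exists>g. integrable lborel g \<and> (LINT x|lborel. \<bar>f x - g x\<bar>) < e \<and> (\<lambda>n. shift_gap g (c n)) \<longlonglongrightarrow> 0"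
      using lim.hyps(1) lim.IH by blast
  qed
qed

lemma shift_gap_uniform:
  fixes f :: "'a::euclidean_space \<Rightarrow> real"
  assumes f: "integrable lborel f" and e: "e > 0"
  obtains \<delta> where "\<delta> > 0" "\<And>y. norm y < \<delta> \<Longrightarrow> shift_gap f y < e"
proof -
  have "(shift_gap f \<longlongrightarrow> 0) (at 0)"
    unfolding tendsto_at_iff_sequentially comp_def using shift_gap_tendsto_0[OF f] by blast
  then have "\<forall>\<^sub>F y in at 0. shift_gap f y < e"
    using e by (rule order_tendstoD(2))
  then obtain \<delta> where \<delta>: "\<delta> > 0" "\<And>y. y \<noteq> 0 \<Longrightarrow> norm y < \<delta> \<Longrightarrow> shift_gap f y < e"
    by (auto simp: eventually_at dist_norm)
  moreover have "shift_gap f 0 < e" using e by (simp add: shift_gap_def)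
  ultimately show ?thesis by (intro that[of \<delta>]) metis+
qed

section \<open>Difference quotients of weakly differentiable functions\<close>

text \<open>
A form of Tonelli's criterion adapted to the means below: the section integrals are bounded and supported
in a compact parameter interval.
\<close>

lemma integrable_lborel_pair:
  fixes H :: "real \<times> 'a::euclidean_space \<Rightarrow> real"
  assumes meas: "H \<in> borel_measurable borel"
    and int: "\<And>t. integrable lborel (\<lambda>x. H (t, x))"
    and bound: "\<And>t. (LINT x|lborel. \<bar>H (t, x)\<bar>) \<le> C * indicator {a..b} t"
  shows "integrable (lborel \<Otimes>\<^sub>M lborel) H"
proof (rule lborel_pair.Fubini_integrable)
  show [measurable]: "H \<in> borel_measurable (lborel \<Otimes>\<^sub>M lborel)"
    using meas by (simp add: lborel_prod)
  show "integrable lborel (\<lambda>t. LINT x|lborel. norm (H (t, x)))"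
  proof (rule Bochner_Integration.integrable_bound)
    show "integrable lborel (\<lambda>t. C * indicat_real {a..b} t)"
      by (intro integrable_mult_right integrable_real_indicator emeasure_bounded_finite) auto
    show "(\<lambda>t. LINT x|lborel. norm (H (t, x))) \<in> borel_measurable lborel"
      by measurable
    show "AE t in lborel. norm (LINT x|lborel. norm (H (t, x))) \<le> norm (C * indicat_real {a..b} t)"
    proof (intro AE_I2)
      fix t
      have "(LINT x|lborel. \<bar>H (t, x)\<bar>) \<ge> 0" by (intro Bochner_Integration.integral_nonneg) auto
      then show "norm (LINT x|lborel. norm (H (t, x))) \<le> norm (C * indicat_real {a..b} t)"
        using bound[of t] by simp
    qed
  qed
qed (use int in auto)

lemma AE_translation:
  fixes P :: "'a::euclidean_space \<Rightarrow> bool"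
  assumes "AE x in lebesgue. P x"
  shows "AE x in lebesgue. P (x + c)"
proof -
  have "negligible {x. \<not> P x}"
    using assms completion.AE_iff_null_sets[of P lborel] by (simp add: negligible_iff_null_sets)
  then have "negligible ((+) (- c) ` {x. \<not> P x})"
    by (rule negligible_translation)
  also have "(+) (- c) ` {x. \<not> P x} = {x. \<not> P (x + c)}"
    by (auto simp: image_iff intro!: exI[of _ "_ + c"])
  finally show ?thesis
    using completion.AE_iff_null_sets[of "\<lambda>x. P (x + c)" lborel] by (simp add: negligible_iff_null_sets)
qed

lemma integrable_lebesgue_L1_loc:
  fixes f :: "'a::euclidean_space \<Rightarrow> 'b::euclidean_space"
  assumes "integrable lborel f"
  shows "integrable lebesgue f" "(LINT x|lebesgue. f x) = (LINT x|lborel. f x)" "f \<in> L1_loc U"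
proof -
  show 1: "integrable lebesgue f"
    using assms integrable_completion borel_measurable_integrable by blast
  show "(LINT x|lebesgue. f x) = (LINT x|lborel. f x)"
    using borel_measurable_integrable[OF assms] by (rule integral_completion)
  show "f \<in> L1_loc U"
    using 1 by (auto simp: L1_loc_def set_integrable_def intro!: integrable_mult_indicator fmeasurableD lmeasurable_compact)
qed

text \<open>
This is \<open>h\<close> times the Steklov mean of \<open>G\<close> in direction \<open>b\<close>. Without normalization it is the
candidate for the increment \<open>F(x + h b) - F(x)\<close> if \<open>G\<close> is the weak derivative of \<open>F\<close>.
\<close>

definition steklov :: "('a::euclidean_space \<Rightarrow> real) \<Rightarrow> 'a \<Rightarrow> real \<Rightarrow> 'a \<Rightarrow> real" where
  "steklov G b h x = (LINT t|lborel. indicator {0..h} t * G (x + t *\<^sub>R b))"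

lemma shifted_integrable_pair:
  fixes G :: "'a::euclidean_space \<Rightarrow> real" and K :: "real \<times> 'a \<Rightarrow> real"
  assumes G: "G \<in> borel_measurable borel" "integrable lborel G"
    and K: "K \<in> borel_measurable borel" "\<And>z. \<bar>K z\<bar> \<le> M"
  shows "integrable (lborel \<Otimes>\<^sub>M lborel) (\<lambda>(t, x). indicator {0..h} t * (K (t, x) * G (x + t *\<^sub>R b)))"
proof (rule integrable_lborel_pair[where C = "M * (LINT x|lborel. \<bar>G x\<bar>)" and a = 0 and b = h])
  have [measurable]: "K \<in> borel_measurable (borel \<Otimes>\<^sub>M borel)" using K(1) by (simp add: borel_prod)
  note [measurable] = G(1)
  show "(\<lambda>(t, x). indicator {0..h} t * (K (t, x) * G (x + t *\<^sub>R b))) \<in> borel_measurable borel"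
    unfolding borel_prod[symmetric] by measurable
  have int: "integrable lborel (\<lambda>x. K (t, x) * G (x + t *\<^sub>R b))" for t
    using integrable_scaleR_bounded[OF integrable_shift(1)[OF G(2)], of "\<lambda>x. K (t, x)" M] K(2) by simp
  then show "integrable lborel (\<lambda>x. case (t, x) of (t, x) \<Rightarrow> indicator {0..h} t * (K (t, x) * G (x + t *\<^sub>R b)))" for t
    by simp
  have M: "M \<ge> 0" using K(2)[of "(0, 0)"] by linarith
  have "(LINT x|lborel. \<bar>K (t, x) * G (x + t *\<^sub>R b)\<bar>) \<le> (LINT x|lborel. M * \<bar>G (x + t *\<^sub>R b)\<bar>)" for t
    using int integrable_shift(1)[OF G(2)] K(2)
    by (intro integral_mono integrable_abs integrable_mult_right) (auto simp: abs_mult intro!: mult_right_mono)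
  also have "(LINT x|lborel. M * \<bar>G (x + t *\<^sub>R b)\<bar>) = M * (LINT x|lborel. \<bar>G x\<bar>)" for t
    using lborel_translation(2)[of "\<lambda>x. \<bar>G x\<bar>" "t *\<^sub>R b"] by simp
  finally show "(LINT x|lborel. \<bar>case (t, x) of (t, x) \<Rightarrow> indicator {0..h} t * (K (t, x) * G (x + t *\<^sub>R b))\<bar>)
      \<le> M * (LINT x|lborel. \<bar>G x\<bar>) * indicator {0..h} t" for t
    by (cases "t \<in> {0..h}") auto
qed

lemma steklov_integral:
  fixes G k :: "'a::euclidean_space \<Rightarrow> real"
  assumes G: "G \<in> borel_measurable borel" "integrable lborel G"
    and k: "k \<in> borel_measurable borel" "\<And>x. \<bar>k x\<bar> \<le> M"
  shows "integrable lborel (\<lambda>x. k x * steklov G b h x)"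
    "(LINT x|lborel. k x * steklov G b h x) = (LINT t|lborel. indicator {0..h} t * (LINT x|lborel. k x * G (x + t *\<^sub>R b)))"
proof -
  let ?H = "\<lambda>t x. indicator {0..h} t * (k x * G (x + t *\<^sub>R b))"
  have "(\<lambda>z::real \<times> 'a. k (snd z)) \<in> borel_measurable borel"
    by (rule measurable_compose[OF _ k(1)]) (auto intro!: borel_measurable_continuous_onI continuous_intros)
  from shifted_integrable_pair[OF G this, of M] k(2)
  have H: "integrable (lborel \<Otimes>\<^sub>M lborel) (case_prod ?H)"
    by simp
  have eq: "(LINT t|lborel. ?H t x) = k x * steklov G b h x" for x
  proof -
    have "?H t x = k x * (indicator {0..h} t * G (x + t *\<^sub>R b))" for t by simp
    then show ?thesis unfolding steklov_def by (simp only: integral_mult_right_zero)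
  qed
  show "integrable lborel (\<lambda>x. k x * steklov G b h x)"
    using lborel_pair.integrable_snd[OF H] by (simp add: eq)
  have "(LINT x|lborel. (LINT t|lborel. ?H t x)) = (LINT t|lborel. (LINT x|lborel. ?H t x))"
    using H by (rule lborel_pair.Fubini_integral)
  then show "(LINT x|lborel. k x * steklov G b h x) = (LINT t|lborel. indicator {0..h} t * (LINT x|lborel. k x * G (x + t *\<^sub>R b)))"
    by (simp add: eq)
qed

lemma test_increment_integral:
  fixes \<phi> :: "'a::euclidean_space \<Rightarrow> real"
  assumes \<phi>: "\<phi> \<in> test_functions U" and h: "h \<ge> 0"
  shows "(LINT t|lborel. indicator {0..h} t * fderiv \<phi> (y + t *\<^sub>R b) b) = \<phi> (y + h *\<^sub>R b) - \<phi> y"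
proof -
  have cont: "continuous_on UNIV (\<lambda>x. fderiv \<phi> x b)"
    using test_functions_smooth[OF test_functions_deriv[OF \<phi>], of 0 b] by simp
  have "continuous_on UNIV (\<lambda>t. fderiv \<phi> (y + t *\<^sub>R b) b)"
    by (rule continuous_on_compose2[OF cont]) (auto intro!: continuous_intros)
  then have "isCont (\<lambda>t. fderiv \<phi> (y + t *\<^sub>R b) b) t" for t
    by (simp add: continuous_on_eq_continuous_at)
  then have "(LINT t|lborel. fderiv \<phi> (y + t *\<^sub>R b) b * indicator {0..h} t) = \<phi> (y + h *\<^sub>R b) - \<phi> (y + 0 *\<^sub>R b)"
    using h test_functions_line_derivative[OF \<phi>] by (intro integral_FTC_Icc_real) auto
  then show ?thesis by (simp add: mult.commute)
qed

text \<open>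
  The weak fundamental theorem of calculus in direction \<open>b\<close>: both sides are moved onto the test
  function, where the classical theorem applies, and the weak derivative is used under the integral.
\<close>

text \<open>
A weak fundamental theorem of calculus in direction \<open>b\<close>. The increment is moved onto the test function,
where the classical theorem applies; the definition of the weak derivative is then used for each fixed
translate of the test function, and Fubini's theorem moves the translation back. The hypothesis on the
translates is stated only up to the step \<open>h\<close>, because larger translates may leave the domain.
\<close>

lemma steklov_weak_identity:
  fixes F G \<phi> :: "'a::euclidean_space \<Rightarrow> real"
  assumes F: "F \<in> borel_measurable borel" "integrable lborel F"
    and G: "G \<in> borel_measurable borel" "integrable lborel G"
    and \<phi>: "\<phi> \<in> test_functions V" and h: "h \<ge> 0"
    and weak: "\<And>t. 0 \<le> t \<Longrightarrow> t \<le> h \<Longrightarrow>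
      (LINT y|lborel. fderiv \<phi> (y + t *\<^sub>R (- b)) (- b) * F y) = (LINT y|lborel. \<phi> (y + t *\<^sub>R (- b)) * G y)"
  shows "(LINT x|lborel. \<phi> x * (F (x + h *\<^sub>R b) - F x)) = (LINT x|lborel. \<phi> x * steklov G b h x)"
proof -
  note \<phi>b = Cc_measurable(1)[OF test_functions_Cc[OF \<phi>]]
  note \<phi>'b = Cc_measurable(1)[OF test_functions_Cc[OF test_functions_deriv[OF \<phi>, of "- b"]]]
  obtain M where M: "\<And>x. \<bar>\<phi> x\<bar> \<le> M"
    using Cc_bounded[OF test_functions_Cc[OF \<phi>]] by (metis real_norm_def)
  obtain M' where M': "\<And>x. \<bar>fderiv \<phi> x (- b)\<bar> \<le> M'"
    using Cc_bounded[OF test_functions_Cc[OF test_functions_deriv[OF \<phi>, of "- b"]]] by (metis real_norm_def)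
  have int: "integrable lborel (\<lambda>x. \<phi> (x + c) * F (x + d))" for c d
  proof -
    have "(\<lambda>x. \<phi> (x + c)) \<in> borel_measurable lborel" using \<phi>b by measurable
    from integrable_scaleR_bounded[OF integrable_shift(1)[OF F(2), of d] this, of M] M show ?thesis by simp
  qed
  let ?K = "\<lambda>z::real \<times> 'a. fderiv \<phi> (snd z + fst z *\<^sub>R (- b)) (- b)"
  let ?H = "\<lambda>t y. indicator {0..h} t * (fderiv \<phi> (y + t *\<^sub>R (- b)) (- b) * F y)"
  have "?K \<in> borel_measurable borel"
    by (rule measurable_compose[OF _ \<phi>'b]) (auto intro!: borel_measurable_continuous_onI continuous_intros)
  from shifted_integrable_pair[OF F this, of M' h 0] M'
  have H: "integrable (lborel \<Otimes>\<^sub>M lborel) (case_prod ?H)" by simp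
  have "(LINT x|lborel. \<phi> x * (F (x + h *\<^sub>R b) - F x)) = (LINT x|lborel. \<phi> x * F (x + h *\<^sub>R b)) - (LINT x|lborel. \<phi> x * F x)"
    using int[of 0 "h *\<^sub>R b"] int[of 0 0] by (simp add: right_diff_distrib)
  also have "(LINT x|lborel. \<phi> x * F (x + h *\<^sub>R b)) = (LINT y|lborel. \<phi> (y + h *\<^sub>R (- b)) * F y)"
    using lborel_translation(2)[OF borel_measurable_integrable[OF int[of "h *\<^sub>R (- b)" 0], simplified], of "h *\<^sub>R b"] by simp
  also have "\<dots> - (LINT x|lborel. \<phi> x * F x) = (LINT y|lborel. (\<phi> (y + h *\<^sub>R (- b)) - \<phi> y) * F y)"
    using int[of "h *\<^sub>R (- b)" 0] int[of 0 0] by (simp add: left_diff_distrib)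
  also have "\<dots> = (LINT y|lborel. (LINT t|lborel. ?H t y))"
  proof (rule Bochner_Integration.integral_cong[OF refl])
    fix y
    have "?H t y = (indicator {0..h} t * fderiv \<phi> (y + t *\<^sub>R (- b)) (- b)) * F y" for t by simp
    then show "(\<phi> (y + h *\<^sub>R (- b)) - \<phi> y) * F y = (LINT t|lborel. ?H t y)"
      using test_increment_integral[OF \<phi> h, of y "- b"] by (simp only: integral_mult_left_zero)
  qed
  also have "\<dots> = (LINT t|lborel. (LINT y|lborel. ?H t y))"
    using H by (rule lborel_pair.Fubini_integral)
  also have "\<dots> = (LINT t|lborel. indicator {0..h} t * (LINT x|lborel. \<phi> x * G (x + t *\<^sub>R b)))"
  proof (rule Bochner_Integration.integral_cong[OF refl])
    fix t
    have "(LINT y|lborel. \<phi> (y + t *\<^sub>R (- b)) * G y) = (LINT x|lborel. \<phi> x * G (x + t *\<^sub>R b))"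
      using lborel_translation(2)[of "\<lambda>y. \<phi> (y + t *\<^sub>R (- b)) * G y" "t *\<^sub>R b"] \<phi>b G(1) by simp
    then show "(LINT y|lborel. ?H t y) = indicator {0..h} t * (LINT x|lborel. \<phi> x * G (x + t *\<^sub>R b))"
      using weak[of t] by (cases "t \<in> {0..h}") auto
  qed
  also have "\<dots> = (LINT x|lborel. \<phi> x * steklov G b h x)"
    using G \<phi>b M by (rule steklov_integral(2)[symmetric])
  finally show ?thesis .
qed

text \<open>
The error of the Steklov mean is an average over \<open>t\<close> of \<open>\<bar>G(x + t b) - G(x)\<bar>\<close>, so its integral over
\<open>x\<close> is an average of translation gaps.
\<close>

lemma steklov_mean_error:
  fixes G :: "'a::euclidean_space \<Rightarrow> real"
  assumes G: "G \<in> borel_measurable borel" "integrable lborel G" and h: "h > 0"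
    and gap: "\<And>t. 0 \<le> t \<Longrightarrow> t \<le> h \<Longrightarrow> shift_gap G (t *\<^sub>R b) \<le> e"
  shows "(LINT x|lborel. \<bar>steklov G b h x / h - G x\<bar>) \<le> e"
proof -
  have H1: "integrable (lborel \<Otimes>\<^sub>M lborel) (\<lambda>(t, x). indicator {0..h} t * G (x + t *\<^sub>R b))"
    using shifted_integrable_pair[OF G, of "\<lambda>_. 1" 1 h b] by simp
  have H0: "integrable (lborel \<Otimes>\<^sub>M lborel) (\<lambda>(t, x). indicator {0..h} t * G x)"
    using shifted_integrable_pair[OF G, of "\<lambda>_. 1" 1 h 0] by simp
  let ?H = "\<lambda>t x. indicator {0..h} t * G (x + t *\<^sub>R b) - indicator {0..h} t * G x"
  have H: "integrable (lborel \<Otimes>\<^sub>M lborel) (case_prod ?H)"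
    using Bochner_Integration.integrable_diff[OF H1 H0] by (simp add: case_prod_unfold)
  have Ha: "integrable (lborel \<Otimes>\<^sub>M lborel) (case_prod (\<lambda>t x. \<bar>?H t x\<bar>))"
    using integrable_abs[OF H] by (simp add: case_prod_unfold)
  have S: "integrable lborel (\<lambda>x. steklov G b h x)"
    using steklov_integral(1)[OF G, of "\<lambda>_. 1" 1 b h] by simp
  have "AE x in lborel. \<bar>steklov G b h x / h - G x\<bar> \<le> (LINT t|lborel. \<bar>?H t x\<bar>) / h"
    using lborel_pair.AE_integrable_snd[OF H1] lborel_pair.AE_integrable_snd[OF H0]
  proof eventually_elim
    case (elim x)
    have "(LINT t|lborel. indicat_real {0..h} t * G x) = h * G x"
      using h by simp
    then have "(LINT t|lborel. ?H t x) = steklov G b h x - h * G x"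
      using elim by (simp add: steklov_def)
    then have "steklov G b h x / h - G x = (LINT t|lborel. ?H t x) / h"
      using h by (simp add: field_simps)
    then have "\<bar>steklov G b h x / h - G x\<bar> = \<bar>LINT t|lborel. ?H t x\<bar> / h"
      using h by simp
    also have "\<dots> \<le> (LINT t|lborel. \<bar>?H t x\<bar>) / h"
      using h by (intro divide_right_mono integral_abs_bound) auto
    finally show ?case .
  qed
  then have "(LINT x|lborel. \<bar>steklov G b h x / h - G x\<bar>) \<le> (LINT x|lborel. (LINT t|lborel. \<bar>?H t x\<bar>) / h)"
    using S G(2) lborel_pair.integrable_snd[OF Ha]
    by (intro integral_mono_AE integrable_abs Bochner_Integration.integrable_diff integrable_divide) auto
  also have "\<dots> = (LINT x|lborel. (LINT t|lborel. \<bar>?H t x\<bar>)) / h"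
    by simp
  also have "(LINT x|lborel. (LINT t|lborel. \<bar>?H t x\<bar>)) = (LINT t|lborel. (LINT x|lborel. \<bar>?H t x\<bar>))"
    using Ha by (rule lborel_pair.Fubini_integral)
  also have "\<dots> \<le> (LINT t|lborel. e * indicator {0..h} t)"
  proof (rule integral_mono)
    show "integrable lborel (\<lambda>t. LINT x|lborel. \<bar>?H t x\<bar>)"
      by (rule lborel_pair.integrable_fst[OF Ha])
    show "integrable lborel (\<lambda>t. e * indicat_real {0..h} t)"
      by (intro integrable_mult_right integrable_real_indicator emeasure_bounded_finite) auto
    show "(LINT x|lborel. \<bar>?H t x\<bar>) \<le> e * indicator {0..h} t" for t
      using gap[of t] by (cases "t \<in> {0..h}") (auto simp: shift_gap_def)
  qed
  also have "\<dots> = e * h" using h by simp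
  finally show ?thesis using h by (simp add: divide_right_mono field_simps)
qed

text \<open>
On a box inside \<open>U\<close> a difference quotient with small step equals the Steklov mean of the weak derivative
almost everywhere, hence converges to it in the mean, and almost everywhere along a subsequence. The step
sizes are prescribed so that the result can be applied successively to several functions.
\<close>

theorem weak_deriv_difference_quotients:
  fixes f g :: "'a::euclidean_space \<Rightarrow> real"
  assumes U: "open U" and b: "b \<in> Basis" and weak: "has_weak_deriv U b f g"
    and ce: "cbox c e \<subseteq> U" and h: "\<And>n. h n > 0" "h \<longlonglongrightarrow> 0"
  obtains r :: "nat \<Rightarrow> nat" where "strict_mono r"
    "AE x in lebesgue. x \<in> box c e \<longrightarrow> (\<lambda>n. (f (x + h (r n) *\<^sub>R b) - f x) / h (r n)) \<longlonglongrightarrow> g x"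
proof -
  have fL: "f \<in> L1_loc U" and gL: "g \<in> L1_loc U" using weak by (auto simp: has_weak_deriv_iff)
  obtain \<delta> where \<delta>: "\<delta> > 0" "(\<Union>x\<in>cbox c e. cball x \<delta>) \<subseteq> U"
    using compact_subset_open_imp_cball_epsilon_subset[OF compact_cbox U ce] by metis
  define K where "K = {x + y |x y. x \<in> cbox c e \<and> y \<in> cball 0 \<delta>}"
  have K: "compact K" unfolding K_def by (intro compact_sums compact_cbox compact_cball)
  have KU: "K \<subseteq> U"
  proof
    fix z assume "z \<in> K"
    then obtain x y where "z = x + y" "x \<in> cbox c e" "norm y \<le> \<delta>" by (auto simp: K_def)
    then have "z \<in> cball x \<delta>" "x \<in> cbox c e" by (auto simp: dist_norm)
    with \<delta>(2) show "z \<in> U" by blast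
  qed
  have inK: "x + t *\<^sub>R b \<in> K" if x: "x \<in> box c e" and t: "0 \<le> t" "t \<le> \<delta>" for x t
  proof -
    have "t *\<^sub>R b \<in> cball 0 \<delta>" using t b by simp
    moreover have "x \<in> cbox c e" using x box_subset_cbox by blast
    ultimately show ?thesis unfolding K_def by blast
  qed
  obtain F where F: "F \<in> borel_measurable borel" "integrable lborel F" "AE x in lebesgue. indicat_real K x *\<^sub>R f x = F x"
    using integrable_lebesgue_borel_representative[OF L1_locD[OF fL K KU, unfolded set_integrable_def]] by metis
  obtain G where G: "G \<in> borel_measurable borel" "integrable lborel G" "AE x in lebesgue. indicat_real K x *\<^sub>R g x = G x"
    using integrable_lebesgue_borel_representative[OF L1_locD[OF gL K KU, unfolded set_integrable_def]] by metis
  have replace: "(LINT x|lborel. k x * P x) = (LINT x|lebesgue. k x * p x)"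
    if k: "k \<in> Cc U" "\<And>x. k x \<noteq> 0 \<Longrightarrow> x \<in> K" and p: "p \<in> L1_loc U"
      and P: "P \<in> borel_measurable borel" "AE x in lebesgue. indicat_real K x *\<^sub>R p x = P x" for k P p :: "'a \<Rightarrow> real"
  proof -
    have "AE x in lebesgue. k x * p x = k x * P x"
      using P(2)
    proof eventually_elim
      case (elim x)
      then show ?case using k(2)[of x] by (cases "x \<in> K") auto
    qed
    then have "(LINT x|lebesgue. k x * P x) = (LINT x|lebesgue. k x * p x)"
      using Cc_L1_loc_integrable[OF k(1) p] by (intro integrable_lebesgue_cong_AE(2)) simp_all
    then show ?thesis
      using P(1) Cc_measurable(1)[OF k(1)] by (simp add: integral_completion)
  qed
  have weakFG: "(LINT y|lborel. fderiv \<phi> (y + t *\<^sub>R (- b)) (- b) * F y) = (LINT y|lborel. \<phi> (y + t *\<^sub>R (- b)) * G y)"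
    if \<phi>: "\<phi> \<in> test_functions (box c e)" and t: "0 \<le> t" "t \<le> \<delta>" for \<phi> :: "'a \<Rightarrow> real" and t
  proof -
    let ?\<psi> = "\<lambda>y. \<phi> (y + t *\<^sub>R (- b))"
    have "(\<lambda>x. x - t *\<^sub>R (- b)) ` box c e \<subseteq> U"
      using inK t KU by auto
    then have \<psi>: "?\<psi> \<in> test_functions U"
      by (rule test_functions_translation[OF \<phi>])
    have d\<psi>: "fderiv ?\<psi> y = fderiv \<phi> (y + t *\<^sub>R (- b))" for y
      by (rule frechet_derivative_translation[OF \<phi>])
    have supp: "y \<in> K" if "y + t *\<^sub>R (- b) \<in> box c e" for y
      using inK[OF that t] by simp
    have supp\<psi>: "y \<in> K" if "?\<psi> y \<noteq> 0" for y
      using supp that test_functions_outside(1)[OF \<phi>] by blast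
    have suppd\<psi>: "y \<in> K" if "fderiv ?\<psi> y b \<noteq> 0" for y
      using supp that test_functions_outside(2)[OF \<phi>] unfolding d\<psi> by blast
    have "fderiv \<phi> y (- b) = - fderiv \<phi> y b" for y
      using has_derivative_linear[OF test_functions_has_derivative[OF \<phi>]] by (rule linear_neg)
    then have "(LINT y|lborel. fderiv \<phi> (y + t *\<^sub>R (- b)) (- b) * F y) = - (LINT y|lborel. fderiv ?\<psi> y b * F y)"
      by (simp only: d\<psi> mult_minus_left Bochner_Integration.integral_minus)
    also have "(LINT y|lborel. fderiv ?\<psi> y b * F y) = (LINT y|lebesgue. fderiv ?\<psi> y b * f y)"
      using test_functions_Cc[OF test_functions_deriv[OF \<psi>]] suppd\<psi> fL F by (intro replace) auto
    also have "- \<dots> = (LINT y|lebesgue. ?\<psi> y * g y)"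
      using weak \<psi> by (simp add: has_weak_deriv_iff)
    also have "\<dots> = (LINT y|lborel. ?\<psi> y * G y)"
      using test_functions_Cc[OF \<psi>] supp\<psi> gL G by (intro replace[symmetric]) auto
    finally show ?thesis .
  qed
  have steklov_int: "integrable lborel (steklov G b s)" for s
    using steklov_integral(1)[OF G(1,2), of "\<lambda>_. 1" 1 b s] by simp
  have identity: "AE x in lebesgue. x \<in> box c e \<longrightarrow> F (x + s *\<^sub>R b) - F x - steklov G b s x = 0"
    if s: "0 \<le> s" "s \<le> \<delta>" for s
  proof (rule fundamental_lemma[OF open_box])
    have int: "integrable lborel (\<lambda>x. F (x + s *\<^sub>R b) - F x - steklov G b s x)"
      using integrable_shift(1)[OF F(2)] F(2) steklov_int by auto
    then show "(\<lambda>x. F (x + s *\<^sub>R b) - F x - steklov G b s x) \<in> L1_loc (box c e)"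
      by (rule integrable_lebesgue_L1_loc(3))
    fix \<phi> :: "'a \<Rightarrow> real" assume \<phi>: "\<phi> \<in> test_functions (box c e)"
    obtain M where M: "\<And>x. \<bar>\<phi> x\<bar> \<le> M"
      using Cc_bounded[OF test_functions_Cc[OF \<phi>]] by (metis real_norm_def)
    have \<phi>b: "\<phi> \<in> borel_measurable lborel" using Cc_measurable(1)[OF test_functions_Cc[OF \<phi>]] by simp
    have bdd: "integrable lborel (\<lambda>x. \<phi> x * P x)" if "integrable lborel P" for P :: "'a \<Rightarrow> real"
      using integrable_scaleR_bounded[OF that \<phi>b M] by simp
    have 1: "integrable lborel (\<lambda>x. \<phi> x * (F (x + s *\<^sub>R b) - F x))"
      using integrable_shift(1)[OF F(2)] F(2) by (intro bdd) auto
    have 2: "integrable lborel (\<lambda>x. \<phi> x * steklov G b s x)"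
      using steklov_int by (intro bdd)
    have "(LINT x|lebesgue. \<phi> x * (F (x + s *\<^sub>R b) - F x - steklov G b s x))
        = (LINT x|lborel. \<phi> x * (F (x + s *\<^sub>R b) - F x - steklov G b s x))"
      using bdd[OF int] by (rule integrable_lebesgue_L1_loc(2))
    also have "\<dots> = (LINT x|lborel. \<phi> x * (F (x + s *\<^sub>R b) - F x)) - (LINT x|lborel. \<phi> x * steklov G b s x)"
      using 1 2 by (simp add: right_diff_distrib)
    also have "\<dots> = 0"
      using steklov_weak_identity[OF F(1,2) G(1,2) \<phi> s(1)] weakFG[OF \<phi>] s(2) by simp
    finally show "(LINT x|lebesgue. \<phi> x * (F (x + s *\<^sub>R b) - F x - steklov G b s x)) = 0" .
  qed
  obtain N where N: "\<And>n. n \<ge> N \<Longrightarrow> h n \<le> \<delta>"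
  proof -
    have "\<forall>\<^sub>F n in sequentially. h n < \<delta>" using order_tendstoD(2)[OF h(2) \<delta>(1)] .
    then show ?thesis using that by (auto simp: eventually_sequentially intro: less_imp_le)
  qed
  \<comment> \<open>drop the steps that are too large for the translates to stay in \<open>K\<close>\<close>
  define k where "k n = h (n + N)" for n
  have k: "k n > 0" "k n \<le> \<delta>" for n using h(1) N by (auto simp: k_def)
  have k0: "k \<longlonglongrightarrow> 0" unfolding k_def using h(2) by (rule LIMSEQ_ignore_initial_segment)
  define u where "u n x = indicat_real (box c e) x * ((F (x + k n *\<^sub>R b) - F x) / k n - G x)" for n x
  have uint: "integrable lborel (u n)" for n
  proof -
    have "integrable lborel (\<lambda>x. (F (x + k n *\<^sub>R b) - F x) / k n - G x)"
      using integrable_shift(1)[OF F(2)] F(2) G(2) by auto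
    from integrable_mult_indicator[OF _ this, of "box c e"] show ?thesis by (simp add: u_def[abs_def])
  qed
  have u_le: "(LINT x|lborel. norm (u n x)) \<le> (LINT x|lborel. \<bar>steklov G b (k n) x / k n - G x\<bar>)" for n
  proof (rule integral_mono_AE)
    show "integrable lborel (\<lambda>x. norm (u n x))" using uint by auto
    show "integrable lborel (\<lambda>x. \<bar>steklov G b (k n) x / k n - G x\<bar>)"
      using steklov_int G(2) by auto
    have "AE x in lborel. x \<in> box c e \<longrightarrow> F (x + k n *\<^sub>R b) - F x - steklov G b (k n) x = 0"
      using identity[of "k n"] k[of n] by (simp add: AE_completion_iff)
    then show "AE x in lborel. norm (u n x) \<le> \<bar>steklov G b (k n) x / k n - G x\<bar>"
      by eventually_elim (auto simp: u_def indicator_def)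
  qed
  have "(\<lambda>n. LINT x|lborel. norm (u n x)) \<longlonglongrightarrow> 0"
  proof (rule LIMSEQ_I)
    fix \<epsilon> :: real assume \<epsilon>: "\<epsilon> > 0"
    obtain \<delta>' where \<delta>': "\<delta>' > 0" "\<And>y. norm y < \<delta>' \<Longrightarrow> shift_gap G y < \<epsilon> / 2"
      using shift_gap_uniform[OF G(2), of "\<epsilon> / 2"] \<epsilon> by auto
    obtain n0 where n0: "\<And>n. n \<ge> n0 \<Longrightarrow> k n < \<delta>'"
      using order_tendstoD(2)[OF k0 \<delta>'(1)] by (auto simp: eventually_sequentially)
    have "norm ((LINT x|lborel. norm (u n x)) - 0) < \<epsilon>" if n: "n \<ge> n0" for n
    proof -
      have "(LINT x|lborel. \<bar>steklov G b (k n) x / k n - G x\<bar>) \<le> \<epsilon> / 2"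
        using n0[OF n] b by (intro steklov_mean_error[OF G(1,2) k(1)] less_imp_le \<delta>'(2)) auto
      moreover have "(LINT x|lborel. norm (u n x)) \<ge> 0"
        by (intro Bochner_Integration.integral_nonneg) auto
      ultimately show ?thesis using u_le[of n] \<epsilon> by simp
    qed
    then show "\<exists>n0. \<forall>n\<ge>n0. norm ((LINT x|lborel. norm (u n x)) - 0) < \<epsilon>" by blast
  qed
  from tendsto_L1_AE_subseq[OF uint this]
  obtain r where r: "strict_mono r" "AE x in lborel. (\<lambda>n. u (r n) x) \<longlonglongrightarrow> 0" by blast
  have shifts: "AE x in lebesgue. \<forall>n. indicat_real K (x + k n *\<^sub>R b) *\<^sub>R f (x + k n *\<^sub>R b) = F (x + k n *\<^sub>R b)"
    unfolding AE_all_countable using AE_translation[OF F(3)] by blast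
  have "AE x in lebesgue. x \<in> box c e \<longrightarrow> (\<lambda>n. (f (x + k (r n) *\<^sub>R b) - f x) / k (r n)) \<longlonglongrightarrow> g x"
    using shifts F(3) G(3) AE_completion[OF r(2)]
  proof eventually_elim
    case (elim x)
    show ?case
    proof
      assume x: "x \<in> box c e"
      have "x \<in> K" "\<And>n. x + k n *\<^sub>R b \<in> K"
        using inK[OF x, of 0] \<delta>(1) inK[OF x less_imp_le[OF k(1)] k(2)] by auto
      then have "u (r n) x = (f (x + k (r n) *\<^sub>R b) - f x) / k (r n) - g x" for n
        using elim(1)[rule_format, of "r n"] elim(2,3) x by (simp add: u_def)
      with elim(4) show "(\<lambda>n. (f (x + k (r n) *\<^sub>R b) - f x) / k (r n)) \<longlonglongrightarrow> g x"
        by (simp add: LIM_zero_iff)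
    qed
  qed
  moreover have "strict_mono (\<lambda>n. r n + N)"
    using r(1) by (auto simp: strict_mono_def)
  ultimately show ?thesis
    by (intro that[of "\<lambda>n. r n + N"]) (simp_all add: k_def)
qed

section \<open>The chain rule\<close>

text \<open>
After passing to subsequences twice, the difference quotients of \<open>f\<close> and of \<open>B \<circ> f\<close> converge
almost everywhere to the two weak derivatives along the same steps. The classical chain rule at
\<open>f x\<close> relates the limits.
\<close>

theorem weak_chain_rule:
  fixes f g k :: "'a::euclidean_space \<Rightarrow> real"
  assumes U: "open U" and b: "b \<in> Basis"
    and f: "has_weak_deriv U b f g" and Bf: "has_weak_deriv U b (\<lambda>x. B (f x)) k"
    and B: "\<And>s. (B has_real_derivative B' s) (at s)"
  shows "AE x in lebesgue. x \<in> U \<longrightarrow> k x = B' (f x) * g x"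
proof (rule AE_open_from_boxes[OF U])
  define h where "h n = inverse (real (Suc n))" for n
  have h: "h n > 0" for n by (simp add: h_def)
  have h0: "h \<longlonglongrightarrow> 0" unfolding h_def by (rule LIMSEQ_inverse_real_of_nat)
  show "AE x in lebesgue. x \<in> box c e \<longrightarrow> k x = B' (f x) * g x" if ce: "cbox c e \<subseteq> U" for c e
  proof -
    obtain r where r: "strict_mono r"
      "AE x in lebesgue. x \<in> box c e \<longrightarrow> (\<lambda>n. (f (x + h (r n) *\<^sub>R b) - f x) / h (r n)) \<longlonglongrightarrow> g x"
      using weak_deriv_difference_quotients[OF U b f ce h h0] by blast
    define h' where "h' n = h (r n)" for n
    have h': "h' n > 0" for n using h by (simp add: h'_def)
    have h'0: "h' \<longlonglongrightarrow> 0"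
      using LIMSEQ_subseq_LIMSEQ[OF h0 r(1)] by (simp add: h'_def[abs_def] comp_def)
    obtain q where q: "strict_mono q"
      "AE x in lebesgue. x \<in> box c e \<longrightarrow> (\<lambda>n. (B (f (x + h' (q n) *\<^sub>R b)) - B (f x)) / h' (q n)) \<longlonglongrightarrow> k x"
      using weak_deriv_difference_quotients[OF U b Bf ce h' h'0] by blast
    have h'q0: "(\<lambda>n. h' (q n)) \<longlonglongrightarrow> 0"
      using LIMSEQ_subseq_LIMSEQ[OF h'0 q(1)] by (simp add: comp_def)
    show ?thesis
      using r(2) q(2)
    proof eventually_elim
      case (elim x)
      show ?case
      proof
        assume x: "x \<in> box c e"
        let ?D = "\<lambda>n. (f (x + h' (q n) *\<^sub>R b) - f x) / h' (q n)"
        have D: "?D \<longlonglongrightarrow> g x"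
          using LIMSEQ_subseq_LIMSEQ[OF elim(1)[rule_format, OF x] q(1)] by (simp add: comp_def h'_def)
        have fd: "f (x + h' (q n) *\<^sub>R b) = f x + h' (q n) * ?D n" for n
          using h'[of "q n"] by simp
        have "(\<lambda>n. f x + h' (q n) * ?D n) \<longlonglongrightarrow> f x + 0 * g x"
          by (intro tendsto_intros h'q0 D)
        then have flim: "(\<lambda>n. f (x + h' (q n) *\<^sub>R b)) \<longlonglongrightarrow> f x"
          unfolding fd[symmetric] by simp
        obtain S where S: "\<And>z. B z - B (f x) = S z * (z - f x)" "isCont S (f x)" "S (f x) = B' (f x)"
          using B[of "f x"] unfolding CARAT_DERIV by blast
        have "(\<lambda>n. S (f (x + h' (q n) *\<^sub>R b)) * ?D n) \<longlonglongrightarrow> B' (f x) * g x"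
          using isCont_tendsto_compose[OF S(2) flim] D unfolding S(3) by (intro tendsto_mult)
        then have "(\<lambda>n. (B (f (x + h' (q n) *\<^sub>R b)) - B (f x)) / h' (q n)) \<longlonglongrightarrow> B' (f x) * g x"
          by (simp add: S(1))
        with elim(2)[rule_format, OF x] show "k x = B' (f x) * g x"
          by (rule LIMSEQ_unique)
      qed
    qed
  qed
qed

section \<open>Vertical stretchings\<close>

definition stretch :: "('a::euclidean_space \<Rightarrow> real) \<Rightarrow> 'a \<times> real \<Rightarrow> 'a \<times> real" where
  "stretch j z = (fst z, snd z * j (fst z))"

lemma measurable_stretch:
  assumes j: "j \<in> borel_measurable borel"
  shows "stretch j \<in> borel_measurable borel" "(\<lambda>z::'a::euclidean_space \<times> real. j (fst z)) \<in> borel_measurable borel"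
proof -
  have fst: "(fst :: 'a \<times> real \<Rightarrow> 'a) \<in> borel_measurable borel" and snd: "(snd :: 'a \<times> real \<Rightarrow> real) \<in> borel_measurable borel"
    by (auto intro!: borel_measurable_continuous_onI continuous_intros)
  show 1: "(\<lambda>z::'a \<times> real. j (fst z)) \<in> borel_measurable borel"
    by (rule measurable_compose[OF fst j])
  show "stretch j \<in> borel_measurable borel"
    unfolding stretch_def[abs_def] using fst snd 1 by (intro borel_measurable_Pair borel_measurable_times)
qed

text \<open>
The transformation formula, on each vertical line the substitution \<open>x \<mapsto> j(r) x\<close>. The stretching
factor is merely measurable in \<open>r\<close>, hence the proof by Fubini's theorem instead of a formula for
differentiable maps.
\<close>

lemma lborel_stretch:
  fixes j :: "'a::euclidean_space \<Rightarrow> real"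
  assumes j: "j \<in> borel_measurable borel" and pos: "\<And>r. j r > 0"
  shows "distr (density lborel (\<lambda>z. ennreal (j (fst z)))) borel (stretch j) = lborel"
proof (rule measure_eqI)
  fix A assume "A \<in> sets (distr (density lborel (\<lambda>z. ennreal (j (fst z)))) borel (stretch j))"
  then have A: "A \<in> sets borel" by simp
  note [measurable] = measurable_stretch[OF j] j A
  have "emeasure (distr (density lborel (\<lambda>z. ennreal (j (fst z)))) borel (stretch j)) A
      = (\<integral>\<^sup>+z. ennreal (j (fst z)) * indicator (stretch j -` A) z \<partial>lborel)"
    using A measurable_sets_borel[OF measurable_stretch(1)[OF j] A]
    by (subst emeasure_distr) (auto simp: emeasure_density)
  also have "\<dots> = (\<integral>\<^sup>+z. ennreal (j (fst z)) * indicator A (stretch j z) \<partial>(lborel \<Otimes>\<^sub>M lborel))"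
    by (simp add: lborel_prod indicator_def)
  also have "\<dots> = (\<integral>\<^sup>+r. (\<integral>\<^sup>+x. ennreal (j r) * indicator A (r, x * j r) \<partial>lborel) \<partial>lborel)"
  proof (subst lborel.nn_integral_fst[symmetric])
    show "(\<lambda>z. ennreal (j (fst z)) * indicator A (stretch j z)) \<in> borel_measurable (lborel \<Otimes>\<^sub>M lborel)"
      unfolding lborel_prod by measurable
  qed (simp add: stretch_def)
  also have "\<dots> = (\<integral>\<^sup>+r. (\<integral>\<^sup>+x. indicator A (r, x) \<partial>lborel) \<partial>lborel)"
  proof (rule nn_integral_cong)
    fix r
    have Ar: "(\<lambda>x. indicator A (r, x) :: ennreal) \<in> borel_measurable borel"
      by (rule measurable_compose[of "Pair r" borel borel])
         (auto intro!: borel_measurable_continuous_onI continuous_intros borel_measurable_indicator A)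
    have "(\<integral>\<^sup>+x. indicator A (r, x) \<partial>lborel) = ennreal \<bar>j r\<bar> * (\<integral>\<^sup>+x. indicator A (r, 0 + j r * x) \<partial>lborel)"
      using pos[of r] by (intro nn_integral_real_affine Ar) auto
    also have "\<dots> = (\<integral>\<^sup>+x. ennreal (j r) * indicator A (r, x * j r) \<partial>lborel)"
    proof (subst nn_integral_cmult[symmetric])
      show "(\<lambda>x. indicator A (r, 0 + j r * x) :: ennreal) \<in> borel_measurable lborel"
        using Ar by measurable
    qed (use pos[of r] in \<open>simp add: mult.commute\<close>)
    finally show "(\<integral>\<^sup>+x. ennreal (j r) * indicator A (r, x * j r) \<partial>lborel) = (\<integral>\<^sup>+x. indicator A (r, x) \<partial>lborel)" ..
  qed
  also have "\<dots> = (\<integral>\<^sup>+z. indicator A z \<partial>(lborel \<Otimes>\<^sub>M lborel))"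
    by (subst lborel.nn_integral_fst) (simp_all add: lborel_prod)
  also have "\<dots> = emeasure lborel A"
    using A by (simp add: lborel_prod)
  finally show "emeasure (distr (density lborel (\<lambda>z. ennreal (j (fst z)))) borel (stretch j)) A = emeasure lborel A" .
qed simp

lemma AE_stretch:
  fixes j :: "'a::euclidean_space \<Rightarrow> real"
  assumes j: "j \<in> borel_measurable borel" and pos: "\<And>r. j r > 0"
    and P: "AE z in lebesgue. P z"
  shows "AE z in lebesgue. P (stretch j z)"
proof -
  note [measurable] = measurable_stretch[OF j]
  have "AE z in lborel. P z" using P by (simp add: AE_completion_iff)
  then have "AE z in distr (density lborel (\<lambda>z. ennreal (j (fst z)))) borel (stretch j). P z"
    unfolding lborel_stretch[OF j pos] .
  then have "AE z in density lborel (\<lambda>z. ennreal (j (fst z))). P (stretch j z)"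
    by (rule AE_distrD[rotated]) (simp add: measurable_stretch[OF j])
  then have "AE z in lborel. 0 < ennreal (j (fst z)) \<longrightarrow> P (stretch j z)"
    by (subst (asm) AE_density) auto
  then show ?thesis
    using pos by (intro AE_completion) simp
qed

lemma integral_stretch:
  fixes j :: "'a::euclidean_space \<Rightarrow> real" and p :: "'a \<times> real \<Rightarrow> real"
  assumes j: "j \<in> borel_measurable borel" and pos: "\<And>r. j r > 0"
    and p: "integrable lebesgue p"
  shows "integrable lebesgue (\<lambda>z. j (fst z) * p (stretch j z))"
    "(LINT z|lebesgue. j (fst z) * p (stretch j z)) = (LINT z|lebesgue. p z)"
proof -
  note [measurable] = measurable_stretch[OF j]
  obtain q where q: "q \<in> borel_measurable borel" "integrable lborel q" "AE z in lebesgue. p z = q z"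
    using integrable_lebesgue_borel_representative[OF p] by blast
  note [measurable] = q(1)
  let ?D = "density lborel (\<lambda>z. ennreal (j (fst z)))"
  have nn: "AE z in lborel. 0 \<le> j (fst z)" using pos by (intro AE_I2 less_imp_le)
  have meas: "stretch j \<in> measurable ?D borel" by simp
  have "integrable (distr ?D borel (stretch j)) q" using q(2) by (simp add: lborel_stretch[OF j pos])
  then have "integrable ?D (\<lambda>z. q (stretch j z))"
    using q(1) meas by (subst (asm) integrable_distr_eq) auto
  then have int: "integrable lborel (\<lambda>z. j (fst z) * q (stretch j z))"
    using nn by (subst (asm) integrable_density) auto
  have "(LINT z|lborel. q z) = (LINT z|distr ?D borel (stretch j). q z)"
    by (simp add: lborel_stretch[OF j pos])
  also have "\<dots> = (LINT z|?D. q (stretch j z))"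
    using q(1) meas by (rule integral_distr[rotated])
  also have "\<dots> = (LINT z|lborel. j (fst z) * q (stretch j z))"
    using nn by (subst integral_density) auto
  finally have eq: "(LINT z|lborel. q z) = (LINT z|lborel. j (fst z) * q (stretch j z))" .
  have ae: "AE z in lebesgue. j (fst z) * q (stretch j z) = j (fst z) * p (stretch j z)"
    using AE_stretch[OF j pos q(3)] by eventually_elim simp
  note I = integrable_lebesgue_L1_loc[OF int]
  show "integrable lebesgue (\<lambda>z. j (fst z) * p (stretch j z))"
    by (rule integrable_lebesgue_cong_AE(1)[OF ae I(1)])
  have "(LINT z|lebesgue. j (fst z) * p (stretch j z)) = (LINT z|lborel. q z)"
    using integrable_lebesgue_cong_AE(2)[OF ae I(1)] I(2) eq by simp
  also have "\<dots> = (LINT z|lebesgue. q z)"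
    by (rule integrable_lebesgue_L1_loc(2)[OF q(2), symmetric])
  also have "\<dots> = (LINT z|lebesgue. p z)"
    by (rule integrable_lebesgue_cong_AE(2)[OF q(3) p])
  finally show "(LINT z|lebesgue. j (fst z) * p (stretch j z)) = (LINT z|lebesgue. p z)" .
qed

section \<open>The moving domain\<close>

lemma base_eq_cbox: "base L = cbox 0 L"
  by (auto simp: base_def mem_box_cart)

lemma compact_base: "compact (base L)"
  by (simp add: base_eq_cbox)

lemma interior_base: "interior (base L) = {r. \<forall>i. 0 < r $ i \<and> r $ i < L $ i}"
  by (auto simp: base_eq_cbox interior_cbox mem_box_cart)

lemma cur_dom_eq:
  assumes H: "H > 0" and gt: "\<forall>r\<in>base L. \<eta> r > - H"
  shows "cur_dom L H \<eta> = {z. fst z \<in> base L \<and> 0 \<le> snd z \<and> snd z \<le> H + \<eta> (fst z)}"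
proof (intro equalityI subsetI)
  fix z assume "z \<in> cur_dom L H \<eta>"
  then obtain y where y: "y \<in> ref_dom L H" "z = ale_map H \<eta> y"
    by (auto simp: cur_dom_def)
  obtain r x where "y = (r, x)" by (cases y)
  with y have z: "z = (r, x * ((H + \<eta> r) / H))" "r \<in> base L" "0 \<le> x" "x \<le> H"
    by (simp_all add: ale_map_def ref_dom_def)
  have "H + \<eta> r > 0" using bspec[OF gt z(2)] by simp
  moreover have "x * ((H + \<eta> r) / H) \<le> H * ((H + \<eta> r) / H)"
    using z H \<open>H + \<eta> r > 0\<close> by (intro mult_right_mono) auto
  ultimately show "z \<in> {z. fst z \<in> base L \<and> 0 \<le> snd z \<and> snd z \<le> H + \<eta> (fst z)}"
    using z H by auto
next
  fix z assume "z \<in> {z. fst z \<in> base L \<and> 0 \<le> snd z \<and> snd z \<le> H + \<eta> (fst z)}"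
  then obtain r x where z: "z = (r, x)" "r \<in> base L" "0 \<le> x" "x \<le> H + \<eta> r"
    by (cases z) auto
  have pos: "H + \<eta> r > 0" using bspec[OF gt z(2)] by simp
  have "z = ale_map H \<eta> (r, x * (H / (H + \<eta> r)))"
    using pos H z by (simp add: ale_map_def)
  moreover have "x * (H / (H + \<eta> r)) \<le> H"
    using mult_right_mono[OF z(4), of "H / (H + \<eta> r)"] pos H by simp
  ultimately show "z \<in> cur_dom L H \<eta>"
    using z pos H by (auto simp: cur_dom_def ref_dom_def)
qed

lemma back_map_eq:
  assumes H: "H > 0" and gt: "\<forall>r\<in>base L. \<eta> r > - H"
    and z: "z \<in> cur_dom L H \<eta>"
  shows "back_map L H \<eta>' \<eta> z = (fst z, snd z * ((H + \<eta>' (fst z)) / (H + \<eta> (fst z))))"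
proof -
  have inj: "inj_on (ale_map H \<eta>) (ref_dom L H)"
  proof (rule inj_onI)
    fix a b assume ab: "a \<in> ref_dom L H" "b \<in> ref_dom L H" "ale_map H \<eta> a = ale_map H \<eta> b"
    then have "fst a = fst b" "fst b \<in> base L" by (auto simp: ale_map_def ref_dom_def split: prod.splits)
    with ab bspec[OF gt, of "fst b"] H show "a = b" by (auto simp: ale_map_def split: prod.splits)
  qed
  obtain r x where rx: "(r, x) \<in> ref_dom L H" "z = ale_map H \<eta> (r, x)"
    using z by (auto simp: cur_dom_def)
  have "inv_into (ref_dom L H) (ale_map H \<eta>) z = (r, x)"
    using rx by (simp add: inv_into_f_f[OF inj])
  moreover have "H + \<eta> r > 0" using rx(1) bspec[OF gt, of r] by (auto simp: ref_dom_def)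
  ultimately show ?thesis
    using rx(2) H by (simp add: back_map_def ale_map_def)
qed

text \<open>The Jacobian as a positive Borel function on the whole space, extended by 1 off the base.\<close>

text \<open>
The Jacobian of the back map as a function of the base point, extended by 1 so that it is a positive Borel
function on the whole space and the transformation formula applies to it globally.
\<close>

definition ratio :: "real^'n \<Rightarrow> real \<Rightarrow> (real^'n \<Rightarrow> real) \<Rightarrow> (real^'n \<Rightarrow> real) \<Rightarrow> real^'n \<Rightarrow> real" where
  "ratio L H \<eta>' \<eta> r = (if r \<in> base L then (H + \<eta>' r) / (H + \<eta> r) else 1)"

lemma continuous_on_ratio:
  fixes \<eta> \<eta>' :: "real^'n \<Rightarrow> real"
  assumes "continuous_on (base L) \<eta>'" "continuous_on (base L) \<eta>" "\<forall>r\<in>base L. \<eta> r > - H"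
  shows "continuous_on (base L) (\<lambda>r. (H + \<eta>' r) / (H + \<eta> r))"
  by (intro continuous_on_divide continuous_on_add continuous_on_const assms(1,2)) (use assms(3) in fastforce)

lemma borel_ratio:
  assumes "continuous_on (base L) \<eta>'" "continuous_on (base L) \<eta>" "\<forall>r\<in>base L. \<eta> r > - H"
  shows "ratio L H \<eta>' \<eta> \<in> borel_measurable borel"
proof -
  have [measurable]: "base L \<in> sets borel" using compact_base by (intro borel_compact)
  have [measurable]: "(\<lambda>r. indicator (base L) r *\<^sub>R ((H + \<eta>' r) / (H + \<eta> r))) \<in> borel_measurable borel"
    using continuous_on_ratio[OF assms] by (intro borel_measurable_continuous_on_indicator) auto
  have "ratio L H \<eta>' \<eta> = (\<lambda>r. indicator (base L) r *\<^sub>R ((H + \<eta>' r) / (H + \<eta> r)) + (1 - indicator (base L) r))"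
    by (auto simp: ratio_def fun_eq_iff)
  also have "\<dots> \<in> borel_measurable borel"
    by measurable
  finally show ?thesis .
qed

lemma ratio_pos:
  assumes "\<forall>r\<in>base L. \<eta>' r > - H" "\<forall>r\<in>base L. \<eta> r > - H"
  shows "ratio L H \<eta>' \<eta> r > 0"
  using assms by (force simp: ratio_def intro!: divide_pos_pos)

lemma back_map_stretch:
  assumes "H > 0" "\<forall>r\<in>base L. \<eta> r > - H" "z \<in> cur_dom L H \<eta>"
  shows "back_map L H \<eta>' \<eta> z = stretch (ratio L H \<eta>' \<eta>) z" "jac H \<eta>' \<eta> z = ratio L H \<eta>' \<eta> (fst z)"
  using assms(3) back_map_eq[OF assms] cur_dom_eq[OF assms(1,2)]
  by (auto simp: stretch_def ratio_def jac_def split: prod.splits)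

lemma stretch_cur_dom_iff:
  assumes H: "H > 0" and gt': "\<forall>r\<in>base L. \<eta>' r > - H" and gt: "\<forall>r\<in>base L. \<eta> r > - H"
  shows "stretch (ratio L H \<eta>' \<eta>) z \<in> cur_dom L H \<eta>' \<longleftrightarrow> z \<in> cur_dom L H \<eta>"
proof (cases "fst z \<in> base L")
  case True
  have pos: "H + \<eta> (fst z) > 0" "H + \<eta>' (fst z) > 0" using bspec[OF gt True] bspec[OF gt' True] by auto
  have aux: "x * (b / a) \<le> b \<longleftrightarrow> x \<le> a" if "a > 0" "b > 0" for a b x :: real
    using that by (simp add: pos_divide_le_eq mult.commute[of b a])
  have "snd z * ((H + \<eta>' (fst z)) / (H + \<eta> (fst z))) \<le> H + \<eta>' (fst z) \<longleftrightarrow> snd z \<le> H + \<eta> (fst z)"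
    using pos by (intro aux)
  with True pos show ?thesis
    by (simp add: cur_dom_eq[OF H gt'] cur_dom_eq[OF H gt] stretch_def ratio_def zero_le_mult_iff zero_le_divide_iff)
next
  case False
  then show ?thesis by (simp add: cur_dom_eq[OF H gt'] cur_dom_eq[OF H gt] stretch_def)
qed

lemma transport_integral:
  fixes p :: "(real^'n) \<times> real \<Rightarrow> real"
  assumes H: "H > 0" and gt': "\<forall>r\<in>base L. \<eta>' r > - H" and gt: "\<forall>r\<in>base L. \<eta> r > - H"
    and cont: "continuous_on (base L) \<eta>'" "continuous_on (base L) \<eta>"
    and p: "set_integrable lebesgue (cur_dom L H \<eta>') p"
  shows "set_integrable lebesgue (cur_dom L H \<eta>) (\<lambda>z. jac H \<eta>' \<eta> z * p (back_map L H \<eta>' \<eta> z))"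
    "(LINT z:cur_dom L H \<eta>|lebesgue. jac H \<eta>' \<eta> z * p (back_map L H \<eta>' \<eta> z)) = (LINT z:cur_dom L H \<eta>'|lebesgue. p z)"
proof -
  let ?j = "ratio L H \<eta>' \<eta>" and ?p = "\<lambda>z. indicat_real (cur_dom L H \<eta>') z *\<^sub>R p z"
  have eq: "indicat_real (cur_dom L H \<eta>) z *\<^sub>R (jac H \<eta>' \<eta> z * p (back_map L H \<eta>' \<eta> z)) = ?j (fst z) * ?p (stretch ?j z)" for z
    using back_map_stretch[OF H gt, where z = z and \<eta>' = \<eta>'] stretch_cur_dom_iff[OF H gt' gt, where z = z]
    by (cases "z \<in> cur_dom L H \<eta>") auto
  have "integrable lebesgue ?p" using p by (simp add: set_integrable_def)
  note I = integral_stretch[OF borel_ratio[OF cont gt] ratio_pos[OF gt' gt] this]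
  show "set_integrable lebesgue (cur_dom L H \<eta>) (\<lambda>z. jac H \<eta>' \<eta> z * p (back_map L H \<eta>' \<eta> z))"
    using I(1) unfolding set_integrable_def eq .
  show "(LINT z:cur_dom L H \<eta>|lebesgue. jac H \<eta>' \<eta> z * p (back_map L H \<eta>' \<eta> z)) = (LINT z:cur_dom L H \<eta>'|lebesgue. p z)"
    using I(2) unfolding set_lebesgue_integral_def eq .
qed

text \<open>
A vertical stretching takes the graph into a hyperplane, and preimages of null sets under
stretchings are null sets.
\<close>

lemma negligible_graph:
  fixes \<eta> :: "real^'n \<Rightarrow> real"
  assumes H: "H > 0" and gt: "\<forall>r\<in>base L. \<eta> r > - H" and cont: "continuous_on (base L) \<eta>"
  shows "negligible {z. fst z \<in> base L \<and> snd z = H + \<eta> (fst z)}"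
proof -
  let ?j = "ratio L H (\<lambda>_. 0) \<eta>"
  have "negligible {z::(real^'n) \<times> real. (0, 1) \<bullet> z = H}"
    by (rule negligible_hyperplane) (simp add: zero_prod_def)
  then have "AE z::(real^'n) \<times> real in lebesgue. z \<notin> {z. (0, 1) \<bullet> z = H}"
    by (intro AE_not_in) (simp add: negligible_iff_null_sets)
  then have "AE z::(real^'n) \<times> real in lebesgue. stretch ?j z \<notin> {z. (0, 1) \<bullet> z = H}"
    using H by (intro AE_stretch borel_ratio ratio_pos gt cont continuous_on_const) auto
  then have "AE z in lebesgue. z \<notin> {z. fst z \<in> base L \<and> snd z = H + \<eta> (fst z)}"
  proof eventually_elim
    case (elim z)
    show ?case
    proof
      assume "z \<in> {z. fst z \<in> base L \<and> snd z = H + \<eta> (fst z)}"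
      moreover from this have "H + \<eta> (fst z) > 0" using bspec[OF gt, of "fst z"] by auto
      ultimately have "(0, 1) \<bullet> stretch ?j z = H"
        by (simp add: stretch_def ratio_def inner_prod_def)
      with elim show False by simp
    qed
  qed
  then show ?thesis
    using completion.AE_iff_null_sets[of "\<lambda>z. z \<notin> {z. fst z \<in> base L \<and> snd z = H + \<eta> (fst z)}" lborel]
    by (simp add: negligible_iff_null_sets)
qed

text \<open>
A point of the domain that is not interior lies over the boundary of the base, on the bottom or on the
graph.
\<close>

lemma cur_dom_interior_AE:
  fixes \<eta> :: "real^'n \<Rightarrow> real"
  assumes H: "H > 0" and gt: "\<forall>r\<in>base L. \<eta> r > - H" and cont: "continuous_on (base L) \<eta>"
  shows "AE z in lebesgue. z \<in> cur_dom L H \<eta> \<longleftrightarrow> z \<in> interior (cur_dom L H \<eta>)"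
proof -
  define S where "S = {z. fst z \<in> interior (base L) \<and> 0 < snd z \<and> snd z < H + \<eta> (fst z)}"
  have "open S"
  proof -
    let ?f = "\<lambda>z. (snd z, H + \<eta> (fst z) - snd z)"
    have "continuous_on (interior (base L) \<times> UNIV) (\<lambda>z. \<eta> (fst z))"
      by (rule continuous_on_compose2[OF cont]) (auto intro!: continuous_intros dest: interior_subset[THEN subsetD])
    then have "continuous_on (interior (base L) \<times> UNIV) ?f"
      by (intro continuous_intros)
    then have "open ((interior (base L) \<times> UNIV) \<inter> ?f -` ({0<..} \<times> {0<..}))"
      by (intro continuous_open_preimage open_Times open_interior open_UNIV open_greaterThan)
    also have "(interior (base L) \<times> UNIV) \<inter> ?f -` ({0<..} \<times> {0<..}) = S"
      by (auto simp: S_def)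
    finally show ?thesis .
  qed
  moreover have "S \<subseteq> cur_dom L H \<eta>"
    using interior_subset by (auto simp: S_def cur_dom_eq[OF H gt])
  ultimately have S: "S \<subseteq> interior (cur_dom L H \<eta>)"
    by (rule interior_maximal[rotated])
  define N where "N = (\<Union>i. {z. (axis i 1, 0) \<bullet> z = 0}) \<union> (\<Union>i. {z. (axis i 1, 0) \<bullet> z = L $ i})
      \<union> {z. (0, 1) \<bullet> z = 0} \<union> {z. fst z \<in> base L \<and> snd z = H + \<eta> (fst z)}"
  have side: "negligible (\<Union>i::'n. {z :: (real^'n) \<times> real. (axis i 1, 0) \<bullet> z = c i})" for c
    by (intro negligible_Union finite_imageI finite) (auto simp: zero_prod_def axis_eq_0_iff intro!: negligible_hyperplane)
  have "negligible {z :: (real^'n) \<times> real. (0, 1) \<bullet> z = 0}"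
    by (rule negligible_hyperplane) (simp add: zero_prod_def)
  then have "negligible N"
    unfolding N_def by (intro negligible_Un negligible_graph[OF H gt cont] side)
  then have "AE z in lebesgue. z \<notin> N"
    by (intro AE_not_in) (simp add: negligible_iff_null_sets)
  then show ?thesis
  proof eventually_elim
    case (elim z)
    have "z \<in> S" if "z \<in> cur_dom L H \<eta>"
    proof -
      have z: "fst z \<in> base L" "0 \<le> snd z" "snd z \<le> H + \<eta> (fst z)"
        using that by (simp_all add: cur_dom_eq[OF H gt])
      have "fst z $ i \<noteq> 0" "fst z $ i \<noteq> L $ i" for i
        using elim by (auto simp: N_def inner_prod_def inner_axis')
      then have "\<forall>i. 0 < fst z $ i \<and> fst z $ i < L $ i"
        using z(1) by (auto simp: base_def less_le)
      moreover have "snd z \<noteq> 0" "fst z \<in> base L \<Longrightarrow> snd z \<noteq> H + \<eta> (fst z)"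
        using elim by (auto simp: N_def inner_prod_def)
      ultimately show ?thesis
        using z by (auto simp: S_def interior_base less_le)
    qed
    then show ?case using S interior_subset by blast
  qed
qed

section \<open>The divergence of the mesh velocity\<close>

lemma Ck_ident: "Ck n (\<lambda>x. x)"
proof (cases n)
  case (Suc m)
  show ?thesis unfolding Suc
    by (rule Ck_SucI[where F = "\<lambda>x h. h"]) (auto intro: Ck_const)
qed (simp add: continuous_on_id)

lemma Cc_integrable_bounded:
  fixes \<phi> A :: "'a::euclidean_space \<Rightarrow> real"
  assumes "\<phi> \<in> Cc U" "A \<in> borel_measurable borel" "\<And>x. \<bar>A x\<bar> \<le> M"
  shows "integrable lebesgue (\<lambda>x. A x * \<phi> x)"
proof -
  have "integrable lebesgue \<phi>"
    using Cc_L1_loc_integrable[OF assms(1), of "\<lambda>_. 1::real"] L1_loc_continuous[of U "\<lambda>_. 1::real"] by simp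
  then show ?thesis
    using integrable_scaleR_bounded[of lebesgue \<phi> A M] assms by (simp add: measurable_completion)
qed

text \<open>
The mesh velocity is \<open>a(r) x\<^sub>d\<close> in the vertical direction, so its divergence is \<open>a(r)\<close>, and this is
\<open>(1 - J) / \<tau>\<close>. The displacements are continuous only, but no horizontal derivative occurs.
\<close>

theorem has_weak_div_mesh_vel:
  fixes \<eta> \<eta>' :: "real^'n \<Rightarrow> real"
  assumes H: "H > 0" and \<tau>: "\<tau> > 0" and gt: "\<forall>r\<in>base L. \<eta> r > - H"
    and cont: "continuous_on (base L) \<eta>'" "continuous_on (base L) \<eta>"
  shows "has_weak_div (interior (cur_dom L H \<eta>)) (mesh_vel H \<tau> \<eta>' \<eta>) (\<lambda>z. (1 - jac H \<eta>' \<eta> z) / \<tau>)"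
proof -
  let ?U = "interior (cur_dom L H \<eta>)"
  define a where "a r = (\<eta> r - \<eta>' r) / \<tau> / (H + \<eta> r)" for r
  \<comment> \<open>\<open>a\<close> cut off to the base, where it is bounded and measurable\<close>
  define A where "A z = indicat_real (base L) (fst z) *\<^sub>R a (fst z)" for z :: "(real^'n) \<times> real"
  have UB: "fst z \<in> base L" if "z \<in> ?U" for z
    using that interior_subset[of "cur_dom L H \<eta>"] cur_dom_eq[OF H gt] by auto
  have nz: "H + \<eta> r \<noteq> 0" if "r \<in> base L" for r using bspec[OF gt that] by simp
  have a_cont: "continuous_on (base L) a"
    unfolding a_def using nz \<tau> by (intro continuous_intros cont) auto
  have aU: "continuous_on ?U (\<lambda>z. a (fst z))"
    by (rule continuous_on_compose2[OF a_cont]) (auto intro!: continuous_intros UB)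
  have w: "mesh_vel H \<tau> \<eta>' \<eta> z = (snd z * a (fst z)) *\<^sub>R (0, 1)" for z
    by (simp add: mesh_vel_def a_def split: prod.splits)
  have j: "(1 - jac H \<eta>' \<eta> z) / \<tau> = a (fst z)" if "z \<in> ?U" for z
  proof -
    have "jac H \<eta>' \<eta> z = (H + \<eta>' (fst z)) / (H + \<eta> (fst z))"
      by (simp add: jac_def case_prod_unfold)
    moreover have "1 - (H + \<eta>' (fst z)) / (H + \<eta> (fst z)) = (\<eta> (fst z) - \<eta>' (fst z)) / (H + \<eta> (fst z))"
      using nz[OF UB[OF that]] by (simp add: field_simps)
    ultimately show ?thesis by (simp add: a_def)
  qed
  obtain M where M: "\<And>z. \<bar>A z\<bar> \<le> M"
  proof -
    have "bounded (a ` base L)"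
      using compact_continuous_image[OF a_cont compact_base] by (rule compact_imp_bounded)
    then obtain M where "M > 0" "\<forall>y\<in>a ` base L. norm y \<le> M" using bounded_pos by metis
    then show ?thesis by (intro that[of M]) (auto simp: A_def indicator_def)
  qed
  have A: "A \<in> borel_measurable borel"
  proof -
    have "(\<lambda>r. indicat_real (base L) r *\<^sub>R a r) \<in> borel_measurable borel"
      using a_cont compact_base by (intro borel_measurable_continuous_on_indicator borel_compact)
    then show ?thesis
      unfolding A_def[abs_def] by (rule measurable_stretch(2))
  qed
  show ?thesis
    unfolding has_weak_div_iff
  proof (intro conjI allI impI)
    show "mesh_vel H \<tau> \<eta>' \<eta> \<in> L1_loc ?U"
      unfolding w[abs_def] by (intro L1_loc_continuous continuous_intros aU)
    have "continuous_on ?U (\<lambda>z. (1 - jac H \<eta>' \<eta> z) / \<tau>) \<longleftrightarrow> continuous_on ?U (\<lambda>z. a (fst z))"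
      using j by (intro continuous_on_cong) auto
    then show "(\<lambda>z. (1 - jac H \<eta>' \<eta> z) / \<tau>) \<in> L1_loc ?U"
      using aU by (intro L1_loc_continuous) simp
    fix \<phi> :: "(real^'n) \<times> real \<Rightarrow> real" assume \<phi>: "\<phi> \<in> test_functions ?U"
    \<comment> \<open>the vertical derivative of \<open>\<psi>\<close> produces both \<open>\<phi>\<close> and \<open>x\<^sub>d\<close> times the derivative of \<open>\<phi>\<close>\<close>
    define \<psi> where "\<psi> z = \<phi> z * snd z" for z
    have "smooth (snd :: (real^'n) \<times> real \<Rightarrow> real)"
      by (intro allI Ck_bounded_linear[OF bounded_linear_snd Ck_ident])
    then have \<psi>: "\<psi> \<in> test_functions ?U"
      unfolding \<psi>_def[abs_def] using test_functions_bilinear[OF bounded_bilinear_mult \<phi>] by blast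
    have d\<psi>: "fderiv \<psi> z (0, 1) = \<phi> z + fderiv \<phi> z (0, 1) * snd z" for z
    proof -
      have "(\<psi> has_derivative (\<lambda>h. \<phi> z * snd h + fderiv \<phi> z h * snd z)) (at z)"
        unfolding \<psi>_def[abs_def]
        by (intro has_derivative_mult test_functions_has_derivative[OF \<phi>] has_derivative_snd has_derivative_ident)
      from frechet_derivative_at[OF this, symmetric] show ?thesis by simp
    qed
    \<comment> \<open>\<open>A\<close> does not depend on the vertical variable, so the integral of \<open>A\<close> times a vertical
      derivative vanishes.\<close>
    have zero: "(LINT z|lebesgue. A z * fderiv \<psi> z (0, 1)) = 0"
    proof (rule integral_invariant_mult_derivative[OF _ A M])
      show "\<psi> \<in> test_functions UNIV" using \<psi> by (auto simp: test_functions_def)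
      show "A (z + t *\<^sub>R (0, 1)) = A z" for z t by (simp add: A_def)
    qed
    have eq1: "fderiv \<phi> z (mesh_vel H \<tau> \<eta>' \<eta> z) = A z * fderiv \<psi> z (0, 1) - A z * \<phi> z" for z
    proof (cases "z \<in> ?U")
      case True
      have "fderiv \<phi> z ((snd z * a (fst z)) *\<^sub>R (0, 1)) = (snd z * a (fst z)) *\<^sub>R fderiv \<phi> z (0, 1)"
        using has_derivative_linear[OF test_functions_has_derivative[OF \<phi>]] by (rule linear_cmul)
      then show ?thesis
        using UB[OF True] by (simp add: w d\<psi> A_def algebra_simps)
    next
      case False
      then show ?thesis using test_functions_outside[OF \<phi> False] test_functions_outside[OF \<psi> False] by simp
    qed
    have eq2: "A z * \<phi> z = \<phi> z * ((1 - jac H \<eta>' \<eta> z) / \<tau>)" for z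
      using j[of z] UB[of z] test_functions_outside(1)[OF \<phi>, of z] by (cases "z \<in> ?U") (auto simp: A_def)
    have "(LINT z|lebesgue. fderiv \<phi> z (mesh_vel H \<tau> \<eta>' \<eta> z)) = 0 - (LINT z|lebesgue. A z * \<phi> z)"
      unfolding eq1 zero[symmetric]
      by (intro Bochner_Integration.integral_diff Cc_integrable_bounded[OF test_functions_Cc[OF \<phi>] A M]
          Cc_integrable_bounded[OF test_functions_Cc[OF test_functions_deriv[OF \<psi>]] A M])
    then show "(LINT z|lebesgue. fderiv \<phi> z (mesh_vel H \<tau> \<eta>' \<eta> z))
        = - (LINT z|lebesgue. \<phi> z * ((1 - jac H \<eta>' \<eta> z) / \<tau>))"
      by (simp add: eq2)
  qed
qed

section \<open>The renormalized balance\<close>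

text \<open>
The two integrals agree even if neither exists, since the default value is the same.
\<close>

lemma set_integral_cong_AE_set:
  fixes f :: "'a::euclidean_space \<Rightarrow> 'b::euclidean_space"
  assumes "AE x in lebesgue. x \<in> S \<longleftrightarrow> x \<in> S'"
  shows "set_integrable lebesgue S f \<longleftrightarrow> set_integrable lebesgue S' f"
    "(LINT x:S|lebesgue. f x) = (LINT x:S'|lebesgue. f x)"
proof -
  have ae: "AE x in lebesgue. indicat_real S x *\<^sub>R f x = indicat_real S' x *\<^sub>R f x"
    using assms by eventually_elim (auto simp: indicator_def)
  have ae': "AE x in lebesgue. indicat_real S' x *\<^sub>R f x = indicat_real S x *\<^sub>R f x"
    using assms by eventually_elim (auto simp: indicator_def)
  show iff: "set_integrable lebesgue S f \<longleftrightarrow> set_integrable lebesgue S' f"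
    unfolding set_integrable_def
    using integrable_lebesgue_cong_AE(1)[OF ae] integrable_lebesgue_cong_AE(1)[OF ae'] by blast
  show "(LINT x:S|lebesgue. f x) = (LINT x:S'|lebesgue. f x)"
  proof (cases "set_integrable lebesgue S f")
    case True
    then show ?thesis
      unfolding set_integrable_def set_lebesgue_integral_def
      by (rule integrable_lebesgue_cong_AE(2)[OF ae, symmetric])
  next
    case False
    with iff show ?thesis
      by (simp add: set_integrable_def set_lebesgue_integral_def not_integrable_integral_eq)
  qed
qed

lemma wgrad_chain_rule:
  fixes f :: "'a::euclidean_space \<Rightarrow> real"
  assumes U: "open U" and f: "\<forall>b\<in>Basis. \<exists>h. has_weak_deriv U b f h"
    and Bf: "\<forall>b\<in>Basis. \<exists>h. has_weak_deriv U b (\<lambda>x. B (f x)) h"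
    and B: "\<And>s. (B has_real_derivative B' s) (at s)"
  shows "AE x in lebesgue. x \<in> U \<longrightarrow> wgrad U (\<lambda>x. B (f x)) x = B' (f x) *\<^sub>R wgrad U f x"
proof -
  have "AE x in lebesgue. \<forall>b\<in>Basis. x \<in> U \<longrightarrow> wderiv U b (\<lambda>x. B (f x)) x = B' (f x) * wderiv U b f x"
  proof (intro AE_finite_allI finite_Basis)
    fix b :: 'a assume b: "b \<in> Basis"
    obtain h h' where "has_weak_deriv U b f h" "has_weak_deriv U b (\<lambda>x. B (f x)) h'"
      using f Bf b by blast
    then show "AE x in lebesgue. x \<in> U \<longrightarrow> wderiv U b (\<lambda>x. B (f x)) x = B' (f x) * wderiv U b f x"
      by (intro weak_chain_rule[OF U b _ _ B] has_weak_deriv_wderiv)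
  qed
  then show ?thesis
    by eventually_elim (auto simp: wgrad_def scaleR_sum_right intro!: sum.cong)
qed

theorem lemma3p2:
  fixes L :: "real^'n" and H T \<tau> \<gamma> :: real and N k :: nat
    and W :: "(real^'n \<Rightarrow> real) set"
    and Q :: "((real^'n) \<times> real) set \<Rightarrow> ((real^'n) \<times> real \<Rightarrow> real) set"
    and V :: "((real^'n) \<times> real) set \<Rightarrow> ((real^'n) \<times> real \<Rightarrow> (real^'n) \<times> real) set"
    and \<eta> :: "nat \<Rightarrow> real^'n \<Rightarrow> real"
    and \<rho> :: "nat \<Rightarrow> (real^'n) \<times> real \<Rightarrow> real"
    and u w v :: "nat \<Rightarrow> (real^'n) \<times> real \<Rightarrow> (real^'n) \<times> real"
    and \<Omega> U :: "nat \<Rightarrow> ((real^'n) \<times> real) set"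
    and B :: "real \<Rightarrow> real"
  assumes dim: "CARD('n) + 1 \<in> {2, 3}"
    and pos: "H > 0" "\<forall>i. L $ i > 0" "T > 0" "N \<ge> 1" "\<gamma> > 1"
    and tau: "\<tau> = T / real N"
    \<comment> \<open>displacements\<close>
    and W: "W \<subseteq> sobolev0 2 2 (interior (base L))"
    and eta_W: "\<forall>j\<le>N. \<eta> j \<in> W \<and> continuous_on (base L) (\<eta> j)"
    and eta_gt: "\<forall>j\<le>N. \<forall>r\<in>base L. \<eta> j r > - H"
    \<comment> \<open>domains, mesh velocity and relative velocity\<close>
    and Omega: "\<forall>j. \<Omega> j = cur_dom L H (\<eta> j)" "\<forall>j. U j = interior (\<Omega> j)"
    and w: "\<forall>j\<in>{1..N}. w j = mesh_vel H \<tau> (\<eta> (j - 1)) (\<eta> j)"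
    and v: "\<forall>j\<in>{1..N}. \<forall>x. v j x = u j x - w j x"
    \<comment> \<open>density and velocity\<close>
    and Q: "\<forall>j\<le>N. Q (\<Omega> j) \<subseteq> Lp \<gamma> (\<Omega> j)" "\<forall>j\<le>N. \<rho> j \<in> Q (\<Omega> j)"
    and V: "\<forall>j\<in>{1..N}. V (\<Omega> j) \<subseteq> vel (U j)" "\<forall>j\<in>{1..N}. u j \<in> V (\<Omega> j)"
    \<comment> \<open>\<open>u = w\<close> on the boundary\<close>
    and bc: "\<forall>j\<in>{1..N}. v j \<in> vel0 (U j)"
    \<comment> \<open>semi-discrete continuity equation\<close>
    and div_exists: "\<forall>j\<in>{1..N}. \<exists>h. has_weak_div (U j) (\<lambda>x. \<rho> j x *\<^sub>R v j x) h"
    and continuity: "\<forall>j\<in>{1..N}. \<forall>\<phi>\<in>Q (\<Omega> j).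
        set_integrable lebesgue (\<Omega> j)
          (\<lambda>x. disc_dt L H \<tau> (\<eta> (j - 1)) (\<eta> j) (\<rho> (j - 1)) (\<rho> j) x * \<phi> x) \<longrightarrow>
        set_integrable lebesgue (\<Omega> j)
          (\<lambda>x. wdiv (U j) (\<lambda>y. \<rho> j y *\<^sub>R v j y) x * \<phi> x) \<longrightarrow>
        (LINT x:\<Omega> j|lebesgue.
            disc_dt L H \<tau> (\<eta> (j - 1)) (\<eta> j) (\<rho> (j - 1)) (\<rho> j) x * \<phi> x)
        + (LINT x:\<Omega> j|lebesgue. wdiv (U j) (\<lambda>y. \<rho> j y *\<^sub>R v j y) x * \<phi> x) = 0"
    and B: "B C1_differentiable_on UNIV"
    and k: "k \<in> {1..N}"
    \<comment> \<open>the test function \<open>B'(\<rho>)\<close> is admissible\<close>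
    and test_adm: "(\<lambda>x. deriv B (\<rho> k x)) \<in> Q (\<Omega> k)"
      "set_integrable lebesgue (\<Omega> k)
         (\<lambda>x. disc_dt L H \<tau> (\<eta> (k - 1)) (\<eta> k) (\<rho> (k - 1)) (\<rho> k) x * deriv B (\<rho> k x))"
      "set_integrable lebesgue (\<Omega> k)
         (\<lambda>x. wdiv (U k) (\<lambda>y. \<rho> k y *\<^sub>R v k y) x * deriv B (\<rho> k x))"
    \<comment> \<open>the integrals in the assertion are well defined\<close>
    and int_adm: "set_integrable lebesgue (\<Omega> k) (\<lambda>x. B (\<rho> k x))"
      "set_integrable lebesgue (\<Omega> (k - 1)) (\<lambda>x. B (\<rho> (k - 1) x))"
      "set_integrable lebesgue (\<Omega> k)
         (\<lambda>x. (\<rho> k x * deriv B (\<rho> k x) - B (\<rho> k x)) * wdiv (U k) (u k) x)"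
      "set_integrable lebesgue (\<Omega> k)
         (D0_integrand L H B (\<eta> (k - 1)) (\<eta> k) (\<rho> (k - 1)) (\<rho> k))"
    \<comment> \<open>integrations by parts are admissible for \<open>\<rho>\<close> and \<open>B(\<rho>)\<close>\<close>
    and ibp_adm: "\<forall>g\<in>{\<rho> k, \<lambda>x. B (\<rho> k x)}. green_admissible (U k) g \<and>
        set_integrable lebesgue (U k) (\<lambda>x. g x * wdiv (U k) (v k) x) \<and>
        set_integrable lebesgue (U k) (\<lambda>x. wgrad (U k) g x \<bullet> v k x)"
  shows "1 / \<tau> * ((LINT x:\<Omega> k|lebesgue. B (\<rho> k x))
                   - (LINT x:\<Omega> (k - 1)|lebesgue. B (\<rho> (k - 1) x)))
         + (LINT x:\<Omega> k|lebesgue.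
              (\<rho> k x * deriv B (\<rho> k x) - B (\<rho> k x)) * wdiv (U k) (u k) x)
         + D0 L H \<tau> B (\<eta> (k - 1)) (\<eta> k) (\<rho> (k - 1)) (\<rho> k) = 0
       \<and> (convex_on UNIV B \<longrightarrow> D0 L H \<tau> B (\<eta> (k - 1)) (\<eta> k) (\<rho> (k - 1)) (\<rho> k) \<ge> 0)"
proof -
  define J X B' where "J = jac H (\<eta> (k - 1)) (\<eta> k)" and "X = back_map L H (\<eta> (k - 1)) (\<eta> k)" and "B' = deriv B"
  define du dv dw where "du = wdiv (U k) (u k)" and "dv = wdiv (U k) (v k)"
    and "dw = wdiv (U k) (\<lambda>y. \<rho> k y *\<^sub>R v k y)"
  have kN: "k \<le> N" "k - 1 \<le> N" and k1: "k \<in> {1..N}" using k by auto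
  have \<tau>: "\<tau> > 0" using pos tau by simp
  have \<Omega>: "\<Omega> j = cur_dom L H (\<eta> j)" "U j = interior (\<Omega> j)" for j using Omega by auto
  have cont: "continuous_on (base L) (\<eta> (k - 1))" "continuous_on (base L) (\<eta> k)"
    and gt': "\<forall>r\<in>base L. \<eta> (k - 1) r > - H" and gt: "\<forall>r\<in>base L. \<eta> k r > - H"
    using eta_W eta_gt kN by auto
  have Uo: "open (U k)" by (simp add: \<Omega>)
  have \<Omega>U: "AE x in lebesgue. x \<in> \<Omega> k \<longleftrightarrow> x \<in> U k"
    using cur_dom_interior_AE[OF pos(1) gt cont(2)] by (simp add: \<Omega>)
  note onU = set_integral_cong_AE_set[OF \<Omega>U]
  have B': "(B has_real_derivative B' s) (at s)" for s
  proof -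
    obtain D where "(B has_vector_derivative D) (at s)"
      using B by (auto simp: C1_differentiable_on_def)
    then show ?thesis
      using DERIV_imp_deriv by (auto simp: B'_def has_real_derivative_iff_has_vector_derivative[symmetric])
  qed
  have vk: "v k \<in> vel0 (U k)" using bc k1 by blast
  have uk: "u k \<in> vel (U k)" using V k1 by blast

  have green: "green_admissible (U k) (\<rho> k)" "green_admissible (U k) (\<lambda>x. B (\<rho> k x))"
    and int_\<rho>: "set_integrable lebesgue (U k) (\<lambda>x. \<rho> k x * dv x)"
      "set_integrable lebesgue (U k) (\<lambda>x. wgrad (U k) (\<rho> k) x \<bullet> v k x)"
    and int_B: "set_integrable lebesgue (U k) (\<lambda>x. B (\<rho> k x) * dv x)"
      "set_integrable lebesgue (U k) (\<lambda>x. wgrad (U k) (\<lambda>x. B (\<rho> k x)) x \<bullet> v k x)"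
    using ibp_adm by (auto simp: dv_def)

  have product: "AE x in lebesgue. x \<in> U k \<longrightarrow> dw x = \<rho> k x * dv x + wgrad (U k) (\<rho> k) x \<bullet> v k x"
  proof -
    obtain h where "has_weak_div (U k) (\<lambda>x. \<rho> k x *\<^sub>R v k x) h" using div_exists k1 by blast
    then show ?thesis
      unfolding dw_def dv_def
      using int_\<rho> by (intro wdiv_product_rule[OF Uo vk green(1)]) (auto simp: dv_def)
  qed
  have chain: "AE x in lebesgue. x \<in> U k \<longrightarrow>
      wgrad (U k) (\<lambda>x. B (\<rho> k x)) x = B' (\<rho> k x) *\<^sub>R wgrad (U k) (\<rho> k) x"
    using green unfolding green_admissible_def by (intro wgrad_chain_rule[OF Uo _ _ B']) auto
  have mesh: "AE x in lebesgue. x \<in> U k \<longrightarrow> du x = dv x + (1 - J x) / \<tau>"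
  proof -
    have "has_weak_div (U k) (\<lambda>x. u k x - v k x) (\<lambda>x. du x - dv x)"
      unfolding du_def dv_def by (intro has_weak_div_diff vel_has_weak_div uk vel0_vel vk)
    moreover have "(\<lambda>x. u k x - v k x) = mesh_vel H \<tau> (\<eta> (k - 1)) (\<eta> k)"
      using v w k1 by (auto simp: fun_eq_iff)
    ultimately have "AE x in lebesgue. x \<in> U k \<longrightarrow> du x - dv x = (1 - J x) / \<tau>"
      using has_weak_div_unique[OF Uo] has_weak_div_mesh_vel[OF pos(1) \<tau> gt cont] by (simp add: \<Omega> J_def)
    then show ?thesis by eventually_elim auto
  qed

  \<comment> \<open>the part of the balance that Green's formula for \<open>B(\<rho>)\<close> removes\<close>
  define Z where "Z x = wgrad (U k) (\<lambda>x. B (\<rho> k x)) x \<bullet> v k x + B (\<rho> k x) * dv x" for x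
  have Z: "set_integrable lebesgue (U k) Z" "(LINT x:U k|lebesgue. Z x) = 0"
  proof -
    show "set_integrable lebesgue (U k) Z"
      unfolding Z_def using int_B by (intro set_integral_add)
    have "(LINT x:U k|lebesgue. B (\<rho> k x) * dv x) = - (LINT x:U k|lebesgue. wgrad (U k) (\<lambda>x. B (\<rho> k x)) x \<bullet> v k x)"
      using green(2) vk int_B unfolding green_admissible_def dv_def by blast
    then show "(LINT x:U k|lebesgue. Z x) = 0"
      unfolding Z_def using int_B by (simp add: set_integral_add)
  qed

  \<comment> \<open>These combinations are integrable by hypothesis or by the transformation formula; the integrands
    are regrouped into them before integrating.\<close>
  let ?C = "\<lambda>x. disc_dt L H \<tau> (\<eta> (k - 1)) (\<eta> k) (\<rho> (k - 1)) (\<rho> k) x * B' (\<rho> k x)"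
  let ?P = "\<lambda>x. dw x * B' (\<rho> k x)"
  let ?E = "\<lambda>x. (\<rho> k x * B' (\<rho> k x) - B (\<rho> k x)) * du x"
  let ?D = "D0_integrand L H B (\<eta> (k - 1)) (\<eta> k) (\<rho> (k - 1)) (\<rho> k)"
  let ?T = "\<lambda>x. J x * B (\<rho> (k - 1) (X x))"
  have transport: "set_integrable lebesgue (\<Omega> k) ?T"
    "(LINT x:\<Omega> k|lebesgue. ?T x) = (LINT x:\<Omega> (k - 1)|lebesgue. B (\<rho> (k - 1) x))"
    unfolding \<Omega> J_def X_def
    using transport_integral[OF pos(1) gt' gt cont int_adm(2)[unfolded \<Omega>]] by auto
  have split: "?C x = 1 / \<tau> * (?D x + B (\<rho> k x) - ?T x) + (\<rho> k x * B' (\<rho> k x) - B (\<rho> k x)) * ((1 - J x) / \<tau>)" for x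
    using \<tau> by (simp add: disc_dt_def D0_integrand_def J_def X_def B'_def field_simps)
  have pointwise: "AE x in lebesgue. x \<in> U k \<longrightarrow> 1 / \<tau> * (?D x + B (\<rho> k x) - ?T x) + ?E x + Z x = ?C x + ?P x"
    using product chain mesh
  proof eventually_elim
    case (elim x)
    show ?case
    proof
      assume "x \<in> U k"
      with elim show "1 / \<tau> * (?D x + B (\<rho> k x) - ?T x) + ?E x + Z x = ?C x + ?P x"
        unfolding split Z_def by (simp add: algebra_simps)
    qed
  qed
  have int_C: "set_integrable lebesgue (U k) ?C" "set_integrable lebesgue (U k) ?P"
    using test_adm(2,3) by (simp_all add: onU(1)[symmetric] B'_def dw_def)
  have int_D: "set_integrable lebesgue (U k) ?D" "set_integrable lebesgue (U k) (\<lambda>x. B (\<rho> k x))"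
    "set_integrable lebesgue (U k) ?T" "set_integrable lebesgue (U k) ?E"
    using int_adm(1,3,4) transport(1) by (simp_all add: onU(1)[symmetric] B'_def du_def)
  have int_DB: "set_integrable lebesgue (U k) (\<lambda>x. ?D x + B (\<rho> k x))"
    using int_D(1,2) by (rule set_integral_add(1))
  have int_DBT: "set_integrable lebesgue (U k) (\<lambda>x. ?D x + B (\<rho> k x) - ?T x)"
    using int_DB int_D(3) by (rule set_integral_diff(1))
  have int_DBTE: "set_integrable lebesgue (U k) (\<lambda>x. 1 / \<tau> * (?D x + B (\<rho> k x) - ?T x))"
    "set_integrable lebesgue (U k) (\<lambda>x. 1 / \<tau> * (?D x + B (\<rho> k x) - ?T x) + ?E x)"
    using set_integrable_mult_right[OF int_DBT, of "1 / \<tau>"] set_integral_add(1)[OF _ int_D(4)] by auto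
  have int_sum: "set_integrable lebesgue (U k) (\<lambda>x. 1 / \<tau> * (?D x + B (\<rho> k x) - ?T x) + ?E x + Z x)"
    using int_DBTE(2) Z(1) by (rule set_integral_add(1))
  have "(LINT x:U k|lebesgue. ?C x) + (LINT x:U k|lebesgue. ?P x) = 0"
    unfolding onU(2)[symmetric] B'_def dw_def by (rule continuity[rule_format, OF k1 test_adm])
  then have "(LINT x:U k|lebesgue. ?C x + ?P x) = 0"
    using set_integral_add(2)[OF int_C] by simp
  moreover have "(LINT x:U k|lebesgue. ?C x + ?P x) = (LINT x:U k|lebesgue. 1 / \<tau> * (?D x + B (\<rho> k x) - ?T x) + ?E x + Z x)"
    by (rule set_integrable_lebesgue_cong_AE(2)[OF pointwise int_sum])
  moreover have "\<dots> =
      1 / \<tau> * ((LINT x:U k|lebesgue. ?D x) + (LINT x:U k|lebesgue. B (\<rho> k x)) - (LINT x:U k|lebesgue. ?T x))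
      + (LINT x:U k|lebesgue. ?E x) + (LINT x:U k|lebesgue. Z x)"
    using int_DB int_DBT int_DBTE Z(1) int_D
    by (simp only: set_integral_add(2) set_integral_diff(2) set_integral_mult_right)
  ultimately have balance: "1 / \<tau> * ((LINT x:\<Omega> k|lebesgue. ?D x) + (LINT x:\<Omega> k|lebesgue. B (\<rho> k x))
      - (LINT x:\<Omega> (k - 1)|lebesgue. B (\<rho> (k - 1) x))) + (LINT x:\<Omega> k|lebesgue. ?E x) = 0"
    using Z(2) transport(2) by (simp add: onU(2))
  have "D0 L H \<tau> B (\<eta> (k - 1)) (\<eta> k) (\<rho> (k - 1)) (\<rho> k) \<ge> 0" if convex: "convex_on UNIV B"
  proof -
    have "?D x \<ge> 0" if x: "x \<in> \<Omega> k" for x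
    proof -
      have "J x \<ge> 0"
        using ratio_pos[OF gt' gt, of "fst x"] back_map_stretch(2)[OF pos(1) gt, of x "\<eta> (k - 1)"] x
        by (simp add: \<Omega> J_def)
      moreover have "B (\<rho> (k - 1) (X x)) - B (\<rho> k x) \<ge> B' (\<rho> k x) * (\<rho> (k - 1) (X x) - \<rho> k x)"
        using B' by (intro convex_on_imp_above_tangent[OF convex]) auto
      ultimately show ?thesis
        by (simp add: D0_integrand_def J_def X_def B'_def)
    qed
    then have "(LINT x:\<Omega> k|lebesgue. ?D x) \<ge> 0"
      unfolding set_lebesgue_integral_def
      by (intro Bochner_Integration.integral_nonneg) (auto simp: indicator_def)
    then show ?thesis
      using \<tau> by (simp add: D0_def \<Omega>)
  qed
  moreover have "1 / \<tau> * ((LINT x:\<Omega> k|lebesgue. B (\<rho> k x)) - (LINT x:\<Omega> (k - 1)|lebesgue. B (\<rho> (k - 1) x)))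
      + (LINT x:\<Omega> k|lebesgue. ?E x) + D0 L H \<tau> B (\<eta> (k - 1)) (\<eta> k) (\<rho> (k - 1)) (\<rho> k) = 0"
    using balance by (simp add: D0_def \<Omega> algebra_simps)
  ultimately show ?thesis
    by (simp add: B'_def du_def)
qed

end
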